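(* Let $\mathfrak{A},\mathfrak{B}$ be small 2-categories. Given a pseudofunctor $T:\mathfrak{A}^{\mathrm{op}}\times\mathfrak{B}^{\mathrm{op}}\times\mathfrak{A}\times\mathfrak{B}\to\mathsf{CAT}$, there are pseudofunctors $T^{\mathfrak{B}}:\mathfrak{A}^{\mathrm{op}}\times\mathfrak{A}\to\mathsf{CAT}$ and $T^{\mathfrak{A}}:\mathfrak{B}^{\mathrm{op}}\times\mathfrak{B}\to\mathsf{CAT}$ such that $$T^{\mathfrak{B}}(X,Y)\cong\int_{b\in\mathfrak{B}}T(X,b,Y,b)\quad\text{and}\quad T^{\mathfrak{A}}(W,Z)\cong\int_{a\in\mathfrak{A}}T(a,W,a,Z).$$ Furthermore, $$\int_{\mathfrak{A}\times\mathfrak{B}}T\simeq\int_{\mathfrak{A}}T^{\mathfrak{B}}\simeq\int_{\mathfrak{B}}T^{\mathfrak{A}}.$$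
   Context: $[\mathfrak{X},\mathfrak{Y}]_{PS}$ denotes the 2-category of pseudofunctors $\mathfrak{X}\to\mathfrak{Y}$, pseudonatural transformations and modifications, and $\mathsf{CAT}$ the 2-category of categories. For a small 2-category $\mathfrak{X}$, the pseudoend of a pseudofunctor $S:\mathfrak{X}^{\mathrm{op}}\times\mathfrak{X}\to\mathsf{CAT}$ is the category $$\int_{x\in\mathfrak{X}}S(x,x)=\int_{\mathfrak{X}}S:=[\mathfrak{X}^{\mathrm{op}}\times\mathfrak{X},\mathsf{CAT}]_{PS}(\mathfrak{X}(-,-),S).$$ For $\int_{\mathfrak{A}\times\mathfrak{B}}T$, regard $T$ as a pseudofunctor $(\mathfrak{A}\times\mathfrak{B})^{\mathrm{op}}\times(\mathfrak{A}\times\mathfrak{B})\to\mathsf{CAT}$. *)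

theory Defs
  imports "HOL-Library.FuncSet"
begin

section \<open>Categories, functors, natural transformations\<close>

text \<open>
  Categories and 2-categories are given by carrier sets inside HOL types. Operations are only constrained on the carriers; \<open>Comp C g f\<close> is
  \<open>g\<close> after \<open>f\<close>.
\<close>

record ('o, 'm) cat =
  Obj :: "'o set"
  Arr :: "'m set"
  Dom :: "'m \<Rightarrow> 'o"
  Cod :: "'m \<Rightarrow> 'o"
  Idn :: "'o \<Rightarrow> 'm"
  Comp :: "'m \<Rightarrow> 'm \<Rightarrow> 'm"

locale category =
  fixes C :: "('o, 'm) cat"
  assumes Dom_in: "f \<in> Arr C \<Longrightarrow> Dom C f \<in> Obj C"
    and Cod_in: "f \<in> Arr C \<Longrightarrow> Cod C f \<in> Obj C"
    and Idn_in: "x \<in> Obj C \<Longrightarrow> Idn C x \<in> Arr C"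
    and Dom_Idn: "x \<in> Obj C \<Longrightarrow> Dom C (Idn C x) = x"
    and Cod_Idn: "x \<in> Obj C \<Longrightarrow> Cod C (Idn C x) = x"
    and Comp_in: "\<lbrakk>f \<in> Arr C; g \<in> Arr C; Cod C f = Dom C g\<rbrakk> \<Longrightarrow> Comp C g f \<in> Arr C"
    and Dom_Comp: "\<lbrakk>f \<in> Arr C; g \<in> Arr C; Cod C f = Dom C g\<rbrakk> \<Longrightarrow> Dom C (Comp C g f) = Dom C f"
    and Cod_Comp: "\<lbrakk>f \<in> Arr C; g \<in> Arr C; Cod C f = Dom C g\<rbrakk> \<Longrightarrow> Cod C (Comp C g f) = Cod C g"
    and Comp_Idn: "f \<in> Arr C \<Longrightarrow> Comp C f (Idn C (Dom C f)) = f"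
    and Idn_Comp: "f \<in> Arr C \<Longrightarrow> Comp C (Idn C (Cod C f)) f = f"
    and Comp_assoc: "\<lbrakk>f \<in> Arr C; g \<in> Arr C; h \<in> Arr C; Cod C f = Dom C g; Cod C g = Dom C h\<rbrakk>
      \<Longrightarrow> Comp C h (Comp C g f) = Comp C (Comp C h g) f"

definition iso_arr :: "('o, 'm) cat \<Rightarrow> 'm \<Rightarrow> bool" where
  "iso_arr C f \<longleftrightarrow> f \<in> Arr C \<and> (\<exists>g\<in>Arr C. Dom C g = Cod C f \<and> Cod C g = Dom C f \<and>
     Comp C g f = Idn C (Dom C f) \<and> Comp C f g = Idn C (Cod C f))"

text \<open>
  Functors carry their domain and codomain. Here and below, maps are required to be
  \<^const>\<open>extensional\<close> (\<^const>\<open>undefined\<close> off their carrier), so that HOL equality is the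
  mathematical equality of functors, transformations and modifications.
\<close>

record ('o1, 'm1, 'o2, 'm2) func =
  FDom :: "('o1, 'm1) cat"
  FCod :: "('o2, 'm2) cat"
  FObj :: "'o1 \<Rightarrow> 'o2"
  FArr :: "'m1 \<Rightarrow> 'm2"

locale is_functor =
  fixes F :: "('o1, 'm1, 'o2, 'm2) func"
  assumes category_FDom: "category (FDom F)"
    and category_FCod: "category (FCod F)"
    and FObj_ext: "FObj F \<in> extensional (Obj (FDom F))"
    and FArr_ext: "FArr F \<in> extensional (Arr (FDom F))"
    and FObj_in: "x \<in> Obj (FDom F) \<Longrightarrow> FObj F x \<in> Obj (FCod F)"
    and FArr_in: "f \<in> Arr (FDom F) \<Longrightarrow> FArr F f \<in> Arr (FCod F)"
    and Dom_FArr: "f \<in> Arr (FDom F) \<Longrightarrow> Dom (FCod F) (FArr F f) = FObj F (Dom (FDom F) f)"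
    and Cod_FArr: "f \<in> Arr (FDom F) \<Longrightarrow> Cod (FCod F) (FArr F f) = FObj F (Cod (FDom F) f)"
    and FArr_Idn: "x \<in> Obj (FDom F) \<Longrightarrow> FArr F (Idn (FDom F) x) = Idn (FCod F) (FObj F x)"
    and FArr_Comp: "\<lbrakk>f \<in> Arr (FDom F); g \<in> Arr (FDom F); Cod (FDom F) f = Dom (FDom F) g\<rbrakk>
      \<Longrightarrow> FArr F (Comp (FDom F) g f) = Comp (FCod F) (FArr F g) (FArr F f)"

definition id_func :: "('o, 'm) cat \<Rightarrow> ('o, 'm, 'o, 'm) func" where
  "id_func C = \<lparr>FDom = C, FCod = C, FObj = (\<lambda>x\<in>Obj C. x), FArr = (\<lambda>f\<in>Arr C. f)\<rparr>"

definition comp_func ::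
  "('o2, 'm2, 'o3, 'm3) func \<Rightarrow> ('o1, 'm1, 'o2, 'm2) func \<Rightarrow> ('o1, 'm1, 'o3, 'm3) func"
  (infixr "\<odot>" 75) where
  "G \<odot> F = \<lparr>FDom = FDom F, FCod = FCod G,
     FObj = (\<lambda>x\<in>Obj (FDom F). FObj G (FObj F x)),
     FArr = (\<lambda>f\<in>Arr (FDom F). FArr G (FArr F f))\<rparr>"

record ('o1, 'm1, 'o2, 'm2) ntrans =
  NDom :: "('o1, 'm1, 'o2, 'm2) func"
  NCod :: "('o1, 'm1, 'o2, 'm2) func"
  NMap :: "'o1 \<Rightarrow> 'm2"

locale is_ntrans =
  fixes \<alpha> :: "('o1, 'm1, 'o2, 'm2) ntrans"
  assumes functor_NDom: "is_functor (NDom \<alpha>)"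
    and functor_NCod: "is_functor (NCod \<alpha>)"
    and FDom_eq: "FDom (NCod \<alpha>) = FDom (NDom \<alpha>)"
    and FCod_eq: "FCod (NCod \<alpha>) = FCod (NDom \<alpha>)"
    and NMap_ext: "NMap \<alpha> \<in> extensional (Obj (FDom (NDom \<alpha>)))"
    and NMap_in: "x \<in> Obj (FDom (NDom \<alpha>)) \<Longrightarrow> NMap \<alpha> x \<in> Arr (FCod (NDom \<alpha>))"
    and Dom_NMap: "x \<in> Obj (FDom (NDom \<alpha>))
      \<Longrightarrow> Dom (FCod (NDom \<alpha>)) (NMap \<alpha> x) = FObj (NDom \<alpha>) x"
    and Cod_NMap: "x \<in> Obj (FDom (NDom \<alpha>))
      \<Longrightarrow> Cod (FCod (NDom \<alpha>)) (NMap \<alpha> x) = FObj (NCod \<alpha>) x"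
    and naturality: "f \<in> Arr (FDom (NDom \<alpha>)) \<Longrightarrow>
      Comp (FCod (NDom \<alpha>)) (NMap \<alpha> (Cod (FDom (NDom \<alpha>)) f)) (FArr (NDom \<alpha>) f) =
      Comp (FCod (NDom \<alpha>)) (FArr (NCod \<alpha>) f) (NMap \<alpha> (Dom (FDom (NDom \<alpha>)) f))"

definition id_nt :: "('o1, 'm1, 'o2, 'm2) func \<Rightarrow> ('o1, 'm1, 'o2, 'm2) ntrans" where
  "id_nt F = \<lparr>NDom = F, NCod = F, NMap = (\<lambda>x\<in>Obj (FDom F). Idn (FCod F) (FObj F x))\<rparr>"

definition vcomp_nt ::
  "('o1, 'm1, 'o2, 'm2) ntrans \<Rightarrow> ('o1, 'm1, 'o2, 'm2) ntrans \<Rightarrow> ('o1, 'm1, 'o2, 'm2) ntrans"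
  (infixr "\<bullet>" 65) where
  "\<beta> \<bullet> \<alpha> = \<lparr>NDom = NDom \<alpha>, NCod = NCod \<beta>,
     NMap = (\<lambda>x\<in>Obj (FDom (NDom \<alpha>)). Comp (FCod (NDom \<alpha>)) (NMap \<beta> x) (NMap \<alpha> x))\<rparr>"

definition hcomp_nt ::
  "('o2, 'm2, 'o3, 'm3) ntrans \<Rightarrow> ('o1, 'm1, 'o2, 'm2) ntrans \<Rightarrow> ('o1, 'm1, 'o3, 'm3) ntrans"
  (infixr "\<star>" 70) where
  "\<beta> \<star> \<alpha> = \<lparr>NDom = NDom \<beta> \<odot> NDom \<alpha>, NCod = NCod \<beta> \<odot> NCod \<alpha>,
     NMap = (\<lambda>x\<in>Obj (FDom (NDom \<alpha>)).
       Comp (FCod (NDom \<beta>)) (NMap \<beta> (FObj (NCod \<alpha>) x)) (FArr (NDom \<beta>) (NMap \<alpha> x)))\<rparr>"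

definition is_nat_iso :: "('o1, 'm1, 'o2, 'm2) ntrans \<Rightarrow> bool" where
  "is_nat_iso \<alpha> \<longleftrightarrow> is_ntrans \<alpha> \<and> (\<exists>\<beta>. is_ntrans \<beta> \<and> NDom \<beta> = NCod \<alpha> \<and> NCod \<beta> = NDom \<alpha> \<and>
     \<beta> \<bullet> \<alpha> = id_nt (NDom \<alpha>) \<and> \<alpha> \<bullet> \<beta> = id_nt (NCod \<alpha>))"

definition isomorphic_cat :: "('o1, 'm1) cat \<Rightarrow> ('o2, 'm2) cat \<Rightarrow> bool"
  (infix "\<cong>\<^sub>C" 50) where
  "C \<cong>\<^sub>C D \<longleftrightarrow> (\<exists>F G. is_functor F \<and> FDom F = C \<and> FCod F = D \<and>
     is_functor G \<and> FDom G = D \<and> FCod G = C \<and> G \<odot> F = id_func C \<and> F \<odot> G = id_func D)"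

definition equivalent_cat :: "('o1, 'm1) cat \<Rightarrow> ('o2, 'm2) cat \<Rightarrow> bool"
  (infix "\<simeq>\<^sub>C" 50) where
  "C \<simeq>\<^sub>C D \<longleftrightarrow> (\<exists>F G \<eta> \<epsilon>. is_functor F \<and> FDom F = C \<and> FCod F = D \<and>
     is_functor G \<and> FDom G = D \<and> FCod G = C \<and>
     is_nat_iso \<eta> \<and> NDom \<eta> = id_func C \<and> NCod \<eta> = G \<odot> F \<and>
     is_nat_iso \<epsilon> \<and> NDom \<epsilon> = F \<odot> G \<and> NCod \<epsilon> = id_func D)"


section \<open>2-categories and pseudofunctors\<close>

record ('a0, 'a1, 'a2) two_cat =
  C0 :: "'a0 set"
  C1 :: "'a1 set"
  C2 :: "'a2 set"
  Src :: "'a1 \<Rightarrow> 'a0"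
  Trg :: "'a1 \<Rightarrow> 'a0"
  Dom2 :: "'a2 \<Rightarrow> 'a1"
  Cod2 :: "'a2 \<Rightarrow> 'a1"
  Id1 :: "'a0 \<Rightarrow> 'a1"
  Id2 :: "'a1 \<Rightarrow> 'a2"
  Comp1 :: "'a1 \<Rightarrow> 'a1 \<Rightarrow> 'a1"
  VComp :: "'a2 \<Rightarrow> 'a2 \<Rightarrow> 'a2"
  HComp :: "'a2 \<Rightarrow> 'a2 \<Rightarrow> 'a2"

definition under_cat :: "('a0, 'a1, 'a2) two_cat \<Rightarrow> ('a0, 'a1) cat" where
  "under_cat X = \<lparr>Obj = C0 X, Arr = C1 X, Dom = Src X, Cod = Trg X, Idn = Id1 X, Comp = Comp1 X\<rparr>"

definition vert_cat :: "('a0, 'a1, 'a2) two_cat \<Rightarrow> ('a1, 'a2) cat" where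
  "vert_cat X = \<lparr>Obj = C1 X, Arr = C2 X, Dom = Dom2 X, Cod = Cod2 X, Idn = Id2 X, Comp = VComp X\<rparr>"

definition horiz_cat :: "('a0, 'a1, 'a2) two_cat \<Rightarrow> ('a0, 'a2) cat" where
  "horiz_cat X = \<lparr>Obj = C0 X, Arr = C2 X, Dom = (\<lambda>\<alpha>. Src X (Dom2 X \<alpha>)),
     Cod = (\<lambda>\<alpha>. Trg X (Dom2 X \<alpha>)), Idn = (\<lambda>x. Id2 X (Id1 X x)), Comp = HComp X\<rparr>"

locale two_category =
  fixes X :: "('a0, 'a1, 'a2) two_cat"
  assumes category_under: "category (under_cat X)"
    and category_vert: "category (vert_cat X)"
    and category_horiz: "category (horiz_cat X)"
    and Src_Cod2: "\<alpha> \<in> C2 X \<Longrightarrow> Src X (Cod2 X \<alpha>) = Src X (Dom2 X \<alpha>)"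
    and Trg_Cod2: "\<alpha> \<in> C2 X \<Longrightarrow> Trg X (Cod2 X \<alpha>) = Trg X (Dom2 X \<alpha>)"
    and Dom2_HComp: "\<lbrakk>\<alpha> \<in> C2 X; \<beta> \<in> C2 X; Trg X (Dom2 X \<alpha>) = Src X (Dom2 X \<beta>)\<rbrakk>
      \<Longrightarrow> Dom2 X (HComp X \<beta> \<alpha>) = Comp1 X (Dom2 X \<beta>) (Dom2 X \<alpha>)"
    and Cod2_HComp: "\<lbrakk>\<alpha> \<in> C2 X; \<beta> \<in> C2 X; Trg X (Dom2 X \<alpha>) = Src X (Dom2 X \<beta>)\<rbrakk>
      \<Longrightarrow> Cod2 X (HComp X \<beta> \<alpha>) = Comp1 X (Cod2 X \<beta>) (Cod2 X \<alpha>)"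
    and HComp_Id2: "\<lbrakk>f \<in> C1 X; g \<in> C1 X; Trg X f = Src X g\<rbrakk>
      \<Longrightarrow> HComp X (Id2 X g) (Id2 X f) = Id2 X (Comp1 X g f)"
    and interchange: "\<lbrakk>\<alpha> \<in> C2 X; \<alpha>' \<in> C2 X; \<beta> \<in> C2 X; \<beta>' \<in> C2 X;
        Cod2 X \<alpha> = Dom2 X \<alpha>'; Cod2 X \<beta> = Dom2 X \<beta>'; Trg X (Dom2 X \<alpha>) = Src X (Dom2 X \<beta>)\<rbrakk>
      \<Longrightarrow> HComp X (VComp X \<beta>' \<beta>) (VComp X \<alpha>' \<alpha>) = VComp X (HComp X \<beta>' \<alpha>') (HComp X \<beta> \<alpha>)"

text \<open>The categories with objects in \<open>'o\<close> and arrows in \<open>'m\<close>, for arbitrary types \<open>'o\<close>, \<open>'m\<close>.\<close>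

definition CAT ::
  "(('o, 'm) cat, ('o, 'm, 'o, 'm) func, ('o, 'm, 'o, 'm) ntrans) two_cat" where
  "CAT = \<lparr>C0 = {C. category C}, C1 = {F. is_functor F}, C2 = {\<alpha>. is_ntrans \<alpha>},
     Src = FDom, Trg = FCod, Dom2 = NDom, Cod2 = NCod, Id1 = id_func, Id2 = id_nt,
     Comp1 = comp_func, VComp = vcomp_nt, HComp = hcomp_nt\<rparr>"

text \<open>Reversal of 1-cells only.\<close>

definition op2 :: "('a0, 'a1, 'a2) two_cat \<Rightarrow> ('a0, 'a1, 'a2) two_cat" where
  "op2 X = X\<lparr>Src := Trg X, Trg := Src X,
     Comp1 := (\<lambda>g f. Comp1 X f g), HComp := (\<lambda>\<beta> \<alpha>. HComp X \<alpha> \<beta>)\<rparr>"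

definition prod2 :: "('a0, 'a1, 'a2) two_cat \<Rightarrow> ('b0, 'b1, 'b2) two_cat
    \<Rightarrow> ('a0 \<times> 'b0, 'a1 \<times> 'b1, 'a2 \<times> 'b2) two_cat" (infixr "\<times>\<^sub>2" 75) where
  "X \<times>\<^sub>2 Y = \<lparr>C0 = C0 X \<times> C0 Y, C1 = C1 X \<times> C1 Y, C2 = C2 X \<times> C2 Y,
     Src = map_prod (Src X) (Src Y), Trg = map_prod (Trg X) (Trg Y),
     Dom2 = map_prod (Dom2 X) (Dom2 Y), Cod2 = map_prod (Cod2 X) (Cod2 Y),
     Id1 = map_prod (Id1 X) (Id1 Y), Id2 = map_prod (Id2 X) (Id2 Y),
     Comp1 = (\<lambda>(g, g') (f, f'). (Comp1 X g f, Comp1 Y g' f')),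
     VComp = (\<lambda>(\<beta>, \<beta>') (\<alpha>, \<alpha>'). (VComp X \<beta> \<alpha>, VComp Y \<beta>' \<alpha>')),
     HComp = (\<lambda>(\<beta>, \<beta>') (\<alpha>, \<alpha>'). (HComp X \<beta> \<alpha>, HComp Y \<beta>' \<alpha>'))\<rparr>"

text \<open>
  The comparison cells point from the composite of images to the image of the composite:
  \<open>PComp F g f : F g \<circ> F f \<Rightarrow> F (g \<circ> f)\<close> and \<open>PUnit F x : id \<Rightarrow> F id\<close>.
\<close>

record ('a0, 'a1, 'a2, 'b0, 'b1, 'b2) pfunc =
  P0 :: "'a0 \<Rightarrow> 'b0"
  P1 :: "'a1 \<Rightarrow> 'b1"
  P2 :: "'a2 \<Rightarrow> 'b2"
  PComp :: "'a1 \<Rightarrow> 'a1 \<Rightarrow> 'b2"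
  PUnit :: "'a0 \<Rightarrow> 'b2"

locale pseudofunctor =
  fixes X :: "('a0, 'a1, 'a2) two_cat" and Y :: "('b0, 'b1, 'b2) two_cat"
    and F :: "('a0, 'a1, 'a2, 'b0, 'b1, 'b2) pfunc"
  assumes P0_in: "x \<in> C0 X \<Longrightarrow> P0 F x \<in> C0 Y"
    and P1_in: "f \<in> C1 X \<Longrightarrow> P1 F f \<in> C1 Y"
    and Src_P1: "f \<in> C1 X \<Longrightarrow> Src Y (P1 F f) = P0 F (Src X f)"
    and Trg_P1: "f \<in> C1 X \<Longrightarrow> Trg Y (P1 F f) = P0 F (Trg X f)"
    and P2_in: "\<alpha> \<in> C2 X \<Longrightarrow> P2 F \<alpha> \<in> C2 Y"
    and Dom2_P2: "\<alpha> \<in> C2 X \<Longrightarrow> Dom2 Y (P2 F \<alpha>) = P1 F (Dom2 X \<alpha>)"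
    and Cod2_P2: "\<alpha> \<in> C2 X \<Longrightarrow> Cod2 Y (P2 F \<alpha>) = P1 F (Cod2 X \<alpha>)"
    and P2_Id2: "f \<in> C1 X \<Longrightarrow> P2 F (Id2 X f) = Id2 Y (P1 F f)"
    and P2_VComp: "\<lbrakk>\<alpha> \<in> C2 X; \<beta> \<in> C2 X; Cod2 X \<alpha> = Dom2 X \<beta>\<rbrakk>
      \<Longrightarrow> P2 F (VComp X \<beta> \<alpha>) = VComp Y (P2 F \<beta>) (P2 F \<alpha>)"
    and PComp_iso: "\<lbrakk>f \<in> C1 X; g \<in> C1 X; Trg X f = Src X g\<rbrakk>
      \<Longrightarrow> iso_arr (vert_cat Y) (PComp F g f)"
    and Dom2_PComp: "\<lbrakk>f \<in> C1 X; g \<in> C1 X; Trg X f = Src X g\<rbrakk>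
      \<Longrightarrow> Dom2 Y (PComp F g f) = Comp1 Y (P1 F g) (P1 F f)"
    and Cod2_PComp: "\<lbrakk>f \<in> C1 X; g \<in> C1 X; Trg X f = Src X g\<rbrakk>
      \<Longrightarrow> Cod2 Y (PComp F g f) = P1 F (Comp1 X g f)"
    and PComp_natural: "\<lbrakk>\<alpha> \<in> C2 X; \<beta> \<in> C2 X; Trg X (Dom2 X \<alpha>) = Src X (Dom2 X \<beta>)\<rbrakk>
      \<Longrightarrow> VComp Y (PComp F (Cod2 X \<beta>) (Cod2 X \<alpha>)) (HComp Y (P2 F \<beta>) (P2 F \<alpha>)) =
          VComp Y (P2 F (HComp X \<beta> \<alpha>)) (PComp F (Dom2 X \<beta>) (Dom2 X \<alpha>))"
    and PUnit_iso: "x \<in> C0 X \<Longrightarrow> iso_arr (vert_cat Y) (PUnit F x)"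
    and Dom2_PUnit: "x \<in> C0 X \<Longrightarrow> Dom2 Y (PUnit F x) = Id1 Y (P0 F x)"
    and Cod2_PUnit: "x \<in> C0 X \<Longrightarrow> Cod2 Y (PUnit F x) = P1 F (Id1 X x)"
    and PComp_assoc: "\<lbrakk>f \<in> C1 X; g \<in> C1 X; h \<in> C1 X; Trg X f = Src X g; Trg X g = Src X h\<rbrakk>
      \<Longrightarrow> VComp Y (PComp F h (Comp1 X g f)) (HComp Y (Id2 Y (P1 F h)) (PComp F g f)) =
          VComp Y (PComp F (Comp1 X h g) f) (HComp Y (PComp F h g) (Id2 Y (P1 F f)))"
    and PComp_unit_right: "f \<in> C1 X
      \<Longrightarrow> VComp Y (PComp F f (Id1 X (Src X f))) (HComp Y (Id2 Y (P1 F f)) (PUnit F (Src X f))) =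
          Id2 Y (P1 F f)"
    and PComp_unit_left: "f \<in> C1 X
      \<Longrightarrow> VComp Y (PComp F (Id1 X (Trg X f)) f) (HComp Y (PUnit F (Trg X f)) (Id2 Y (P1 F f))) =
          Id2 Y (P1 F f)"


section \<open>The hom-categories of the 2-category of CAT-valued pseudofunctors\<close>

text \<open>
  The two pseudofunctors may take values in categories over different types, as the
  hom-pseudofunctor and the integrand of a pseudoend do; their common target is \<open>CAT\<close> over any
  pair of types containing both. A pseudonatural transformation consists of functors
  \<open>T0 \<sigma> x : F x \<rightarrow> G x\<close> and invertible \<open>T1 \<sigma> f : G f \<circ> \<sigma> x \<Rightarrow> \<sigma> y \<circ> F f\<close> for \<open>f : x \<rightarrow> y\<close>.
\<close>

type_synonym ('x0, 'x1, 'x2, 'o, 'm) cat_pfunc =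
  "('x0, 'x1, 'x2, ('o, 'm) cat, ('o, 'm, 'o, 'm) func, ('o, 'm, 'o, 'm) ntrans) pfunc"

record ('x0, 'x1, 'o1, 'm1, 'o2, 'm2) ptrans =
  T0 :: "'x0 \<Rightarrow> ('o1, 'm1, 'o2, 'm2) func"
  T1 :: "'x1 \<Rightarrow> ('o1, 'm1, 'o2, 'm2) ntrans"

locale pseudonatural =
  fixes X :: "('x0, 'x1, 'x2) two_cat"
    and F :: "('x0, 'x1, 'x2, 'o1, 'm1) cat_pfunc"
    and G :: "('x0, 'x1, 'x2, 'o2, 'm2) cat_pfunc"
    and \<sigma> :: "('x0, 'x1, 'o1, 'm1, 'o2, 'm2) ptrans"
  assumes T0_ext: "T0 \<sigma> \<in> extensional (C0 X)"
    and T1_ext: "T1 \<sigma> \<in> extensional (C1 X)"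
    and T0_functor: "x \<in> C0 X \<Longrightarrow> is_functor (T0 \<sigma> x)"
    and FDom_T0: "x \<in> C0 X \<Longrightarrow> FDom (T0 \<sigma> x) = P0 F x"
    and FCod_T0: "x \<in> C0 X \<Longrightarrow> FCod (T0 \<sigma> x) = P0 G x"
    and T1_iso: "f \<in> C1 X \<Longrightarrow> is_nat_iso (T1 \<sigma> f)"
    and NDom_T1: "f \<in> C1 X \<Longrightarrow> NDom (T1 \<sigma> f) = P1 G f \<odot> T0 \<sigma> (Src X f)"
    and NCod_T1: "f \<in> C1 X \<Longrightarrow> NCod (T1 \<sigma> f) = T0 \<sigma> (Trg X f) \<odot> P1 F f"
    and T1_natural: "\<alpha> \<in> C2 X \<Longrightarrow>
      T1 \<sigma> (Cod2 X \<alpha>) \<bullet> (P2 G \<alpha> \<star> id_nt (T0 \<sigma> (Src X (Dom2 X \<alpha>)))) =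
      (id_nt (T0 \<sigma> (Trg X (Dom2 X \<alpha>))) \<star> P2 F \<alpha>) \<bullet> T1 \<sigma> (Dom2 X \<alpha>)"
    and T1_Comp1: "\<lbrakk>f \<in> C1 X; g \<in> C1 X; Trg X f = Src X g\<rbrakk> \<Longrightarrow>
      T1 \<sigma> (Comp1 X g f) \<bullet> (PComp G g f \<star> id_nt (T0 \<sigma> (Src X f))) =
      (id_nt (T0 \<sigma> (Trg X g)) \<star> PComp F g f) \<bullet>
        (T1 \<sigma> g \<star> id_nt (P1 F f)) \<bullet> (id_nt (P1 G g) \<star> T1 \<sigma> f)"
    and T1_Id1: "x \<in> C0 X \<Longrightarrow>
      T1 \<sigma> (Id1 X x) \<bullet> (PUnit G x \<star> id_nt (T0 \<sigma> x)) = id_nt (T0 \<sigma> x) \<star> PUnit F x"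

record ('x0, 'x1, 'o1, 'm1, 'o2, 'm2) modif =
  MDom :: "('x0, 'x1, 'o1, 'm1, 'o2, 'm2) ptrans"
  MCod :: "('x0, 'x1, 'o1, 'm1, 'o2, 'm2) ptrans"
  MMap :: "'x0 \<Rightarrow> ('o1, 'm1, 'o2, 'm2) ntrans"

locale modification =
  fixes X :: "('x0, 'x1, 'x2) two_cat"
    and F :: "('x0, 'x1, 'x2, 'o1, 'm1) cat_pfunc"
    and G :: "('x0, 'x1, 'x2, 'o2, 'm2) cat_pfunc"
    and \<Gamma> :: "('x0, 'x1, 'o1, 'm1, 'o2, 'm2) modif"
  assumes pseudonatural_MDom: "pseudonatural X F G (MDom \<Gamma>)"
    and pseudonatural_MCod: "pseudonatural X F G (MCod \<Gamma>)"
    and MMap_ext: "MMap \<Gamma> \<in> extensional (C0 X)"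
    and MMap_ntrans: "x \<in> C0 X \<Longrightarrow> is_ntrans (MMap \<Gamma> x)"
    and NDom_MMap: "x \<in> C0 X \<Longrightarrow> NDom (MMap \<Gamma> x) = T0 (MDom \<Gamma>) x"
    and NCod_MMap: "x \<in> C0 X \<Longrightarrow> NCod (MMap \<Gamma> x) = T0 (MCod \<Gamma>) x"
    and MMap_natural: "f \<in> C1 X \<Longrightarrow>
      T1 (MCod \<Gamma>) f \<bullet> (id_nt (P1 G f) \<star> MMap \<Gamma> (Src X f)) =
      (MMap \<Gamma> (Trg X f) \<star> id_nt (P1 F f)) \<bullet> T1 (MDom \<Gamma>) f"

definition PS_hom :: "('x0, 'x1, 'x2) two_cat
    \<Rightarrow> ('x0, 'x1, 'x2, 'o1, 'm1) cat_pfunc \<Rightarrow> ('x0, 'x1, 'x2, 'o2, 'm2) cat_pfunc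
    \<Rightarrow> (('x0, 'x1, 'o1, 'm1, 'o2, 'm2) ptrans, ('x0, 'x1, 'o1, 'm1, 'o2, 'm2) modif) cat" where
  "PS_hom X F G = \<lparr>Obj = {\<sigma>. pseudonatural X F G \<sigma>}, Arr = {\<Gamma>. modification X F G \<Gamma>},
     Dom = MDom, Cod = MCod,
     Idn = (\<lambda>\<sigma>. \<lparr>MDom = \<sigma>, MCod = \<sigma>, MMap = (\<lambda>x\<in>C0 X. id_nt (T0 \<sigma> x))\<rparr>),
     Comp = (\<lambda>\<Delta> \<Gamma>. \<lparr>MDom = MDom \<Gamma>, MCod = MCod \<Delta>, MMap = (\<lambda>x\<in>C0 X. MMap \<Delta> x \<bullet> MMap \<Gamma> x)\<rparr>)\<rparr>"


section \<open>Pseudoends\<close>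

definition hom_cat :: "('x0, 'x1, 'x2) two_cat \<Rightarrow> 'x0 \<Rightarrow> 'x0 \<Rightarrow> ('x1, 'x2) cat" where
  "hom_cat X x y = \<lparr>Obj = {f \<in> C1 X. Src X f = x \<and> Trg X f = y},
     Arr = {\<alpha> \<in> C2 X. Src X (Dom2 X \<alpha>) = x \<and> Trg X (Dom2 X \<alpha>) = y},
     Dom = Dom2 X, Cod = Cod2 X, Idn = Id2 X, Comp = VComp X\<rparr>"

text \<open>
  For \<open>f : x' \<rightarrow> x\<close> and \<open>g : y \<rightarrow> y'\<close> in \<open>X\<close>, the functor \<open>X(f, g) : X(x, y) \<rightarrow> X(x', y')\<close> is
  \<open>h \<mapsto> g \<circ> h \<circ> f\<close>.
\<close>

definition hom_func :: "('x0, 'x1, 'x2) two_cat \<Rightarrow> 'x1 \<Rightarrow> 'x1 \<Rightarrow> ('x1, 'x2, 'x1, 'x2) func" where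
  "hom_func X f g =
     (let C = hom_cat X (Trg X f) (Src X g); D = hom_cat X (Src X f) (Trg X g) in
      \<lparr>FDom = C, FCod = D,
       FObj = (\<lambda>h\<in>Obj C. Comp1 X g (Comp1 X h f)),
       FArr = (\<lambda>\<gamma>\<in>Arr C. HComp X (Id2 X g) (HComp X \<gamma> (Id2 X f)))\<rparr>)"

definition hom_ntrans :: "('x0, 'x1, 'x2) two_cat \<Rightarrow> 'x2 \<Rightarrow> 'x2 \<Rightarrow> ('x1, 'x2, 'x1, 'x2) ntrans" where
  "hom_ntrans X \<alpha> \<beta> =
     \<lparr>NDom = hom_func X (Dom2 X \<alpha>) (Dom2 X \<beta>), NCod = hom_func X (Cod2 X \<alpha>) (Cod2 X \<beta>),
      NMap = (\<lambda>h\<in>Obj (hom_cat X (Trg X (Dom2 X \<alpha>)) (Src X (Dom2 X \<beta>))).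
        HComp X \<beta> (HComp X (Id2 X h) \<alpha>))\<rparr>"

text \<open>\<open>X(-,-)\<close> is a strict 2-functor, so its comparison cells are identities.\<close>

definition hom_pfunc :: "('x0, 'x1, 'x2) two_cat
    \<Rightarrow> ('x0 \<times> 'x0, 'x1 \<times> 'x1, 'x2 \<times> 'x2, 'x1, 'x2) cat_pfunc" where
  "hom_pfunc X = \<lparr>P0 = (\<lambda>(x, y). hom_cat X x y),
     P1 = (\<lambda>(f, g). hom_func X f g),
     P2 = (\<lambda>(\<alpha>, \<beta>). hom_ntrans X \<alpha> \<beta>),
     PComp = (\<lambda>(f', g') (f, g). id_nt (hom_func X f' g' \<odot> hom_func X f g)),
     PUnit = (\<lambda>(x, y). id_nt (id_func (hom_cat X x y)))\<rparr>"

type_synonym ('x0, 'x1, 'x2, 'o, 'm) end_obj =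
  "('x0 \<times> 'x0, 'x1 \<times> 'x1, 'x1, 'x2, 'o, 'm) ptrans"

type_synonym ('x0, 'x1, 'x2, 'o, 'm) end_arr =
  "('x0 \<times> 'x0, 'x1 \<times> 'x1, 'x1, 'x2, 'o, 'm) modif"

definition pseudoend :: "('x0, 'x1, 'x2) two_cat
    \<Rightarrow> ('x0 \<times> 'x0, 'x1 \<times> 'x1, 'x2 \<times> 'x2, 'o, 'm) cat_pfunc
    \<Rightarrow> (('x0, 'x1, 'x2, 'o, 'm) end_obj, ('x0, 'x1, 'x2, 'o, 'm) end_arr) cat" where
  "pseudoend X S = PS_hom (op2 X \<times>\<^sub>2 X) (hom_pfunc X) S"

text \<open>Precomposition of a pseudofunctor with the strict 2-functor given by \<open>k0\<close>, \<open>k1\<close>, \<open>k2\<close>.\<close>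

definition reindex :: "('x0 \<Rightarrow> 'y0) \<Rightarrow> ('x1 \<Rightarrow> 'y1) \<Rightarrow> ('x2 \<Rightarrow> 'y2)
    \<Rightarrow> ('y0, 'y1, 'y2, 'z0, 'z1, 'z2) pfunc \<Rightarrow> ('x0, 'x1, 'x2, 'z0, 'z1, 'z2) pfunc" where
  "reindex k0 k1 k2 T = \<lparr>P0 = (\<lambda>x. P0 T (k0 x)), P1 = (\<lambda>f. P1 T (k1 f)), P2 = (\<lambda>\<alpha>. P2 T (k2 \<alpha>)),
     PComp = (\<lambda>g f. PComp T (k1 g) (k1 f)), PUnit = (\<lambda>x. PUnit T (k0 x))\<rparr>"

type_synonym ('a0, 'a1, 'a2, 'b0, 'b1, 'b2, 'o, 'm) integrand =
  "('a0 \<times> 'b0 \<times> 'a0 \<times> 'b0, 'a1 \<times> 'b1 \<times> 'a1 \<times> 'b1, 'a2 \<times> 'b2 \<times> 'a2 \<times> 'b2, 'o, 'm) cat_pfunc"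

definition regroup :: "('a0, 'a1, 'a2, 'b0, 'b1, 'b2, 'o, 'm) integrand
    \<Rightarrow> (('a0 \<times> 'b0) \<times> 'a0 \<times> 'b0, ('a1 \<times> 'b1) \<times> 'a1 \<times> 'b1, ('a2 \<times> 'b2) \<times> 'a2 \<times> 'b2, 'o, 'm) cat_pfunc"
  where
  "regroup T = reindex (\<lambda>((a, b), a', b'). (a, b, a', b')) (\<lambda>((a, b), a', b'). (a, b, a', b'))
     (\<lambda>((a, b), a', b'). (a, b, a', b')) T"

text \<open>\<open>T(x, -, y, -)\<close> and \<open>T(-, w, -, z)\<close>.\<close>

definition fix_A :: "('a0, 'a1, 'a2) two_cat \<Rightarrow> 'a0 \<Rightarrow> 'a0
    \<Rightarrow> ('a0, 'a1, 'a2, 'b0, 'b1, 'b2, 'o, 'm) integrand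
    \<Rightarrow> ('b0 \<times> 'b0, 'b1 \<times> 'b1, 'b2 \<times> 'b2, 'o, 'm) cat_pfunc" where
  "fix_A A x y T = reindex (\<lambda>(b, b'). (x, b, y, b'))
     (\<lambda>(g, g'). (Id1 A x, g, Id1 A y, g'))
     (\<lambda>(\<beta>, \<beta>'). (Id2 A (Id1 A x), \<beta>, Id2 A (Id1 A y), \<beta>')) T"

definition fix_B :: "('b0, 'b1, 'b2) two_cat \<Rightarrow> 'b0 \<Rightarrow> 'b0
    \<Rightarrow> ('a0, 'a1, 'a2, 'b0, 'b1, 'b2, 'o, 'm) integrand
    \<Rightarrow> ('a0 \<times> 'a0, 'a1 \<times> 'a1, 'a2 \<times> 'a2, 'o, 'm) cat_pfunc" where
  "fix_B B w z T = reindex (\<lambda>(a, a'). (a, w, a', z))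
     (\<lambda>(f, f'). (f, Id1 B w, f', Id1 B z))
     (\<lambda>(\<alpha>, \<alpha>'). (\<alpha>, Id2 B (Id1 B w), \<alpha>', Id2 B (Id1 B z))) T"

end

(* The pseudoend of S is the category of pseudonatural transformations X(-,-) -> S, and the
   hom-pseudofunctor of A x B is the product of those of A and B. Hence the theorem is an instance of
   currying: for strict F : X -> CAT and G : Y -> CAT and a pseudofunctor R : X x Y -> CAT, the category
   [X x Y, CAT](F x G, R) is isomorphic to [X, CAT](F, x |-> [Y, CAT](G, R(x,-))). A 1-cell f of X acts on
   [Y, CAT](G, R(x,-)) by postcomposition with R(f,1), made pseudonatural in Y by the
   isomorphisms R(1,g) R(f,1) ~ R(f,g) ~ R(f,1) R(1,g). A joint transformation is determined by its components at the
   1-cells (f,1) and (1,g), because (f,g) = (1,g) o (f,1). Exchanging the roles of A and B gives the second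
   equivalence. *)

theory Submission
  imports Defs
begin

section \<open>Categories, functors and transformations\<close>

text \<open>The obstacle is the composition axiom of the joint transformation built from an iterated
  one. Its component at \<open>(f,g)\<close> is defined through \<open>(1,g) o (f,1)\<close>, so the
  axiom for \<open>(f',g') o (f,g)\<close> has to be derived from four special kinds of pairs:
  \<open>(1,g)\<close> after \<open>(f,1)\<close> holds by construction; \<open>(1,g')\<close> after
  \<open>(1,g)\<close> and \<open>(f',1)\<close> after \<open>(f,1)\<close> are the composition
  axioms of the inner and of the outer transformation; \<open>(f,1)\<close> after
  \<open>(1,g)\<close> expresses that each outer component is a modification. A cocycle argument
  over composable triples then reaches every pair, and naturality spreads from factors to
  composites. All equations are checked on components, inside one category \<open>P0 R z\<close>.
  Inverse comparison cells are mostly avoided: an equation is composed with an invertible cell,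
  proved there, and the cell is cancelled. Transformations are extensional records, so agreement of
  components is equality; this is why currying yields an isomorphism of categories, and why both
  equivalences get identity units and counits.\<close>

declare category.Dom_in [simp] category.Cod_in [simp] category.Idn_in [simp]
  category.Dom_Idn [simp] category.Cod_Idn [simp] category.Comp_in [simp]
  category.Dom_Comp [simp] category.Cod_Comp [simp]

lemma Comp_Idn' [simp]:
  "\<lbrakk>category C; f \<in> Arr C; Dom C f = x\<rbrakk> \<Longrightarrow> Comp C f (Idn C x) = f"
  by (auto simp: category.Comp_Idn)

lemma Idn_Comp' [simp]:
  "\<lbrakk>category C; f \<in> Arr C; Cod C f = x\<rbrakk> \<Longrightarrow> Comp C (Idn C x) f = f"
  by (auto simp: category.Idn_Comp)

lemma Comp_assoc':
  "\<lbrakk>category C; f \<in> Arr C; g \<in> Arr C; h \<in> Arr C; Cod C f = Dom C g; Cod C g = Dom C h\<rbrakk>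
    \<Longrightarrow> Comp C (Comp C h g) f = Comp C h (Comp C g f)"
  by (rule category.Comp_assoc[symmetric])

section \<open>Invertible arrows, cancellation and pasting of squares\<close>

lemma iso_arrD [simp]: "iso_arr C f \<Longrightarrow> f \<in> Arr C"
  by (simp add: iso_arr_def)

definition inv_arr :: "('o, 'm) cat \<Rightarrow> 'm \<Rightarrow> 'm" where
  "inv_arr C f = (SOME g. g \<in> Arr C \<and> Dom C g = Cod C f \<and> Cod C g = Dom C f \<and>
     Comp C g f = Idn C (Dom C f) \<and> Comp C f g = Idn C (Cod C f))"

lemma inv_arr:
  assumes "iso_arr C f"
  shows inv_arr_in [simp]: "inv_arr C f \<in> Arr C" and Dom_inv_arr [simp]: "Dom C (inv_arr C f) = Cod C f"
    and Cod_inv_arr [simp]: "Cod C (inv_arr C f) = Dom C f"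
    and inv_arr_left [simp]: "Comp C (inv_arr C f) f = Idn C (Dom C f)"
    and inv_arr_right [simp]: "Comp C f (inv_arr C f) = Idn C (Cod C f)"
proof -
  have "\<exists>g. g \<in> Arr C \<and> Dom C g = Cod C f \<and> Cod C g = Dom C f \<and>
     Comp C g f = Idn C (Dom C f) \<and> Comp C f g = Idn C (Cod C f)"
    using assms unfolding iso_arr_def by blast
  from someI_ex[OF this] show
    "inv_arr C f \<in> Arr C" "Dom C (inv_arr C f) = Cod C f" "Cod C (inv_arr C f) = Dom C f"
    "Comp C (inv_arr C f) f = Idn C (Dom C f)" "Comp C f (inv_arr C f) = Idn C (Cod C f)"
    unfolding inv_arr_def by blast+
qed

lemma iso_arrI:
  assumes "f \<in> Arr C" "g \<in> Arr C" "Dom C g = Cod C f" "Cod C g = Dom C f"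
    "Comp C g f = Idn C (Dom C f)" "Comp C f g = Idn C (Cod C f)"
  shows "iso_arr C f"
  using assms unfolding iso_arr_def by blast

lemma iso_inv_arr [simp]: "iso_arr C f \<Longrightarrow> iso_arr C (inv_arr C f)"
  by (rule iso_arrI[where g = f]) auto

lemma iso_Comp [simp]:
  assumes "category C" "iso_arr C f" "iso_arr C g" "Cod C f = Dom C g"
  shows "iso_arr C (Comp C g f)"
proof (rule iso_arrI[where g = "Comp C (inv_arr C f) (inv_arr C g)"])
  have "Comp C (Comp C (inv_arr C f) (inv_arr C g)) (Comp C g f) =
     Comp C (inv_arr C f) (Comp C (Comp C (inv_arr C g) g) f)"
    using assms by (simp add: Comp_assoc' del: inv_arr_left)
  then show "Comp C (Comp C (inv_arr C f) (inv_arr C g)) (Comp C g f) = Idn C (Dom C (Comp C g f))"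
    using assms by simp
  have "Comp C (Comp C g f) (Comp C (inv_arr C f) (inv_arr C g)) =
     Comp C g (Comp C (Comp C f (inv_arr C f)) (inv_arr C g))"
    using assms by (simp add: Comp_assoc' del: inv_arr_right)
  then show "Comp C (Comp C g f) (Comp C (inv_arr C f) (inv_arr C g)) = Idn C (Cod C (Comp C g f))"
    using assms by simp
qed (use assms in auto)

lemma iso_Idn [simp]: "category C \<Longrightarrow> x \<in> Obj C \<Longrightarrow> iso_arr C (Idn C x)"
  by (rule iso_arrI[where g = "Idn C x"]) auto

text \<open>Compose with the inverse on the right. The coherence proofs rest on this: an equation is
  proved after precomposition with an invertible comparison cell, which is then cancelled.\<close>

lemma iso_epi:
  assumes C: "category C" and p: "iso_arr C p" and gh: "g \<in> Arr C" "h \<in> Arr C"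
    "Dom C g = Cod C p" "Dom C h = Cod C p" and eq: "Comp C g p = Comp C h p"
  shows "g = h"
proof -
  have "Comp C (Comp C g p) (inv_arr C p) = Comp C (Comp C h p) (inv_arr C p)"
    using eq by simp
  then show ?thesis using C p gh by (simp add: Comp_assoc')
qed

text \<open>Dual to \<open>iso_epi\<close>. It serves the exchange cells, which are defined with an
  inverse on the left that a postcomposed comparison cell removes.\<close>

lemma iso_mono:
  assumes C: "category C" and p: "iso_arr C p" and gh: "g \<in> Arr C" "h \<in> Arr C"
    "Cod C g = Dom C p" "Cod C h = Dom C p" and eq: "Comp C p g = Comp C p h"
  shows "g = h"
proof -
  have "Comp C (Comp C (inv_arr C p) p) g = Comp C (Comp C (inv_arr C p) p) h"
    using assms by (simp add: Comp_assoc' del: inv_arr_left)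
  then show ?thesis using assms by simp
qed

text \<open>Composites are normalized to right-nested form by \<open>Comp_assoc'\<close>, where one
  side of a square law occurs only with a tail \<open>m\<close>. This rule applies the law in front
  of such a tail.\<close>

lemma rew_left:
  "\<lbrakk>Comp C f g = Comp C h k; category C; f \<in> Arr C; g \<in> Arr C; h \<in> Arr C; k \<in> Arr C; m \<in> Arr C;
    Cod C g = Dom C f; Cod C k = Dom C h; Cod C m = Dom C g; Cod C m = Dom C k\<rbrakk>
    \<Longrightarrow> Comp C f (Comp C g m) = Comp C h (Comp C k m)"
  by (simp flip: Comp_assoc')

text \<open>The reason why pointwise inverses of a natural family are natural: two parallel sides of
  a commuting square may be inverted.\<close>

lemma inv_square:
  assumes c: "category C" "iso_arr C p" "iso_arr C q" "f \<in> Arr C" "g \<in> Arr C" "Dom C f = Cod C q" "Cod C f = Cod C p"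
      "Dom C g = Dom C q" "Cod C g = Dom C p" and e: "Comp C f q = Comp C p g"
  shows "Comp C (inv_arr C p) f = Comp C g (inv_arr C q)"
proof (rule iso_epi[OF c(1,3)])
  have "Comp C (Comp C (inv_arr C p) f) q = Comp C (Comp C (inv_arr C p) p) g"
    using c by (simp add: Comp_assoc' e del: inv_arr_left)
  then show "Comp C (Comp C (inv_arr C p) f) q = Comp C (Comp C g (inv_arr C q)) q"
    using c by (simp add: Comp_assoc')
qed (use c in simp_all)

text \<open>Many naturality proofs below glue two squares along the edge \<open>f2\<close>. That
  edge does not occur in the conclusion, so each use names it explicitly.\<close>

lemma paste_squares:
  assumes "category C" "q1 \<in> Arr C" "f1 \<in> Arr C" "f2 \<in> Arr C" "p1 \<in> Arr C" "q2 \<in> Arr C" "f3 \<in> Arr C" "p2 \<in> Arr C"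
    "Cod C f1 = Dom C q1" "Cod C q1 = Dom C q2" "Cod C p1 = Dom C f2" "Cod C f2 = Dom C q2"
    "Cod C p1 = Dom C p2" "Cod C p2 = Dom C f3"
    and 1: "Comp C q1 f1 = Comp C f2 p1" and 2: "Comp C q2 f2 = Comp C f3 p2"
  shows "Comp C (Comp C q2 q1) f1 = Comp C f3 (Comp C p2 p1)"
proof -
  have "Comp C (Comp C q2 q1) f1 = Comp C q2 (Comp C f2 p1)"
    using assms(1-14) unfolding 1[symmetric] by (intro Comp_assoc')
  also have "\<dots> = Comp C (Comp C f3 p2) p1"
    using assms(1-14) unfolding 2[symmetric] by (intro Comp_assoc'[symmetric])
  also have "\<dots> = Comp C f3 (Comp C p2 p1)"
    using assms(1-14) by (intro Comp_assoc')
  finally show ?thesis .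
qed

section \<open>Functors and natural transformations, with equality by components\<close>

lemma is_functorD [simp]:
  assumes "is_functor F"
  shows "category (FDom F)" "category (FCod F)"
    "FObj F \<in> extensional (Obj (FDom F))" "FArr F \<in> extensional (Arr (FDom F))"
    "\<lbrakk>FCod F = D; x \<in> Obj (FDom F)\<rbrakk> \<Longrightarrow> FObj F x \<in> Obj D"
    "\<lbrakk>FCod F = D; f \<in> Arr (FDom F)\<rbrakk> \<Longrightarrow> FArr F f \<in> Arr D"
    "\<lbrakk>FCod F = D; f \<in> Arr (FDom F)\<rbrakk> \<Longrightarrow> Dom D (FArr F f) = FObj F (Dom (FDom F) f)"
    "\<lbrakk>FCod F = D; f \<in> Arr (FDom F)\<rbrakk> \<Longrightarrow> Cod D (FArr F f) = FObj F (Cod (FDom F) f)"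
    "\<lbrakk>FDom F = C; x \<in> Obj C\<rbrakk> \<Longrightarrow> FArr F (Idn C x) = Idn (FCod F) (FObj F x)"
    "\<lbrakk>FDom F = C; f \<in> Arr C; g \<in> Arr C; Cod C f = Dom C g\<rbrakk>
      \<Longrightarrow> FArr F (Comp C g f) = Comp (FCod F) (FArr F g) (FArr F f)"
  using is_functor.category_FDom[OF assms] is_functor.category_FCod[OF assms]
    is_functor.FObj_ext[OF assms] is_functor.FArr_ext[OF assms] is_functor.FObj_in[OF assms]
    is_functor.FArr_in[OF assms] is_functor.Dom_FArr[OF assms] is_functor.Cod_FArr[OF assms]
    is_functor.FArr_Idn[OF assms] is_functor.FArr_Comp[OF assms] by blast+

lemma is_ntransD [simp]:
  assumes "is_ntrans \<alpha>"
  shows "is_functor (NDom \<alpha>)" "is_functor (NCod \<alpha>)"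
    "FDom (NCod \<alpha>) = FDom (NDom \<alpha>)" "FCod (NCod \<alpha>) = FCod (NDom \<alpha>)"
    "NMap \<alpha> \<in> extensional (Obj (FDom (NDom \<alpha>)))"
    "\<lbrakk>FCod (NDom \<alpha>) = D; x \<in> Obj (FDom (NDom \<alpha>))\<rbrakk> \<Longrightarrow> NMap \<alpha> x \<in> Arr D"
    "\<lbrakk>FCod (NDom \<alpha>) = D; x \<in> Obj (FDom (NDom \<alpha>))\<rbrakk> \<Longrightarrow> Dom D (NMap \<alpha> x) = FObj (NDom \<alpha>) x"
    "\<lbrakk>FCod (NDom \<alpha>) = D; x \<in> Obj (FDom (NDom \<alpha>))\<rbrakk> \<Longrightarrow> Cod D (NMap \<alpha> x) = FObj (NCod \<alpha>) x"
  using is_ntrans.functor_NDom[OF assms] is_ntrans.functor_NCod[OF assms] is_ntrans.FDom_eq[OF assms]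
    is_ntrans.FCod_eq[OF assms] is_ntrans.NMap_ext[OF assms] is_ntrans.NMap_in[OF assms]
    is_ntrans.Dom_NMap[OF assms] is_ntrans.Cod_NMap[OF assms] by blast+

lemma iso_FArr:
  assumes "is_functor F" "iso_arr (FDom F) f"
  shows "iso_arr (FCod F) (FArr F f)"
proof (rule iso_arrI[where g = "FArr F (inv_arr (FDom F) f)"])
  show "Comp (FCod F) (FArr F (inv_arr (FDom F) f)) (FArr F f) = Idn (FCod F) (Dom (FCod F) (FArr F f))"
    using assms is_functor.FArr_Comp[of F f "inv_arr (FDom F) f"] by (simp del: is_functorD(10))
  show "Comp (FCod F) (FArr F f) (FArr F (inv_arr (FDom F) f)) = Idn (FCod F) (Cod (FCod F) (FArr F f))"
    using assms is_functor.FArr_Comp[of F "inv_arr (FDom F) f" f] by (simp del: is_functorD(10))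
qed (use assms in auto)

lemma FArr_inv_arr:
  assumes F: "is_functor F" and f: "iso_arr (FDom F) f"
  shows "FArr F (inv_arr (FDom F) f) = inv_arr (FCod F) (FArr F f)"
proof (rule iso_epi[OF _ iso_FArr[OF F f]])
  show "Comp (FCod F) (FArr F (inv_arr (FDom F) f)) (FArr F f) =
      Comp (FCod F) (inv_arr (FCod F) (FArr F f)) (FArr F f)"
    using F f iso_FArr[OF F f] is_functor.FArr_Comp[OF F, of f "inv_arr (FDom F) f"] by (simp del: is_functorD(10))
qed (use F f iso_FArr[OF F f] in simp_all)

text \<open>Both maps are \<open>undefined\<close> off the carriers, so agreement on the carriers is
  already HOL equality. \<open>ntrans_eqI\<close> rests on the same fact.\<close>

lemma func_eqI:
  assumes "is_functor F" "is_functor G" "FDom F = FDom G" "FCod F = FCod G"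
    "\<And>x. x \<in> Obj (FDom G) \<Longrightarrow> FObj F x = FObj G x" "\<And>f. f \<in> Arr (FDom G) \<Longrightarrow> FArr F f = FArr G f"
  shows "F = G"
proof (rule func.equality)
  show "FObj F = FObj G"
    using assms by (intro extensionalityI[of _ "Obj (FDom G)"]) (auto dest: is_functor.FObj_ext)
  show "FArr F = FArr G"
    using assms by (intro extensionalityI[of _ "Arr (FDom G)"]) (auto dest: is_functor.FArr_ext)
qed (use assms in auto)

lemma ntrans_eqI:
  assumes "is_ntrans \<alpha>" "is_ntrans \<beta>" "NDom \<alpha> = NDom \<beta>" "NCod \<alpha> = NCod \<beta>"
    "\<And>x. x \<in> Obj (FDom (NDom \<beta>)) \<Longrightarrow> NMap \<alpha> x = NMap \<beta> x"
  shows "\<alpha> = \<beta>"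
proof (rule ntrans.equality)
  show "NMap \<alpha> = NMap \<beta>"
    using assms by (intro extensionalityI[of _ "Obj (FDom (NDom \<beta>))"]) (auto dest: is_ntrans.NMap_ext)
qed (use assms in auto)

lemma id_func_simps [simp]:
  "FDom (id_func C) = C" "FCod (id_func C) = C"
  "x \<in> Obj C \<Longrightarrow> FObj (id_func C) x = x" "f \<in> Arr C \<Longrightarrow> FArr (id_func C) f = f"
  by (simp_all add: id_func_def)

lemma comp_func_simps [simp]:
  "FDom (G \<odot> F) = FDom F" "FCod (G \<odot> F) = FCod G"
  "x \<in> Obj (FDom F) \<Longrightarrow> FObj (G \<odot> F) x = FObj G (FObj F x)"
  "f \<in> Arr (FDom F) \<Longrightarrow> FArr (G \<odot> F) f = FArr G (FArr F f)"
  by (simp_all add: comp_func_def)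

lemma id_nt_simps [simp]:
  "NDom (id_nt F) = F" "NCod (id_nt F) = F"
  "x \<in> Obj (FDom F) \<Longrightarrow> NMap (id_nt F) x = Idn (FCod F) (FObj F x)"
  by (simp_all add: id_nt_def)

lemma vcomp_nt_simps [simp]:
  "NDom (\<beta> \<bullet> \<alpha>) = NDom \<alpha>" "NCod (\<beta> \<bullet> \<alpha>) = NCod \<beta>"
  "x \<in> Obj (FDom (NDom \<alpha>)) \<Longrightarrow> NMap (\<beta> \<bullet> \<alpha>) x = Comp (FCod (NDom \<alpha>)) (NMap \<beta> x) (NMap \<alpha> x)"
  by (simp_all add: vcomp_nt_def)

lemma hcomp_nt_simps [simp]:
  "NDom (\<beta> \<star> \<alpha>) = NDom \<beta> \<odot> NDom \<alpha>" "NCod (\<beta> \<star> \<alpha>) = NCod \<beta> \<odot> NCod \<alpha>"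
  "x \<in> Obj (FDom (NDom \<alpha>)) \<Longrightarrow> NMap (\<beta> \<star> \<alpha>) x =
     Comp (FCod (NDom \<beta>)) (NMap \<beta> (FObj (NCod \<alpha>) x)) (FArr (NDom \<beta>) (NMap \<alpha> x))"
  by (simp_all add: hcomp_nt_def)

lemma id_func_functor [simp]: "category C \<Longrightarrow> is_functor (id_func C)"
  by (rule is_functor.intro) (auto simp: id_func_def)

lemma comp_func_functor [simp]:
  "\<lbrakk>is_functor F; is_functor G; FCod F = FDom G\<rbrakk> \<Longrightarrow> is_functor (G \<odot> F)"
  by (rule is_functor.intro) (auto simp: comp_func_def)

lemma comp_func_assoc [simp]:
  "\<lbrakk>is_functor P; is_functor Q; is_functor R; FCod R = FDom Q; FCod Q = FDom P\<rbrakk> \<Longrightarrow> (P \<odot> Q) \<odot> R = P \<odot> Q \<odot> R"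
  by (rule func_eqI) simp_all

lemma comp_func_id [simp]:
  "\<lbrakk>is_functor P; FCod P = D\<rbrakk> \<Longrightarrow> id_func D \<odot> P = P" "\<lbrakk>is_functor P; FDom P = C\<rbrakk> \<Longrightarrow> P \<odot> id_func C = P"
  by (rule func_eqI; use is_functorD(1,2)[of P] in force)+

lemma id_nt_ntrans [simp]: "is_functor F \<Longrightarrow> is_ntrans (id_nt F)"
  by (rule is_ntrans.intro) (auto simp: id_nt_def)

lemma vcomp_ntrans [simp]:
  assumes "is_ntrans \<alpha>" "is_ntrans \<beta>" "NCod \<alpha> = NDom \<beta>"
  shows "is_ntrans (\<beta> \<bullet> \<alpha>)"
proof -
  have [simp]: "FDom (NDom \<beta>) = FDom (NDom \<alpha>)" "FCod (NDom \<beta>) = FCod (NDom \<alpha>)"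
    using is_ntransD(3,4)[OF assms(1)] unfolding assms(3) by blast+
  show ?thesis
  proof (rule is_ntrans.intro, goal_cases)
    \<comment> \<open>Goal 9 is the naturality square, the last axiom of \<open>is_ntrans\<close>.
      It is glued from the two given squares along the image of \<open>f\<close> under the middle
      functor.\<close>
    case (9 f)
    let ?C = "FDom (NDom \<alpha>)" and ?D = "FCod (NDom \<alpha>)"
    have f: "f \<in> Arr ?C" using 9 by simp
    have "Comp ?D (Comp ?D (NMap \<beta> (Cod ?C f)) (NMap \<alpha> (Cod ?C f))) (FArr (NDom \<alpha>) f) =
      Comp ?D (FArr (NCod \<beta>) f) (Comp ?D (NMap \<beta> (Dom ?C f)) (NMap \<alpha> (Dom ?C f)))"
      by (rule paste_squares[where ?f2.0 = "FArr (NDom \<beta>) f"])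
        (use assms f is_ntrans.naturality[OF assms(1), of f] is_ntrans.naturality[OF assms(2), of f] in simp_all)
    then show ?case using f assms by simp
  qed (use assms in \<open>auto simp: vcomp_nt_def\<close>)
qed

text \<open>The square is glued from the image under \<open>NDom \<beta>\<close> of the square of
  \<alpha> at \<open>f\<close>, and the square of \<beta> at
  \<open>FArr (NCod \<alpha>) f\<close>.\<close>

lemma hcomp_ntrans [simp]:
  assumes "is_ntrans \<alpha>" "is_ntrans \<beta>" "FCod (NDom \<alpha>) = FDom (NDom \<beta>)"
  shows "is_ntrans (\<beta> \<star> \<alpha>)"
proof (rule is_ntrans.intro, goal_cases)
  case (9 f)
  let ?C = "FDom (NDom \<alpha>)" and ?D = "FDom (NDom \<beta>)" and ?E = "FCod (NDom \<beta>)"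
  have f: "f \<in> Arr ?C" using 9 by simp
  let ?a = "NMap \<alpha> (Cod ?C f)" and ?b = "NMap \<alpha> (Dom ?C f)"
  have "Comp ?E (FArr (NDom \<beta>) ?a) (FArr (NDom \<beta>) (FArr (NDom \<alpha>) f)) =
      FArr (NDom \<beta>) (Comp ?D ?a (FArr (NDom \<alpha>) f))"
    using f assms by simp
  also have "\<dots> = FArr (NDom \<beta>) (Comp ?D (FArr (NCod \<alpha>) f) ?b)"
    using f assms is_ntrans.naturality[OF assms(1), of f] by simp
  finally have 1: "Comp ?E (FArr (NDom \<beta>) ?a) (FArr (NDom \<beta>) (FArr (NDom \<alpha>) f)) =
     Comp ?E (FArr (NDom \<beta>) (FArr (NCod \<alpha>) f)) (FArr (NDom \<beta>) ?b)"
    using f assms by simp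
  have "Comp ?E (Comp ?E (NMap \<beta> (FObj (NCod \<alpha>) (Cod ?C f))) (FArr (NDom \<beta>) ?a)) (FArr (NDom \<beta>) (FArr (NDom \<alpha>) f)) =
     Comp ?E (FArr (NCod \<beta>) (FArr (NCod \<alpha>) f)) (Comp ?E (NMap \<beta> (FObj (NCod \<alpha>) (Dom ?C f))) (FArr (NDom \<beta>) ?b))"
    by (rule paste_squares[where ?f2.0 = "FArr (NDom \<beta>) (FArr (NCod \<alpha>) f)"])
      (use assms f 1 is_ntrans.naturality[OF assms(2), of "FArr (NCod \<alpha>) f"] in simp_all)
  then show ?case using f assms by simp
qed (use assms in \<open>auto simp: hcomp_nt_def\<close>)

section \<open>Natural isomorphisms; isomorphism and equivalence of categories\<close>

lemma nat_isoD [simp]: "is_nat_iso \<alpha> \<Longrightarrow> is_ntrans \<alpha>"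
  by (simp add: is_nat_iso_def)

lemma nat_iso_iso:
  assumes "is_nat_iso \<alpha>" "x \<in> Obj (FDom (NDom \<alpha>))"
  shows "iso_arr (FCod (NDom \<alpha>)) (NMap \<alpha> x)"
proof -
  obtain \<beta> where b: "is_ntrans \<beta>" "NDom \<beta> = NCod \<alpha>" "NCod \<beta> = NDom \<alpha>"
     "\<beta> \<bullet> \<alpha> = id_nt (NDom \<alpha>)" "\<alpha> \<bullet> \<beta> = id_nt (NCod \<alpha>)" and a: "is_ntrans \<alpha>"
    using assms unfolding is_nat_iso_def by blast
  have "NMap (\<beta> \<bullet> \<alpha>) x = NMap (id_nt (NDom \<alpha>)) x" "NMap (\<alpha> \<bullet> \<beta>) x = NMap (id_nt (NCod \<alpha>)) x"
    using b by simp_all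
  then show ?thesis
    using assms(2) a b(1-3) by (intro iso_arrI[where g = "NMap \<beta> x"]) simp_all
qed

text \<open>Pointwise inverses are natural by \<open>inv_square\<close>, so invertible components
  suffice.\<close>

lemma nat_isoI:
  assumes "is_ntrans \<alpha>" "\<And>x. x \<in> Obj (FDom (NDom \<alpha>)) \<Longrightarrow> iso_arr (FCod (NDom \<alpha>)) (NMap \<alpha> x)"
  shows "is_nat_iso \<alpha>"
proof -
  let ?C = "FDom (NDom \<alpha>)" and ?D = "FCod (NDom \<alpha>)"
  let ?b = "\<lparr>NDom = NCod \<alpha>, NCod = NDom \<alpha>, NMap = (\<lambda>x\<in>Obj ?C. inv_arr ?D (NMap \<alpha> x))\<rparr>"
  have b: "is_ntrans ?b"
  proof (rule is_ntrans.intro, goal_cases)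
    case (9 f)
    then have f: "f \<in> Arr ?C" using assms(1) by simp
    let ?p = "NMap \<alpha> (Dom ?C f)" and ?q = "NMap \<alpha> (Cod ?C f)"
    have n: "Comp ?D ?q (FArr (NDom \<alpha>) f) = Comp ?D (FArr (NCod \<alpha>) f) ?p"
      using is_ntrans.naturality[OF assms(1) f] .
    have "Comp ?D (inv_arr ?D ?q) (FArr (NCod \<alpha>) f) = Comp ?D (FArr (NDom \<alpha>) f) (inv_arr ?D ?p)"
      by (rule inv_square) (use f n assms in simp_all)
    then show ?case using f assms by simp
  qed (use assms in auto)
  have "?b \<bullet> \<alpha> = id_nt (NDom \<alpha>)"
    using b assms by (intro ntrans_eqI) auto
  moreover have "\<alpha> \<bullet> ?b = id_nt (NCod \<alpha>)"
    using b assms by (intro ntrans_eqI) auto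
  ultimately show ?thesis using b assms(1) unfolding is_nat_iso_def
    by (intro conjI exI[of _ ?b]) auto
qed

text \<open>Joint data will be defined by decoding a pair with \<open>inv\<close>; this evaluates
  such a decoding. Injectivity on the whole type, not only on a carrier, keeps the evaluation free
  of side conditions.\<close>

lemma inv_pair: "inj (\<lambda>(x, y). k x y) \<Longrightarrow> inv (\<lambda>(x, y). k x y) (k x y) = (x, y)"
  using inv_f_f[of "\<lambda>(x, y). k x y" "(x, y)"] by simp

text \<open>The inverse maps form a functor automatically: each law of \<open>C\<close> can be
  checked after applying the injective maps of \<open>J\<close>.\<close>

lemma isomorphic_catI:
  assumes J: "is_functor J" "FDom J = C" "FCod J = D"
    and O: "bij_betw (FObj J) (Obj C) (Obj D)" and A: "bij_betw (FArr J) (Arr C) (Arr D)"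
  shows "C \<cong>\<^sub>C D"
proof -
  interpret is_functor J by fact
  let ?o = "inv_into (Obj C) (FObj J)" and ?a = "inv_into (Arr C) (FArr J)"
  let ?K = "\<lparr>FDom = D, FCod = C, FObj = (\<lambda>x\<in>Obj D. ?o x), FArr = (\<lambda>f\<in>Arr D. ?a f)\<rparr>"
  have C [simp]: "category C" "category D" using category_FDom category_FCod J by auto
  have o: "\<And>x. x \<in> Obj C \<Longrightarrow> ?o (FObj J x) = x" "\<And>y. y \<in> Obj D \<Longrightarrow> FObj J (?o y) = y"
    "\<And>y. y \<in> Obj D \<Longrightarrow> ?o y \<in> Obj C"
    using O by (auto simp: bij_betw_def inv_into_f_f f_inv_into_f inv_into_into)
  have a: "\<And>x. x \<in> Arr C \<Longrightarrow> ?a (FArr J x) = x" "\<And>y. y \<in> Arr D \<Longrightarrow> FArr J (?a y) = y"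
    "\<And>y. y \<in> Arr D \<Longrightarrow> ?a y \<in> Arr C"
    using A by (auto simp: bij_betw_def inv_into_f_f f_inv_into_f inv_into_into)
  \<comment> \<open>\<open>J\<close> preserves endpoints and is injective on objects, so its inverse
    preserves endpoints too.\<close>
  have d: "Dom C (?a f) = ?o (Dom D f)" "Cod C (?a f) = ?o (Cod D f)" if "f \<in> Arr D" for f
  proof -
    have *: "?a f \<in> Arr (FDom J)" using that a J by simp
    have "Dom D f = FObj J (Dom C (?a f))" "Cod D f = FObj J (Cod C (?a f))"
      using Dom_FArr[OF *] Cod_FArr[OF *] a(2)[OF that] J by auto
    then show "Dom C (?a f) = ?o (Dom D f)" "Cod C (?a f) = ?o (Cod D f)"
      using that a(3) o(1) by auto
  qed
  have K: "is_functor ?K"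
  proof (rule is_functor.intro, goal_cases)
    case (9 x)
    then have *: "x \<in> Obj D" by simp
    have "FArr J (Idn C (?o x)) = Idn D x" using o(2,3)[OF *] FArr_Idn[of "?o x"] J by simp
    then have "?a (Idn D x) = Idn C (?o x)" using a(1)[of "Idn C (?o x)"] o(3)[OF *] by simp
    then show ?case using * by simp
  next
    case (10 f g)
    then have fg: "f \<in> Arr D" "g \<in> Arr D" "Cod D f = Dom D g" by auto
    then have "Comp D g f = FArr J (Comp C (?a g) (?a f))"
      using FArr_Comp[of "?a f" "?a g"] a d J by simp
    moreover have "Comp C (?a g) (?a f) \<in> Arr C" using fg a d by simp
    ultimately have "?a (Comp D g f) = Comp C (?a g) (?a f)" using a(1) by simp
    then show ?case using fg by simp
  qed (use a o d in auto)
  have "?K \<odot> J = id_func C"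
    using K J a o FObj_in FArr_in by (intro func_eqI) auto
  moreover have "J \<odot> ?K = id_func D"
    using K J a o by (intro func_eqI) auto
  ultimately show ?thesis unfolding isomorphic_cat_def
    using K J by (intro exI[of _ J] exI[of _ ?K]) auto
qed

lemma isomorphic_cat_refl: "category C \<Longrightarrow> C \<cong>\<^sub>C C"
  by (rule isomorphic_catI[of "id_func C"]) (auto intro!: bij_betw_imageI inj_onI simp: image_iff)

lemma isomorphic_cat_sym: "C \<cong>\<^sub>C D \<Longrightarrow> D \<cong>\<^sub>C C"
  unfolding isomorphic_cat_def by blast

lemma isomorphic_cat_trans:
  assumes "C \<cong>\<^sub>C D" "D \<cong>\<^sub>C E" shows "C \<cong>\<^sub>C E"
proof -
  obtain F G where FG: "is_functor F" "FDom F = C" "FCod F = D"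
     "is_functor G" "FDom G = D" "FCod G = C" "G \<odot> F = id_func C" "F \<odot> G = id_func D"
    using assms(1) unfolding isomorphic_cat_def by blast
  obtain H K where HK: "is_functor H" "FDom H = D" "FCod H = E"
     "is_functor K" "FDom K = E" "FCod K = D" "K \<odot> H = id_func D" "H \<odot> K = id_func E"
    using assms(2) unfolding isomorphic_cat_def by blast
  have inv: "\<And>x. x \<in> Obj C' \<Longrightarrow> FObj Q (FObj P x) = x" "\<And>f. f \<in> Arr C' \<Longrightarrow> FArr Q (FArr P f) = f"
    if "FDom P = C'" "Q \<odot> P = id_func C'"
    for P :: "('p, 'q, 'r, 's) func" and Q :: "('r, 's, 'p, 'q) func" and C'
    using that by (metis comp_func_simps(3) id_func_simps(3), metis comp_func_simps(4) id_func_simps(4))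
  note i = inv[OF FG(2,7)] inv[OF FG(5,8)] inv[OF HK(2,7)] inv[OF HK(5,8)]
  have c: "category C" "category E" using FG(1,2) HK(1,3) by (auto dest: is_functorD)
  have 1: "(G \<odot> K) \<odot> (H \<odot> F) = id_func C"
    using FG(1-6) HK(1-6) i c by (intro func_eqI) auto
  have 2: "(H \<odot> F) \<odot> (G \<odot> K) = id_func E"
    using FG(1-6) HK(1-6) i c by (intro func_eqI) auto
  show ?thesis unfolding isomorphic_cat_def
    using FG HK 1 2 by (intro exI[of _ "H \<odot> F"] exI[of _ "G \<odot> K"]) auto
qed

lemma isomorphic_cat_equivalent:
  assumes "C \<cong>\<^sub>C D" shows "C \<simeq>\<^sub>C D"
proof -
  obtain F G where FG: "is_functor F" "FDom F = C" "FCod F = D"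
     "is_functor G" "FDom G = D" "FCod G = C" "G \<odot> F = id_func C" "F \<odot> G = id_func D"
    using assms(1) unfolding isomorphic_cat_def by blast
  have c: "category C" "category D" using is_functorD(1,2)[OF FG(1)] FG(2,3) by auto
  have n: "is_nat_iso (id_nt (id_func E))" if "category E" for E :: "('p,'q) cat"
    using that by (intro nat_isoI) simp_all
  show ?thesis
    unfolding equivalent_cat_def
    by (rule exI[of _ F], rule exI[of _ G], rule exI[of _ "id_nt (id_func C)"],
        rule exI[of _ "id_nt (id_func D)"], unfold FG id_nt_simps) (use FG(1,4) n[OF c(1)] n[OF c(2)] in blast)
qed

section \<open>2-categories and pseudofunctors into \<open>CAT\<close>\<close>

lemma hom_cat_simps [simp]:
  "f \<in> Obj (hom_cat X x y) \<longleftrightarrow> f \<in> C1 X \<and> Src X f = x \<and> Trg X f = y"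
  "\<alpha> \<in> Arr (hom_cat X x y) \<longleftrightarrow> \<alpha> \<in> C2 X \<and> Src X (Dom2 X \<alpha>) = x \<and> Trg X (Dom2 X \<alpha>) = y"
  "Dom (hom_cat X x y) = Dom2 X" "Cod (hom_cat X x y) = Cod2 X" "Idn (hom_cat X x y) = Id2 X"
  "Comp (hom_cat X x y) = VComp X"
  by (simp_all add: hom_cat_def)

context two_category
begin

lemma one_cells [simp]:
  "f \<in> C1 X \<Longrightarrow> Src X f \<in> C0 X" "f \<in> C1 X \<Longrightarrow> Trg X f \<in> C0 X"
  "x \<in> C0 X \<Longrightarrow> Id1 X x \<in> C1 X" "x \<in> C0 X \<Longrightarrow> Src X (Id1 X x) = x" "x \<in> C0 X \<Longrightarrow> Trg X (Id1 X x) = x"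
  "\<lbrakk>f \<in> C1 X; g \<in> C1 X; Trg X f = Src X g\<rbrakk> \<Longrightarrow> Comp1 X g f \<in> C1 X"
  "\<lbrakk>f \<in> C1 X; g \<in> C1 X; Trg X f = Src X g\<rbrakk> \<Longrightarrow> Src X (Comp1 X g f) = Src X f"
  "\<lbrakk>f \<in> C1 X; g \<in> C1 X; Trg X f = Src X g\<rbrakk> \<Longrightarrow> Trg X (Comp1 X g f) = Trg X g"
  "\<lbrakk>f \<in> C1 X; Src X f = x\<rbrakk> \<Longrightarrow> Comp1 X f (Id1 X x) = f"
  "\<lbrakk>f \<in> C1 X; Trg X f = x\<rbrakk> \<Longrightarrow> Comp1 X (Id1 X x) f = f"
  using category.Dom_in[OF category_under] category.Cod_in[OF category_under]
    category.Idn_in[OF category_under] category.Dom_Idn[OF category_under]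
    category.Cod_Idn[OF category_under] category.Comp_in[OF category_under]
    category.Dom_Comp[OF category_under] category.Cod_Comp[OF category_under]
    category.Comp_Idn[OF category_under] category.Idn_Comp[OF category_under]
  unfolding under_cat_def by auto

lemma Comp1_assoc:
  "\<lbrakk>f \<in> C1 X; g \<in> C1 X; h \<in> C1 X; Trg X f = Src X g; Trg X g = Src X h\<rbrakk>
    \<Longrightarrow> Comp1 X (Comp1 X h g) f = Comp1 X h (Comp1 X g f)"
  using category.Comp_assoc[OF category_under] unfolding under_cat_def by simp

lemma two_cells [simp]:
  "\<alpha> \<in> C2 X \<Longrightarrow> Dom2 X \<alpha> \<in> C1 X" "\<alpha> \<in> C2 X \<Longrightarrow> Cod2 X \<alpha> \<in> C1 X"
  "f \<in> C1 X \<Longrightarrow> Id2 X f \<in> C2 X" "f \<in> C1 X \<Longrightarrow> Dom2 X (Id2 X f) = f" "f \<in> C1 X \<Longrightarrow> Cod2 X (Id2 X f) = f"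
  "\<lbrakk>\<alpha> \<in> C2 X; \<beta> \<in> C2 X; Cod2 X \<alpha> = Dom2 X \<beta>\<rbrakk> \<Longrightarrow> VComp X \<beta> \<alpha> \<in> C2 X"
  "\<lbrakk>\<alpha> \<in> C2 X; \<beta> \<in> C2 X; Cod2 X \<alpha> = Dom2 X \<beta>\<rbrakk> \<Longrightarrow> Dom2 X (VComp X \<beta> \<alpha>) = Dom2 X \<alpha>"
  "\<lbrakk>\<alpha> \<in> C2 X; \<beta> \<in> C2 X; Cod2 X \<alpha> = Dom2 X \<beta>\<rbrakk> \<Longrightarrow> Cod2 X (VComp X \<beta> \<alpha>) = Cod2 X \<beta>"
  "\<lbrakk>\<alpha> \<in> C2 X; Dom2 X \<alpha> = f\<rbrakk> \<Longrightarrow> VComp X \<alpha> (Id2 X f) = \<alpha>"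
  "\<lbrakk>\<alpha> \<in> C2 X; Cod2 X \<alpha> = f\<rbrakk> \<Longrightarrow> VComp X (Id2 X f) \<alpha> = \<alpha>"
  using category.Dom_in[OF category_vert] category.Cod_in[OF category_vert]
    category.Idn_in[OF category_vert] category.Dom_Idn[OF category_vert]
    category.Cod_Idn[OF category_vert] category.Comp_in[OF category_vert]
    category.Dom_Comp[OF category_vert] category.Cod_Comp[OF category_vert]
    category.Comp_Idn[OF category_vert] category.Idn_Comp[OF category_vert]
  unfolding vert_cat_def by auto

lemma HComp_in [simp]:
  "\<lbrakk>\<alpha> \<in> C2 X; \<beta> \<in> C2 X; Trg X (Dom2 X \<alpha>) = Src X (Dom2 X \<beta>)\<rbrakk> \<Longrightarrow> HComp X \<beta> \<alpha> \<in> C2 X"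
  "\<lbrakk>\<alpha> \<in> C2 X; Src X (Dom2 X \<alpha>) = x\<rbrakk> \<Longrightarrow> HComp X \<alpha> (Id2 X (Id1 X x)) = \<alpha>"
  "\<lbrakk>\<alpha> \<in> C2 X; Trg X (Dom2 X \<alpha>) = x\<rbrakk> \<Longrightarrow> HComp X (Id2 X (Id1 X x)) \<alpha> = \<alpha>"
  using category.Comp_in[OF category_horiz] category.Comp_Idn[OF category_horiz]
    category.Idn_Comp[OF category_horiz]
  unfolding horiz_cat_def by auto

lemma HComp_assoc:
  "\<lbrakk>\<alpha> \<in> C2 X; \<beta> \<in> C2 X; \<gamma> \<in> C2 X; Trg X (Dom2 X \<alpha>) = Src X (Dom2 X \<beta>); Trg X (Dom2 X \<beta>) = Src X (Dom2 X \<gamma>)\<rbrakk>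
    \<Longrightarrow> HComp X (HComp X \<gamma> \<beta>) \<alpha> = HComp X \<gamma> (HComp X \<beta> \<alpha>)"
  using category.Comp_assoc[OF category_horiz] unfolding horiz_cat_def by simp

declare Src_Cod2 [simp] Trg_Cod2 [simp] Dom2_HComp [simp] Cod2_HComp [simp] HComp_Id2 [simp]

lemma category_hom_cat [simp]: "category (hom_cat X x y)"
proof (rule category.intro, goal_cases)
  case (11 f g h)
  then show ?case using category.Comp_assoc[OF category_vert] unfolding vert_cat_def by simp
qed auto

end

lemma two_category_op2 [simp]:
  assumes "two_category X" shows "two_category (op2 X)"
proof -
  interpret two_category X by fact
  show ?thesis
  proof (rule two_category.intro, goal_cases)
    case 1 show ?case
      by (rule category.intro) (auto simp: under_cat_def op2_def Comp1_assoc)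
  next
    case 2 show ?case using category_vert by (simp add: vert_cat_def op2_def)
  next
    case 3 show ?case
      by (rule category.intro) (auto simp: horiz_cat_def op2_def HComp_assoc)
  qed (auto simp: op2_def interchange)
qed

text \<open>The underlying, vertical and horizontal categories of a product 2-category all have this
  form, so their laws are checked only once.\<close>

definition prod_cat :: "('o, 'm) cat \<Rightarrow> ('o2, 'm2) cat \<Rightarrow> ('o \<times> 'o2, 'm \<times> 'm2) cat" where
  "prod_cat C D = \<lparr>Obj = Obj C \<times> Obj D, Arr = Arr C \<times> Arr D, Dom = map_prod (Dom C) (Dom D),
     Cod = map_prod (Cod C) (Cod D), Idn = map_prod (Idn C) (Idn D),
     Comp = (\<lambda>(g, g') (f, f'). (Comp C g f, Comp D g' f'))\<rparr>"

lemma category_prod_cat: "\<lbrakk>category C; category D\<rbrakk> \<Longrightarrow> category (prod_cat C D)"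
  by (rule category.intro) (auto simp: prod_cat_def Comp_assoc')

lemma two_category_prod2 [simp]:
  assumes "two_category X" "two_category Y" shows "two_category (X \<times>\<^sub>2 Y)"
proof -
  interpret X: two_category X by fact
  interpret Y: two_category Y by fact
  show ?thesis
  proof (rule two_category.intro, goal_cases)
    case 1 
    have "under_cat (X \<times>\<^sub>2 Y) = prod_cat (under_cat X) (under_cat Y)"
      by (simp add: under_cat_def prod2_def prod_cat_def)
    then show ?case using X.category_under Y.category_under by (simp add: category_prod_cat)
  next
    case 2
    have "vert_cat (X \<times>\<^sub>2 Y) = prod_cat (vert_cat X) (vert_cat Y)"
      by (simp add: vert_cat_def prod2_def prod_cat_def)
    then show ?case using X.category_vert Y.category_vert by (simp add: category_prod_cat)
  next
    case 3
    have "horiz_cat (X \<times>\<^sub>2 Y) = prod_cat (horiz_cat X) (horiz_cat Y)"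
      by (auto simp add: horiz_cat_def prod2_def prod_cat_def fun_eq_iff)
    then show ?case using X.category_horiz Y.category_horiz by (simp add: category_prod_cat)
  qed (auto simp: prod2_def X.interchange Y.interchange)
qed

section \<open>The 2-category \<open>CAT\<close> and pseudofunctors into it, by components\<close>

lemma CAT_simps [simp]:
  "C0 CAT = Collect category" "C1 CAT = Collect is_functor" "C2 CAT = Collect is_ntrans"
  "Src CAT = FDom" "Trg CAT = FCod" "Dom2 CAT = NDom" "Cod2 CAT = NCod" "Id1 CAT = id_func"
  "Id2 CAT = id_nt" "Comp1 CAT = comp_func" "VComp CAT = vcomp_nt" "HComp CAT = hcomp_nt"
  unfolding CAT_def by (simp_all only: two_cat.simps)

lemma iso_arr_CAT [simp]: "iso_arr (vert_cat CAT) \<alpha> = is_nat_iso \<alpha>"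
  unfolding iso_arr_def is_nat_iso_def vert_cat_def CAT_def Bex_def
  by (simp only: cat.simps two_cat.simps mem_Collect_eq)

text \<open>Since the values lie in \<open>CAT\<close>, each axiom can be evaluated at an object
  \<open>w\<close>. The lemmas of this context are these evaluations: equations between arrows of a
  single category.\<close>

locale cat_pf = two_category X + pf: pseudofunctor X CAT F
  for X :: "('x0, 'x1, 'x2) two_cat" and F :: "('x0, 'x1, 'x2, 'o, 'm) cat_pfunc"
begin

abbreviation "fo f \<equiv> FObj (P1 F f)"
abbreviation "fa f \<equiv> FArr (P1 F f)"
abbreviation "fc \<alpha> \<equiv> NMap (P2 F \<alpha>)"
abbreviation "ph g f \<equiv> NMap (PComp F g f)"
abbreviation "un x \<equiv> NMap (PUnit F x)"

lemma P0_cat [simp]: "x \<in> C0 X \<Longrightarrow> category (P0 F x)"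
  using pf.P0_in by simp

lemma P1_functor [simp]:
  "f \<in> C1 X \<Longrightarrow> is_functor (P1 F f)" "f \<in> C1 X \<Longrightarrow> FDom (P1 F f) = P0 F (Src X f)"
  "f \<in> C1 X \<Longrightarrow> FCod (P1 F f) = P0 F (Trg X f)"
  using pf.P1_in pf.Src_P1 pf.Trg_P1 by simp_all

lemma P2_ntrans [simp]:
  "\<alpha> \<in> C2 X \<Longrightarrow> is_ntrans (P2 F \<alpha>)" "\<alpha> \<in> C2 X \<Longrightarrow> NDom (P2 F \<alpha>) = P1 F (Dom2 X \<alpha>)"
  "\<alpha> \<in> C2 X \<Longrightarrow> NCod (P2 F \<alpha>) = P1 F (Cod2 X \<alpha>)"
  using pf.P2_in pf.Dom2_P2 pf.Cod2_P2 by simp_all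

lemma PComp_ntrans [simp]:
  assumes "f \<in> C1 X" "g \<in> C1 X" "Trg X f = Src X g"
  shows "is_nat_iso (PComp F g f)" "NDom (PComp F g f) = P1 F g \<odot> P1 F f" "NCod (PComp F g f) = P1 F (Comp1 X g f)"
  using pf.PComp_iso[OF assms] pf.Dom2_PComp[OF assms] pf.Cod2_PComp[OF assms] by simp_all

lemma PUnit_ntrans [simp]:
  assumes "x \<in> C0 X"
  shows "is_nat_iso (PUnit F x)" "NDom (PUnit F x) = id_func (P0 F x)" "NCod (PUnit F x) = P1 F (Id1 X x)"
  using pf.PUnit_iso[OF assms] pf.Dom2_PUnit[OF assms] pf.Cod2_PUnit[OF assms] by simp_all

lemma ph [simp]:
  assumes "f \<in> C1 X" "g \<in> C1 X" "Trg X f = Src X g" "w \<in> Obj (P0 F (Src X f))" "Trg X g = z"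
  shows "iso_arr (P0 F z) (ph g f w)" "ph g f w \<in> Arr (P0 F z)"
    "Dom (P0 F z) (ph g f w) = fo g (fo f w)"
    "Cod (P0 F z) (ph g f w) = fo (Comp1 X g f) w"
  using nat_iso_iso[of "PComp F g f" w] is_ntransD(6-8)[of "PComp F g f" "P0 F z" w] assms by simp_all

lemma un [simp]:
  assumes "x \<in> C0 X" "w \<in> Obj (P0 F x)"
  shows "iso_arr (P0 F x) (un x w)" "un x w \<in> Arr (P0 F x)"
    "Dom (P0 F x) (un x w) = w" "Cod (P0 F x) (un x w) = fo (Id1 X x) w"
  using nat_iso_iso[of "PUnit F x" w] is_ntransD(6-8)[of "PUnit F x" "P0 F x" w] assms by simp_all

lemma ph_natural:
  assumes "f \<in> C1 X" "g \<in> C1 X" "Trg X f = Src X g" "m \<in> Arr (P0 F (Src X f))"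
  shows "Comp (P0 F (Trg X g)) (ph g f (Cod (P0 F (Src X f)) m)) (fa g (fa f m)) =
    Comp (P0 F (Trg X g)) (fa (Comp1 X g f) m) (ph g f (Dom (P0 F (Src X f)) m))"
  using is_ntrans.naturality[of "PComp F g f" m] assms by simp

lemma un_natural:
  assumes "x \<in> C0 X" "m \<in> Arr (P0 F x)"
  shows "Comp (P0 F x) (un x (Cod (P0 F x) m)) m =
    Comp (P0 F x) (fa (Id1 X x) m) (un x (Dom (P0 F x) m))"
  using is_ntrans.naturality[of "PUnit F x" m] assms by simp

lemma fc_natural:
  assumes "\<alpha> \<in> C2 X" "m \<in> Arr (P0 F (Src X (Dom2 X \<alpha>)))"
  shows "Comp (P0 F (Trg X (Dom2 X \<alpha>))) (fc \<alpha> (Cod (P0 F (Src X (Dom2 X \<alpha>))) m)) (fa (Dom2 X \<alpha>) m) =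
    Comp (P0 F (Trg X (Dom2 X \<alpha>))) (fa (Cod2 X \<alpha>) m) (fc \<alpha> (Dom (P0 F (Src X (Dom2 X \<alpha>))) m))"
  using is_ntrans.naturality[of "P2 F \<alpha>" m] assms by simp

lemma fc_Id2 [simp]:
  assumes "f \<in> C1 X" "w \<in> Obj (P0 F (Src X f))"
  shows "fc (Id2 X f) w = Idn (P0 F (Trg X f)) (fo f w)"
  using pf.P2_Id2 assms by simp

lemma fc_VComp:
  assumes "\<alpha> \<in> C2 X" "\<beta> \<in> C2 X" "Cod2 X \<alpha> = Dom2 X \<beta>" "w \<in> Obj (P0 F (Src X (Dom2 X \<alpha>)))"
  shows "fc (VComp X \<beta> \<alpha>) w = Comp (P0 F (Trg X (Dom2 X \<alpha>))) (fc \<beta> w) (fc \<alpha> w)"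
  using pf.P2_VComp[of \<alpha> \<beta>] assms by simp

lemma ph_natural2:
  assumes "\<alpha> \<in> C2 X" "\<beta> \<in> C2 X" "Trg X (Dom2 X \<alpha>) = Src X (Dom2 X \<beta>)" "w \<in> Obj (P0 F (Src X (Dom2 X \<alpha>)))"
  shows "Comp (P0 F (Trg X (Dom2 X \<beta>))) (ph (Cod2 X \<beta>) (Cod2 X \<alpha>) w)
      (Comp (P0 F (Trg X (Dom2 X \<beta>))) (fc \<beta> (fo (Cod2 X \<alpha>) w)) (fa (Dom2 X \<beta>) (fc \<alpha> w))) =
    Comp (P0 F (Trg X (Dom2 X \<beta>))) (fc (HComp X \<beta> \<alpha>) w) (ph (Dom2 X \<beta>) (Dom2 X \<alpha>) w)"
  using arg_cong[OF pf.PComp_natural[OF assms(1-3)], of "\<lambda>t. NMap t w"] assms by simp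

lemma ph_assoc:
  assumes "f \<in> C1 X" "g \<in> C1 X" "h \<in> C1 X" "Trg X f = Src X g" "Trg X g = Src X h" "w \<in> Obj (P0 F (Src X f))"
  shows "Comp (P0 F (Trg X h)) (ph h (Comp1 X g f) w) (fa h (ph g f w)) =
    Comp (P0 F (Trg X h)) (ph (Comp1 X h g) f w) (ph h g (fo f w))"
  using arg_cong[OF pf.PComp_assoc[OF assms(1-5)], of "\<lambda>t. NMap t w"] assms by simp

lemma ph_unit_right:
  assumes "f \<in> C1 X" "Src X f = x" "w \<in> Obj (P0 F x)"
  shows "Comp (P0 F (Trg X f)) (ph f (Id1 X x) w) (fa f (un x w)) = Idn (P0 F (Trg X f)) (fo f w)"
  using arg_cong[OF pf.PComp_unit_right[OF assms(1)], of "\<lambda>t. NMap t w"] assms one_cells(1)[OF assms(1)] by simp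

lemma ph_unit_left:
  assumes "f \<in> C1 X" "Trg X f = y" "w \<in> Obj (P0 F (Src X f))"
  shows "Comp (P0 F y) (ph (Id1 X y) f w) (un y (fo f w)) = Idn (P0 F y) (fo f w)"
  using arg_cong[OF pf.PComp_unit_left[OF assms(1)], of "\<lambda>t. NMap t w"] assms one_cells(2)[OF assms(1)] by simp

end

text \<open>The way back from component equations to the axioms, by \<open>ntrans_eqI\<close>. It is
  meant for the partial pseudoend, whose laws are verified one component at a time.\<close>

lemma pseudofunctor_CATI:
  assumes X: "two_category X"
    and P0: "\<And>x. x \<in> C0 X \<Longrightarrow> category (P0 F x)"
    and P1: "\<And>f. f \<in> C1 X \<Longrightarrow> is_functor (P1 F f)" "\<And>f. f \<in> C1 X \<Longrightarrow> FDom (P1 F f) = P0 F (Src X f)"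
      "\<And>f. f \<in> C1 X \<Longrightarrow> FCod (P1 F f) = P0 F (Trg X f)"
    and P2: "\<And>\<alpha>. \<alpha> \<in> C2 X \<Longrightarrow> is_ntrans (P2 F \<alpha>)" "\<And>\<alpha>. \<alpha> \<in> C2 X \<Longrightarrow> NDom (P2 F \<alpha>) = P1 F (Dom2 X \<alpha>)"
      "\<And>\<alpha>. \<alpha> \<in> C2 X \<Longrightarrow> NCod (P2 F \<alpha>) = P1 F (Cod2 X \<alpha>)"
    and PC: "\<And>f g. \<lbrakk>f \<in> C1 X; g \<in> C1 X; Trg X f = Src X g\<rbrakk> \<Longrightarrow> is_nat_iso (PComp F g f)"
      "\<And>f g. \<lbrakk>f \<in> C1 X; g \<in> C1 X; Trg X f = Src X g\<rbrakk> \<Longrightarrow> NDom (PComp F g f) = P1 F g \<odot> P1 F f"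
      "\<And>f g. \<lbrakk>f \<in> C1 X; g \<in> C1 X; Trg X f = Src X g\<rbrakk> \<Longrightarrow> NCod (PComp F g f) = P1 F (Comp1 X g f)"
    and PU: "\<And>x. x \<in> C0 X \<Longrightarrow> is_nat_iso (PUnit F x)" "\<And>x. x \<in> C0 X \<Longrightarrow> NDom (PUnit F x) = id_func (P0 F x)"
      "\<And>x. x \<in> C0 X \<Longrightarrow> NCod (PUnit F x) = P1 F (Id1 X x)"
    and Id2: "\<And>f w. \<lbrakk>f \<in> C1 X; w \<in> Obj (P0 F (Src X f))\<rbrakk> \<Longrightarrow>
      NMap (P2 F (Id2 X f)) w = Idn (P0 F (Trg X f)) (FObj (P1 F f) w)"
    and V: "\<And>\<alpha> \<beta> w. \<lbrakk>\<alpha> \<in> C2 X; \<beta> \<in> C2 X; Cod2 X \<alpha> = Dom2 X \<beta>; w \<in> Obj (P0 F (Src X (Dom2 X \<alpha>)))\<rbrakk> \<Longrightarrow>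
      NMap (P2 F (VComp X \<beta> \<alpha>)) w = Comp (P0 F (Trg X (Dom2 X \<alpha>))) (NMap (P2 F \<beta>) w) (NMap (P2 F \<alpha>) w)"
    and H: "\<And>\<alpha> \<beta> w. \<lbrakk>\<alpha> \<in> C2 X; \<beta> \<in> C2 X; Trg X (Dom2 X \<alpha>) = Src X (Dom2 X \<beta>); w \<in> Obj (P0 F (Src X (Dom2 X \<alpha>)))\<rbrakk> \<Longrightarrow>
      Comp (P0 F (Trg X (Dom2 X \<beta>))) (NMap (PComp F (Cod2 X \<beta>) (Cod2 X \<alpha>)) w)
      (Comp (P0 F (Trg X (Dom2 X \<beta>))) (NMap (P2 F \<beta>) (FObj (P1 F (Cod2 X \<alpha>)) w)) (FArr (P1 F (Dom2 X \<beta>)) (NMap (P2 F \<alpha>) w))) =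
    Comp (P0 F (Trg X (Dom2 X \<beta>))) (NMap (P2 F (HComp X \<beta> \<alpha>)) w) (NMap (PComp F (Dom2 X \<beta>) (Dom2 X \<alpha>)) w)"
    and A: "\<And>f g h w. \<lbrakk>f \<in> C1 X; g \<in> C1 X; h \<in> C1 X; Trg X f = Src X g; Trg X g = Src X h; w \<in> Obj (P0 F (Src X f))\<rbrakk> \<Longrightarrow>
      Comp (P0 F (Trg X h)) (NMap (PComp F h (Comp1 X g f)) w) (FArr (P1 F h) (NMap (PComp F g f) w)) =
      Comp (P0 F (Trg X h)) (NMap (PComp F (Comp1 X h g) f) w) (NMap (PComp F h g) (FObj (P1 F f) w))"
    and UR: "\<And>f w. \<lbrakk>f \<in> C1 X; w \<in> Obj (P0 F (Src X f))\<rbrakk> \<Longrightarrow> Comp (P0 F (Trg X f)) (NMap (PComp F f (Id1 X (Src X f))) w)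
      (FArr (P1 F f) (NMap (PUnit F (Src X f)) w)) = Idn (P0 F (Trg X f)) (FObj (P1 F f) w)"
    and UL: "\<And>f w. \<lbrakk>f \<in> C1 X; w \<in> Obj (P0 F (Src X f))\<rbrakk> \<Longrightarrow> Comp (P0 F (Trg X f)) (NMap (PComp F (Id1 X (Trg X f)) f) w)
      (NMap (PUnit F (Trg X f)) (FObj (P1 F f) w)) = Idn (P0 F (Trg X f)) (FObj (P1 F f) w)"
  shows "pseudofunctor X CAT F"
proof -
  interpret two_category X by fact
  note [simp] = P0 P1 P2 PC PU Id2 nat_isoD
  have [simp]: "NMap (PComp F g f) w \<in> Arr (P0 F z)"
    "Dom (P0 F z) (NMap (PComp F g f) w) = FObj (P1 F g) (FObj (P1 F f) w)"
    "Cod (P0 F z) (NMap (PComp F g f) w) = FObj (P1 F (Comp1 X g f)) w"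
    if "f \<in> C1 X" "g \<in> C1 X" "Trg X f = Src X g" "w \<in> Obj (P0 F (Src X f))" "Trg X g = z" for f g w z
    using is_ntransD(6-8)[of "PComp F g f" "P0 F z" w] that by simp_all
  have [simp]: "NMap (PUnit F x) w \<in> Arr (P0 F x)" "Dom (P0 F x) (NMap (PUnit F x) w) = w"
    "Cod (P0 F x) (NMap (PUnit F x) w) = FObj (P1 F (Id1 X x)) w"
    if "x \<in> C0 X" "w \<in> Obj (P0 F x)" for x w
    using is_ntransD(6-8)[of "PUnit F x" "P0 F x" w] that by simp_all
  show ?thesis
  proof (rule pseudofunctor.intro, goal_cases)
    case (8 f) then show ?case by simp (rule ntrans_eqI, simp_all)
  next
    case (9 \<alpha> \<beta>) then show ?case by simp (rule ntrans_eqI, simp_all add: V)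
  next
    case (13 \<alpha> \<beta>) then show ?case by simp (rule ntrans_eqI, simp_all add: H)
  next
    case (17 f g h) then show ?case by simp (rule ntrans_eqI, simp_all add: A Comp1_assoc)
  next
    case (18 f) then show ?case by simp (rule ntrans_eqI, simp_all add: UR)
  next
    case (19 f) then show ?case by simp (rule ntrans_eqI, simp_all add: UL)
  qed simp_all
qed

section \<open>Pseudonatural transformations in components\<close>

text \<open>This will be the source of the transformations. Strictness makes \<open>P1 F\<close> of
  a composite a literal composite, so the comparison cells of \<open>F\<close> disappear from the
  component equations in \<open>psdata\<close>.\<close>

locale strict_pf = two_category X
  for X :: "('x0, 'x1, 'x2) two_cat" +
  fixes F :: "('x0, 'x1, 'x2, 'o, 'm) cat_pfunc"
  assumes P0_cat [simp]: "x \<in> C0 X \<Longrightarrow> category (P0 F x)"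
    and P1_functor [simp]: "f \<in> C1 X \<Longrightarrow> is_functor (P1 F f)"
    and FDom_P1 [simp]: "f \<in> C1 X \<Longrightarrow> FDom (P1 F f) = P0 F (Src X f)"
    and FCod_P1 [simp]: "f \<in> C1 X \<Longrightarrow> FCod (P1 F f) = P0 F (Trg X f)"
    and P2_ntrans [simp]: "\<alpha> \<in> C2 X \<Longrightarrow> is_ntrans (P2 F \<alpha>)"
    and NDom_P2 [simp]: "\<alpha> \<in> C2 X \<Longrightarrow> NDom (P2 F \<alpha>) = P1 F (Dom2 X \<alpha>)"
    and NCod_P2 [simp]: "\<alpha> \<in> C2 X \<Longrightarrow> NCod (P2 F \<alpha>) = P1 F (Cod2 X \<alpha>)"
    and P2_Id2 [simp]: "f \<in> C1 X \<Longrightarrow> P2 F (Id2 X f) = id_nt (P1 F f)"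
    and P1_Comp1 [simp]: "\<lbrakk>f \<in> C1 X; g \<in> C1 X; Trg X f = Src X g\<rbrakk> \<Longrightarrow> P1 F (Comp1 X g f) = P1 F g \<odot> P1 F f"
    and P1_Id1 [simp]: "x \<in> C0 X \<Longrightarrow> P1 F (Id1 X x) = id_func (P0 F x)"
    and PComp_id [simp]: "\<lbrakk>f \<in> C1 X; g \<in> C1 X; Trg X f = Src X g\<rbrakk> \<Longrightarrow> PComp F g f = id_nt (P1 F g \<odot> P1 F f)"
    and PUnit_id [simp]: "x \<in> C0 X \<Longrightarrow> PUnit F x = id_nt (id_func (P0 F x))"

abbreviation "o0 \<sigma> \<equiv> \<lambda>x. FObj (T0 \<sigma> x)"
abbreviation "o1 \<sigma> \<equiv> \<lambda>x. FArr (T0 \<sigma> x)"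
abbreviation "o2 \<sigma> \<equiv> \<lambda>f. NMap (T1 \<sigma> f)"
abbreviation "md \<Gamma> \<equiv> \<lambda>x. NMap (MMap \<Gamma> x)"

text \<open>The components of a pseudonatural transformation: \<open>s0\<close>, \<open>s1\<close> are its values on the objects and
  arrows of \<open>F x\<close>, and \<open>t f u : G f (s u) \<rightarrow> s (F f u)\<close>.\<close>

locale pstyped =
  fixes X :: "('x0, 'x1, 'x2) two_cat"
    and F :: "('x0, 'x1, 'x2, 'o1, 'm1) cat_pfunc" and G :: "('x0, 'x1, 'x2, 'o2, 'm2) cat_pfunc"
    and s0 :: "'x0 \<Rightarrow> 'o1 \<Rightarrow> 'o2" and s1 :: "'x0 \<Rightarrow> 'm1 \<Rightarrow> 'm2" and t :: "'x1 \<Rightarrow> 'o1 \<Rightarrow> 'm2"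
  assumes s0_in: "\<lbrakk>x \<in> C0 X; u \<in> Obj (P0 F x)\<rbrakk> \<Longrightarrow> s0 x u \<in> Obj (P0 G x)"
    and s1_in: "\<lbrakk>x \<in> C0 X; m \<in> Arr (P0 F x)\<rbrakk> \<Longrightarrow> s1 x m \<in> Arr (P0 G x)"
    and Dom_s1: "\<lbrakk>x \<in> C0 X; m \<in> Arr (P0 F x)\<rbrakk> \<Longrightarrow> Dom (P0 G x) (s1 x m) = s0 x (Dom (P0 F x) m)"
    and Cod_s1: "\<lbrakk>x \<in> C0 X; m \<in> Arr (P0 F x)\<rbrakk> \<Longrightarrow> Cod (P0 G x) (s1 x m) = s0 x (Cod (P0 F x) m)"
    and s1_Idn: "\<lbrakk>x \<in> C0 X; u \<in> Obj (P0 F x)\<rbrakk> \<Longrightarrow> s1 x (Idn (P0 F x) u) = Idn (P0 G x) (s0 x u)"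
    and s1_Comp: "\<lbrakk>x \<in> C0 X; m \<in> Arr (P0 F x); n \<in> Arr (P0 F x); Cod (P0 F x) m = Dom (P0 F x) n\<rbrakk>
      \<Longrightarrow> s1 x (Comp (P0 F x) n m) = Comp (P0 G x) (s1 x n) (s1 x m)"
    and t_iso: "\<lbrakk>f \<in> C1 X; u \<in> Obj (P0 F (Src X f)); Trg X f = y\<rbrakk> \<Longrightarrow> iso_arr (P0 G y) (t f u)"
    and Dom_t: "\<lbrakk>f \<in> C1 X; u \<in> Obj (P0 F (Src X f)); Trg X f = y\<rbrakk> \<Longrightarrow> Dom (P0 G y) (t f u) = FObj (P1 G f) (s0 (Src X f) u)"
    and Cod_t: "\<lbrakk>f \<in> C1 X; u \<in> Obj (P0 F (Src X f)); Trg X f = y\<rbrakk> \<Longrightarrow> Cod (P0 G y) (t f u) = s0 y (FObj (P1 F f) u)"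
begin

lemma t_in: "\<lbrakk>f \<in> C1 X; u \<in> Obj (P0 F (Src X f)); Trg X f = y\<rbrakk> \<Longrightarrow> t f u \<in> Arr (P0 G y)"
  by (rule iso_arrD) (rule t_iso)

lemmas s_simps = s0_in s1_in Dom_s1 Cod_s1 s1_Idn s1_Comp t_iso t_in Dom_t Cod_t

end

text \<open>Kept apart from \<open>pstyped\<close> so that the currying argument can work with
  components that are known to be well typed before any of these axioms is established.\<close>

locale psdata = pstyped X F G s0 s1 t
  for X :: "('x0, 'x1, 'x2) two_cat"
    and F :: "('x0, 'x1, 'x2, 'o1, 'm1) cat_pfunc" and G :: "('x0, 'x1, 'x2, 'o2, 'm2) cat_pfunc"
    and s0 :: "'x0 \<Rightarrow> 'o1 \<Rightarrow> 'o2" and s1 :: "'x0 \<Rightarrow> 'm1 \<Rightarrow> 'm2" and t :: "'x1 \<Rightarrow> 'o1 \<Rightarrow> 'm2" +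
  assumes t_natural: "\<lbrakk>f \<in> C1 X; m \<in> Arr (P0 F (Src X f))\<rbrakk> \<Longrightarrow>
      Comp (P0 G (Trg X f)) (t f (Cod (P0 F (Src X f)) m)) (FArr (P1 G f) (s1 (Src X f) m)) =
      Comp (P0 G (Trg X f)) (s1 (Trg X f) (FArr (P1 F f) m)) (t f (Dom (P0 F (Src X f)) m))"
    and t_natural2: "\<lbrakk>\<alpha> \<in> C2 X; u \<in> Obj (P0 F (Src X (Dom2 X \<alpha>)))\<rbrakk> \<Longrightarrow>
      Comp (P0 G (Trg X (Dom2 X \<alpha>))) (t (Cod2 X \<alpha>) u) (NMap (P2 G \<alpha>) (s0 (Src X (Dom2 X \<alpha>)) u)) =
      Comp (P0 G (Trg X (Dom2 X \<alpha>))) (s1 (Trg X (Dom2 X \<alpha>)) (NMap (P2 F \<alpha>) u)) (t (Dom2 X \<alpha>) u)"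
    and t_Comp1: "\<lbrakk>f \<in> C1 X; g \<in> C1 X; Trg X f = Src X g; u \<in> Obj (P0 F (Src X f))\<rbrakk> \<Longrightarrow>
      Comp (P0 G (Trg X g)) (t (Comp1 X g f) u) (NMap (PComp G g f) (s0 (Src X f) u)) =
      Comp (P0 G (Trg X g)) (t g (FObj (P1 F f) u)) (FArr (P1 G g) (t f u))"
    and t_Id1: "\<lbrakk>x \<in> C0 X; u \<in> Obj (P0 F x)\<rbrakk> \<Longrightarrow>
      Comp (P0 G x) (t (Id1 X x) u) (NMap (PUnit G x) (s0 x u)) = Idn (P0 G x) (s0 x u)"

text \<open>Goals 1 to 9 are the typing conditions; 10 to 13 are naturality in arrows, naturality in
  2-cells, composites and identities. The case numbers of later proofs refer to this order.\<close>

lemmas psdataI = psdata.intro[OF pstyped.intro psdata_axioms.intro]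

locale mdata =
  fixes X :: "('x0, 'x1, 'x2) two_cat"
    and F :: "('x0, 'x1, 'x2, 'o1, 'm1) cat_pfunc" and G :: "('x0, 'x1, 'x2, 'o2, 'm2) cat_pfunc"
    and \<sigma> \<sigma>' :: "('x0, 'x1, 'o1, 'm1, 'o2, 'm2) ptrans" and c :: "'x0 \<Rightarrow> 'o1 \<Rightarrow> 'm2"
  assumes c_in: "\<lbrakk>x \<in> C0 X; u \<in> Obj (P0 F x)\<rbrakk> \<Longrightarrow> c x u \<in> Arr (P0 G x)"
    and Dom_c: "\<lbrakk>x \<in> C0 X; u \<in> Obj (P0 F x)\<rbrakk> \<Longrightarrow> Dom (P0 G x) (c x u) = o0 \<sigma> x u"
    and Cod_c: "\<lbrakk>x \<in> C0 X; u \<in> Obj (P0 F x)\<rbrakk> \<Longrightarrow> Cod (P0 G x) (c x u) = o0 \<sigma>' x u"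
    and c_natural: "\<lbrakk>x \<in> C0 X; m \<in> Arr (P0 F x)\<rbrakk> \<Longrightarrow>
      Comp (P0 G x) (c x (Cod (P0 F x) m)) (o1 \<sigma> x m) = Comp (P0 G x) (o1 \<sigma>' x m) (c x (Dom (P0 F x) m))"
    and c_modif: "\<lbrakk>f \<in> C1 X; u \<in> Obj (P0 F (Src X f))\<rbrakk> \<Longrightarrow>
      Comp (P0 G (Trg X f)) (o2 \<sigma>' f u) (FArr (P1 G f) (c (Src X f) u)) =
      Comp (P0 G (Trg X f)) (c (Trg X f) (FObj (P1 F f) u)) (o2 \<sigma> f u)"

text \<open>All maps are restricted to their carriers, as extensionality demands; otherwise
  different records could have the same components.\<close>

definition mkpt where
  "mkpt X F G s0 s1 t =
    (let \<sigma> = \<lambda>x\<in>C0 X. \<lparr>FDom = P0 F x, FCod = P0 G x, FObj = (\<lambda>u\<in>Obj (P0 F x). s0 x u), FArr = (\<lambda>m\<in>Arr (P0 F x). s1 x m)\<rparr>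
     in \<lparr>T0 = \<sigma>, T1 = (\<lambda>f\<in>C1 X. \<lparr>NDom = P1 G f \<odot> \<sigma> (Src X f), NCod = \<sigma> (Trg X f) \<odot> P1 F f,
       NMap = (\<lambda>u\<in>Obj (P0 F (Src X f)). t f u)\<rparr>)\<rparr>)"

definition mkmd where
  "mkmd X F \<sigma> \<sigma>' c = \<lparr>MDom = \<sigma>, MCod = \<sigma>',
     MMap = (\<lambda>x\<in>C0 X. \<lparr>NDom = T0 \<sigma> x, NCod = T0 \<sigma>' x, NMap = (\<lambda>u\<in>Obj (P0 F x). c x u)\<rparr>)\<rparr>"

lemma mkpt_simps [simp]:
  "\<lbrakk>x \<in> C0 X; u \<in> Obj (P0 F x)\<rbrakk> \<Longrightarrow> FObj (T0 (mkpt X F G s0 s1 t) x) u = s0 x u"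
  "\<lbrakk>x \<in> C0 X; m \<in> Arr (P0 F x)\<rbrakk> \<Longrightarrow> FArr (T0 (mkpt X F G s0 s1 t) x) m = s1 x m"
  "\<lbrakk>f \<in> C1 X; u \<in> Obj (P0 F (Src X f))\<rbrakk> \<Longrightarrow> NMap (T1 (mkpt X F G s0 s1 t) f) u = t f u"
  by (simp_all add: mkpt_def)

lemma mkmd_simps [simp]:
  "MDom (mkmd X F \<sigma> \<sigma>' c) = \<sigma>" "MCod (mkmd X F \<sigma> \<sigma>' c) = \<sigma>'"
  "\<lbrakk>x \<in> C0 X; u \<in> Obj (P0 F x)\<rbrakk> \<Longrightarrow> NMap (MMap (mkmd X F \<sigma> \<sigma>' c) x) u = c x u"
  by (simp_all add: mkmd_def)

section \<open>Transformations and modifications determined by their components\<close>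

locale ps = F: strict_pf X F + G: cat_pf X G
  for X :: "('x0, 'x1, 'x2) two_cat"
    and F :: "('x0, 'x1, 'x2, 'o1, 'm1) cat_pfunc" and G :: "('x0, 'x1, 'x2, 'o2, 'm2) cat_pfunc"
begin

lemma pseudonatural_psdata:
  assumes "pseudonatural X F G \<sigma>"
  shows "psdata X F G (o0 \<sigma>) (o1 \<sigma>) (o2 \<sigma>)"
proof -
  interpret s: pseudonatural X F G \<sigma> by fact
  note [simp] = s.T0_functor s.FDom_T0 s.FCod_T0 s.T1_iso s.NDom_T1 s.NCod_T1
  have t: "iso_arr (P0 G y) (o2 \<sigma> f u)" "o2 \<sigma> f u \<in> Arr (P0 G y)"
    "Dom (P0 G y) (o2 \<sigma> f u) = G.fo f (o0 \<sigma> (Src X f) u)"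
    "Cod (P0 G y) (o2 \<sigma> f u) = o0 \<sigma> y (FObj (P1 F f) u)"
    if "f \<in> C1 X" "u \<in> Obj (P0 F (Src X f))" "Trg X f = y" for f u y
    using nat_iso_iso[of "T1 \<sigma> f" u] is_ntransD(6-8)[of "T1 \<sigma> f" "P0 G y" u] nat_isoD[of "T1 \<sigma> f"] that by simp_all
  show ?thesis
  proof (rule psdataI, goal_cases)
    case (10 f m)
    then show ?case using is_ntrans.naturality[of "T1 \<sigma> f" m] by simp
  next
    case (11 \<alpha> u)
    then show ?case using arg_cong[OF s.T1_natural[OF 11(1)], of "\<lambda>a. NMap a u"] by (simp add: t)
  next
    case (12 f g u)
    then show ?case using arg_cong[OF s.T1_Comp1[OF 12(1-3)], of "\<lambda>a. NMap a u"] by (simp add: t)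
  next
    case (13 x u)
    then show ?case using arg_cong[OF s.T1_Id1[OF 13(1)], of "\<lambda>a. NMap a u"] by (simp add: t)
  qed (simp_all add: t)
qed

lemma pseudonatural_mkpt:
  assumes "psdata X F G s0 s1 t"
  shows "pseudonatural X F G (mkpt X F G s0 s1 t)" (is "pseudonatural X F G ?\<sigma>")
proof -
  interpret s: psdata X F G s0 s1 t by fact
  note [simp] = s.s_simps
  have T0: "T0 ?\<sigma> \<in> extensional (C0 X)" "T1 ?\<sigma> \<in> extensional (C1 X)"
    "\<And>f. f \<in> C1 X \<Longrightarrow> NDom (T1 ?\<sigma> f) = P1 G f \<odot> T0 ?\<sigma> (Src X f)"
    "\<And>f. f \<in> C1 X \<Longrightarrow> NCod (T1 ?\<sigma> f) = T0 ?\<sigma> (Trg X f) \<odot> P1 F f"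
    and FD: "\<And>x. x \<in> C0 X \<Longrightarrow> FDom (T0 ?\<sigma> x) = P0 F x" "\<And>x. x \<in> C0 X \<Longrightarrow> FCod (T0 ?\<sigma> x) = P0 G x"
    by (simp_all add: mkpt_def)
  have E: "FObj (T0 ?\<sigma> x) \<in> extensional (Obj (P0 F x))" "FArr (T0 ?\<sigma> x) \<in> extensional (Arr (P0 F x))" if "x \<in> C0 X" for x
    using that by (simp_all add: mkpt_def)
  have E1: "NMap (T1 ?\<sigma> f) \<in> extensional (Obj (P0 F (Src X f)))" if "f \<in> C1 X" for f
    using that by (simp add: mkpt_def)
  have fctr: "is_functor (T0 ?\<sigma> x)" if "x \<in> C0 X" for x
    using that by (intro is_functor.intro) (simp_all add: FD E)
  note [simp] = T0 FD fctr
  have nt: "is_ntrans (T1 ?\<sigma> f)" if "f \<in> C1 X" for f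
    using that s.t_natural by (intro is_ntrans.intro) (simp_all add: E1)
  then have iso: "is_nat_iso (T1 ?\<sigma> f)" if "f \<in> C1 X" for f
    using that by (intro nat_isoI) simp_all
  note [simp] = nt iso
  show ?thesis
  proof (rule pseudonatural.intro, goal_cases)
    case (9 \<alpha>)
    then show ?case by (intro ntrans_eqI) (simp_all add: s.t_natural2)
  next
    case (10 f g)
    then show ?case by (intro ntrans_eqI) (simp_all add: s.t_Comp1)
  next
    case (11 x)
    then show ?case by (intro ntrans_eqI) (simp_all add: s.t_Id1)
  qed simp_all
qed

text \<open>Domains and codomains of \<open>T0\<close> and \<open>T1\<close> are prescribed by the
  axioms and extensionality fixes the rest, so only the components are left to compare.\<close>

lemma ptrans_eqI:
  assumes "pseudonatural X F G \<sigma>" "pseudonatural X F G \<tau>"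
    and 0: "\<And>x u. \<lbrakk>x \<in> C0 X; u \<in> Obj (P0 F x)\<rbrakk> \<Longrightarrow> o0 \<sigma> x u = o0 \<tau> x u"
    and 1: "\<And>x m. \<lbrakk>x \<in> C0 X; m \<in> Arr (P0 F x)\<rbrakk> \<Longrightarrow> o1 \<sigma> x m = o1 \<tau> x m"
    and 2: "\<And>f u. \<lbrakk>f \<in> C1 X; u \<in> Obj (P0 F (Src X f))\<rbrakk> \<Longrightarrow> o2 \<sigma> f u = o2 \<tau> f u"
  shows "\<sigma> = \<tau>"
proof -
  interpret s: pseudonatural X F G \<sigma> by fact
  interpret t: pseudonatural X F G \<tau> by fact
  have T: "T0 \<sigma> x = T0 \<tau> x" if "x \<in> C0 X" for x
    using that 0 1 s.T0_functor t.T0_functor s.FDom_T0 t.FDom_T0 s.FCod_T0 t.FCod_T0 by (intro func_eqI) simp_all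
  have "T1 \<sigma> f = T1 \<tau> f" if "f \<in> C1 X" for f
    using that 2 s.T1_iso t.T1_iso s.NDom_T1 t.NDom_T1 s.NCod_T1 t.NCod_T1 T t.FDom_T0 by (intro ntrans_eqI) simp_all
  then show ?thesis
    using T s.T0_ext t.T0_ext s.T1_ext t.T1_ext
    by (intro ptrans.equality extensionalityI[of _ "C0 X"] extensionalityI[of _ "C1 X"]) auto
qed

lemma modification_mdata:
  assumes "modification X F G \<Gamma>"
  shows "mdata X F G (MDom \<Gamma>) (MCod \<Gamma>) (md \<Gamma>)"
proof -
  interpret m: modification X F G \<Gamma> by fact
  interpret s: pseudonatural X F G "MDom \<Gamma>" by (rule m.pseudonatural_MDom)
  interpret s': pseudonatural X F G "MCod \<Gamma>" by (rule m.pseudonatural_MCod)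
  interpret sd: psdata X F G "o0 (MDom \<Gamma>)" "o1 (MDom \<Gamma>)" "o2 (MDom \<Gamma>)"
    by (rule pseudonatural_psdata[OF m.pseudonatural_MDom])
  interpret sd': psdata X F G "o0 (MCod \<Gamma>)" "o1 (MCod \<Gamma>)" "o2 (MCod \<Gamma>)"
    by (rule pseudonatural_psdata[OF m.pseudonatural_MCod])
  note [simp] = s.T0_functor s.FDom_T0 s.FCod_T0 s.T1_iso s.NDom_T1 s.NCod_T1
    s'.T0_functor s'.FDom_T0 s'.FCod_T0 s'.T1_iso s'.NDom_T1 s'.NCod_T1
    m.MMap_ntrans m.NDom_MMap m.NCod_MMap sd.s_simps sd'.s_simps
  have c: "md \<Gamma> x u \<in> Arr (P0 G x)" "Dom (P0 G x) (md \<Gamma> x u) = o0 (MDom \<Gamma>) x u"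
    "Cod (P0 G x) (md \<Gamma> x u) = o0 (MCod \<Gamma>) x u" if "x \<in> C0 X" "u \<in> Obj (P0 F x)" for x u
    using is_ntransD(6-8)[of "MMap \<Gamma> x" "P0 G x" u] that by simp_all
  show ?thesis
  proof (rule mdata.intro, goal_cases)
    case (4 x m)
    then show ?case using is_ntrans.naturality[of "MMap \<Gamma> x" m] by simp
  next
    case (5 f u)
    then show ?case using arg_cong[OF m.MMap_natural[OF 5(1)], of "\<lambda>a. NMap a u"] by (simp add: c)
  qed (simp_all add: c)
qed

lemma modification_mkmd:
  assumes "pseudonatural X F G \<sigma>" "pseudonatural X F G \<sigma>'" "mdata X F G \<sigma> \<sigma>' c"
  shows "modification X F G (mkmd X F \<sigma> \<sigma>' c)"
proof -
  interpret s: pseudonatural X F G \<sigma> by fact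
  interpret s': pseudonatural X F G \<sigma>' by fact
  interpret sd: psdata X F G "o0 \<sigma>" "o1 \<sigma>" "o2 \<sigma>" by (rule pseudonatural_psdata) fact
  interpret sd': psdata X F G "o0 \<sigma>'" "o1 \<sigma>'" "o2 \<sigma>'" by (rule pseudonatural_psdata) fact
  interpret m: mdata X F G \<sigma> \<sigma>' c by fact
  note [simp] = s.T0_functor s.FDom_T0 s.FCod_T0 s.T1_iso s.NDom_T1 s.NCod_T1
    s'.T0_functor s'.FDom_T0 s'.FCod_T0 s'.T1_iso s'.NDom_T1 s'.NCod_T1
    sd.s_simps sd'.s_simps m.c_in m.Dom_c m.Cod_c
  let ?\<Gamma> = "mkmd X F \<sigma> \<sigma>' c"
  have M: "MMap ?\<Gamma> \<in> extensional (C0 X)" "\<And>x. x \<in> C0 X \<Longrightarrow> NDom (MMap ?\<Gamma> x) = T0 \<sigma> x"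
    "\<And>x. x \<in> C0 X \<Longrightarrow> NCod (MMap ?\<Gamma> x) = T0 \<sigma>' x"
    "\<And>x. x \<in> C0 X \<Longrightarrow> NMap (MMap ?\<Gamma> x) \<in> extensional (Obj (P0 F x))"
    by (simp_all add: mkmd_def)
  have N: "is_ntrans (MMap ?\<Gamma> x)" if "x \<in> C0 X" for x
    using that m.c_natural by (intro is_ntrans.intro) (simp_all add: M)
  show ?thesis
  proof (rule modification.intro, goal_cases)
    case (7 f)
    then show ?case by (intro ntrans_eqI) (simp_all add: M N m.c_modif)
  qed (simp_all add: M N assms)
qed

lemma modif_eqI:
  assumes "modification X F G \<Gamma>" "modification X F G \<Delta>" "MDom \<Gamma> = MDom \<Delta>" "MCod \<Gamma> = MCod \<Delta>"
    and 0: "\<And>x u. \<lbrakk>x \<in> C0 X; u \<in> Obj (P0 F x)\<rbrakk> \<Longrightarrow> md \<Gamma> x u = md \<Delta> x u"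
  shows "\<Gamma> = \<Delta>"
proof -
  interpret s: modification X F G \<Gamma> by fact
  interpret t: modification X F G \<Delta> by fact
  interpret p: pseudonatural X F G "MDom \<Delta>" by (rule t.pseudonatural_MDom)
  have "MMap \<Gamma> x = MMap \<Delta> x" if "x \<in> C0 X" for x
    using that 0 assms(3,4) s.MMap_ntrans t.MMap_ntrans s.NDom_MMap t.NDom_MMap s.NCod_MMap t.NCod_MMap p.FDom_T0
    by (intro ntrans_eqI) simp_all
  then show ?thesis
    using s.MMap_ext t.MMap_ext assms(3,4)
    by (intro modif.equality extensionalityI[of _ "C0 X"]) auto
qed

end

section \<open>The category of pseudonatural transformations\<close>

lemma PS_hom_simps [simp]:
  "\<sigma> \<in> Obj (PS_hom X F G) \<longleftrightarrow> pseudonatural X F G \<sigma>"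
  "\<Gamma> \<in> Arr (PS_hom X F G) \<longleftrightarrow> modification X F G \<Gamma>"
  "Dom (PS_hom X F G) = MDom" "Cod (PS_hom X F G) = MCod"
  "MDom (Idn (PS_hom X F G) \<sigma>) = \<sigma>" "MCod (Idn (PS_hom X F G) \<sigma>) = \<sigma>"
  "MDom (Comp (PS_hom X F G) \<Delta> \<Gamma>) = MDom \<Gamma>" "MCod (Comp (PS_hom X F G) \<Delta> \<Gamma>) = MCod \<Delta>"
  by (simp_all add: PS_hom_def)

context ps
begin

lemma modification_MDom [simp]: "modification X F G \<Gamma> \<Longrightarrow> pseudonatural X F G (MDom \<Gamma>)"
  and modification_MCod [simp]: "modification X F G \<Gamma> \<Longrightarrow> pseudonatural X F G (MCod \<Gamma>)"
  by (simp_all add: modification_def)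

lemma o_simps [simp]:
  assumes "pseudonatural X F G \<sigma>"
  shows "\<lbrakk>x \<in> C0 X; u \<in> Obj (P0 F x)\<rbrakk> \<Longrightarrow> o0 \<sigma> x u \<in> Obj (P0 G x)"
    "\<lbrakk>x \<in> C0 X; m \<in> Arr (P0 F x)\<rbrakk> \<Longrightarrow> o1 \<sigma> x m \<in> Arr (P0 G x)"
    "\<lbrakk>x \<in> C0 X; m \<in> Arr (P0 F x)\<rbrakk> \<Longrightarrow> Dom (P0 G x) (o1 \<sigma> x m) = o0 \<sigma> x (Dom (P0 F x) m)"
    "\<lbrakk>x \<in> C0 X; m \<in> Arr (P0 F x)\<rbrakk> \<Longrightarrow> Cod (P0 G x) (o1 \<sigma> x m) = o0 \<sigma> x (Cod (P0 F x) m)"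
    "\<lbrakk>x \<in> C0 X; u \<in> Obj (P0 F x)\<rbrakk> \<Longrightarrow> o1 \<sigma> x (Idn (P0 F x) u) = Idn (P0 G x) (o0 \<sigma> x u)"
    "\<lbrakk>x \<in> C0 X; m \<in> Arr (P0 F x); n \<in> Arr (P0 F x); Cod (P0 F x) m = Dom (P0 F x) n\<rbrakk>
      \<Longrightarrow> o1 \<sigma> x (Comp (P0 F x) n m) = Comp (P0 G x) (o1 \<sigma> x n) (o1 \<sigma> x m)"
    "\<lbrakk>f \<in> C1 X; u \<in> Obj (P0 F (Src X f)); Trg X f = y\<rbrakk> \<Longrightarrow> iso_arr (P0 G y) (o2 \<sigma> f u)"
    "\<lbrakk>f \<in> C1 X; u \<in> Obj (P0 F (Src X f)); Trg X f = y\<rbrakk> \<Longrightarrow> o2 \<sigma> f u \<in> Arr (P0 G y)"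
    "\<lbrakk>f \<in> C1 X; u \<in> Obj (P0 F (Src X f)); Trg X f = y\<rbrakk> \<Longrightarrow> Dom (P0 G y) (o2 \<sigma> f u) = FObj (P1 G f) (o0 \<sigma> (Src X f) u)"
    "\<lbrakk>f \<in> C1 X; u \<in> Obj (P0 F (Src X f)); Trg X f = y\<rbrakk> \<Longrightarrow> Cod (P0 G y) (o2 \<sigma> f u) = o0 \<sigma> y (FObj (P1 F f) u)"
  using pstyped.s_simps[OF psdata.axioms(1)[OF pseudonatural_psdata[OF assms]]] by simp_all

lemma md_simps [simp]:
  assumes "modification X F G \<Gamma>" "x \<in> C0 X" "u \<in> Obj (P0 F x)"
  shows "md \<Gamma> x u \<in> Arr (P0 G x)" "Dom (P0 G x) (md \<Gamma> x u) = o0 (MDom \<Gamma>) x u"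
    "Cod (P0 G x) (md \<Gamma> x u) = o0 (MCod \<Gamma>) x u"
  using mdata.c_in[OF modification_mdata[OF assms(1)]] mdata.Dom_c[OF modification_mdata[OF assms(1)]]
    mdata.Cod_c[OF modification_mdata[OF assms(1)]] assms(2,3) by simp_all

lemmas o2_natural = psdata.t_natural[OF pseudonatural_psdata]
  and o2_natural2 = psdata.t_natural2[OF pseudonatural_psdata]
  and o2_Comp1 = psdata.t_Comp1[OF pseudonatural_psdata]
  and o2_Id1 = psdata.t_Id1[OF pseudonatural_psdata]
  and md_natural = mdata.c_natural[OF modification_mdata]
  and md_modif = mdata.c_modif[OF modification_mdata]

text \<open>Composites, and likewise identities, are literally of the form \<open>mkmd\<close>, so
  closure of modifications under them reduces to the component laws \<open>mdata\<close>.\<close>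

lemma Comp_mkmd: "Comp (PS_hom X F G) \<Delta> \<Gamma> =
    mkmd X F (MDom \<Gamma>) (MCod \<Delta>) (\<lambda>x u. Comp (P0 G x) (md \<Delta> x u) (md \<Gamma> x u))"
  if "modification X F G \<Gamma>" "modification X F G \<Delta>" "MCod \<Gamma> = MDom \<Delta>"
proof -
  interpret G: modification X F G \<Gamma> by fact
  interpret D: modification X F G \<Delta> by fact
  have "FDom (T0 (MDom \<Gamma>) x) = P0 F x" "FCod (T0 (MDom \<Gamma>) x) = P0 G x" if "x \<in> C0 X" for x
    using that pseudonatural.FDom_T0[OF G.pseudonatural_MDom] pseudonatural.FCod_T0[OF G.pseudonatural_MDom] by auto
  then show ?thesis
    by (simp add: PS_hom_def mkmd_def vcomp_nt_def G.NDom_MMap D.NCod_MMap cong: restrict_cong)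
qed

lemma Idn_mkmd: "Idn (PS_hom X F G) \<sigma> = mkmd X F \<sigma> \<sigma> (\<lambda>x u. Idn (P0 G x) (o0 \<sigma> x u))"
  if "pseudonatural X F G \<sigma>"
  using pseudonatural.FDom_T0[OF that] pseudonatural.FCod_T0[OF that]
  by (simp add: PS_hom_def mkmd_def id_nt_def cong: restrict_cong)

lemma modification_Idn: "modification X F G (Idn (PS_hom X F G) \<sigma>)" if \<sigma>: "pseudonatural X F G \<sigma>"
  unfolding Idn_mkmd[OF that]
  by (rule modification_mkmd[OF \<sigma> \<sigma>], rule mdata.intro) (use \<sigma> in simp_all)

lemma modification_Comp:
  assumes G: "modification X F G \<Gamma>" and D: "modification X F G \<Delta>" and c: "MCod \<Gamma> = MDom \<Delta>"
  shows "modification X F G (Comp (PS_hom X F G) \<Delta> \<Gamma>)"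
  unfolding Comp_mkmd[OF assms]
proof (rule modification_mkmd, goal_cases)
  case 3
  show ?case
  proof (rule mdata.intro, goal_cases)
    case (4 x m)
    show ?case
      by (rule paste_squares[where ?f2.0 = "o1 (MDom \<Delta>) x m"])
        (use G D c 4 md_natural[OF G 4] md_natural[OF D 4] in simp_all)
  next
    case (5 f u)
    let ?C = "P0 G (Trg X f)"
    have "Comp ?C (Comp ?C (md \<Delta> (Trg X f) (FObj (P1 F f) u)) (md \<Gamma> (Trg X f) (FObj (P1 F f) u))) (o2 (MDom \<Gamma>) f u) =
      Comp ?C (o2 (MCod \<Delta>) f u) (Comp ?C (FArr (P1 G f) (md \<Delta> (Src X f) u)) (FArr (P1 G f) (md \<Gamma> (Src X f) u)))"
      by (rule paste_squares[where ?f2.0 = "o2 (MDom \<Delta>) f u"])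
        (use G D c 5 md_modif[OF G 5] md_modif[OF D 5] in simp_all)
    then show ?case using G D c 5 by simp
  qed (use G D c in simp_all)
qed (use G D in simp_all)

lemma md_Comp [simp]:
  assumes "modification X F G \<Gamma>" "modification X F G \<Delta>" "MCod \<Gamma> = MDom \<Delta>" "x \<in> C0 X" "u \<in> Obj (P0 F x)"
  shows "md (Comp (PS_hom X F G) \<Delta> \<Gamma>) x u = Comp (P0 G x) (md \<Delta> x u) (md \<Gamma> x u)"
  using assms by (simp add: Comp_mkmd)

lemma md_Idn [simp]:
  "\<lbrakk>pseudonatural X F G \<sigma>; x \<in> C0 X; u \<in> Obj (P0 F x)\<rbrakk> \<Longrightarrow> md (Idn (PS_hom X F G) \<sigma>) x u = Idn (P0 G x) (o0 \<sigma> x u)"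
  by (simp add: Idn_mkmd)

lemma category_PS_hom [simp]: "category (PS_hom X F G)"
proof (rule category.intro, goal_cases)
  case (9 \<Gamma>) then show ?case
    by (intro modif_eqI) (simp_all add: modification_Comp modification_Idn)
next
  case (10 \<Gamma>) then show ?case
    by (intro modif_eqI) (simp_all add: modification_Comp modification_Idn)
next
  case (11 \<Gamma> \<Delta> \<Theta>) then show ?case
    by (intro modif_eqI) (simp_all add: modification_Comp Comp_assoc')
qed (simp_all add: modification_Comp modification_Idn)

text \<open>Pointwise inverses satisfy both laws of a modification by
  \<open>inv_square\<close>.\<close>

lemma iso_PS_homI:
  assumes G: "modification X F G \<Gamma>" and i: "\<And>x u. \<lbrakk>x \<in> C0 X; u \<in> Obj (P0 F x)\<rbrakk> \<Longrightarrow> iso_arr (P0 G x) (md \<Gamma> x u)"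
  shows "iso_arr (PS_hom X F G) \<Gamma>"
proof -
  let ?\<Delta> = "mkmd X F (MCod \<Gamma>) (MDom \<Gamma>) (\<lambda>x u. inv_arr (P0 G x) (md \<Gamma> x u))"
  note [simp] = G i
  have D: "modification X F G ?\<Delta>"
  proof (rule modification_mkmd, goal_cases)
    case 3 show ?case
    proof (rule mdata.intro, goal_cases)
      case (4 x m)
      show ?case
        by (rule inv_square) (use 4 md_natural[OF G 4] in simp_all)
    next
      case (5 f u)
      have i: "iso_arr (P0 G (Trg X f)) (FArr (P1 G f) (md \<Gamma> (Src X f) u))"
        using iso_FArr[of "P1 G f"] 5 by simp
      \<comment> \<open>The functor \<open>P1 G f\<close> carries the inverse component to an
        inverse, which brings the law into the shape of \<open>inv_square\<close>.\<close>
      have e: "FArr (P1 G f) (inv_arr (P0 G (Src X f)) (md \<Gamma> (Src X f) u)) = inv_arr (P0 G (Trg X f)) (FArr (P1 G f) (md \<Gamma> (Src X f) u))"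
        using FArr_inv_arr[of "P1 G f" "md \<Gamma> (Src X f) u"] 5 by simp
      show ?case using 5
        by (simp add: e) (rule inv_square[symmetric]; use 5 i md_modif[OF G 5] in simp)
    qed simp_all
  qed simp_all
  show ?thesis
    by (rule iso_arrI[where g = ?\<Delta>]; (rule modif_eqI)?)
      (use D in \<open>simp_all add: modification_Comp modification_Idn\<close>)
qed

text \<open>The components of the inverse modification are the inverses. It lets the components of
  an iterated transformation be seen as invertible arrows, not only as invertible
  modifications.\<close>

lemma iso_PS_homD:
  assumes G: "iso_arr (PS_hom X F G) \<Gamma>" and "x \<in> C0 X" "u \<in> Obj (P0 F x)"
  shows "iso_arr (P0 G x) (md \<Gamma> x u)"
proof -
  let ?D = "inv_arr (PS_hom X F G) \<Gamma>"
  have g: "modification X F G \<Gamma>" "modification X F G ?D" "MDom ?D = MCod \<Gamma>" "MCod ?D = MDom \<Gamma>"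
    using iso_arrD[OF G] inv_arr_in[OF G] Dom_inv_arr[OF G] Cod_inv_arr[OF G] by simp_all
  have "md (Comp (PS_hom X F G) ?D \<Gamma>) x u = md (Idn (PS_hom X F G) (MDom \<Gamma>)) x u"
    "md (Comp (PS_hom X F G) \<Gamma> ?D) x u = md (Idn (PS_hom X F G) (MCod \<Gamma>)) x u"
    using inv_arr_left[OF G] inv_arr_right[OF G] by simp_all
  then show ?thesis
    using g assms(2,3) by (intro iso_arrI[where g = "md ?D x u"]) (simp_all del: inv_arr_left inv_arr_right)
qed

end

section \<open>The hom-pseudofunctor and reindexing\<close>

lemma op2_simps [simp]:
  "C0 (op2 X) = C0 X" "C1 (op2 X) = C1 X" "C2 (op2 X) = C2 X" "Src (op2 X) = Trg X" "Trg (op2 X) = Src X"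
  "Dom2 (op2 X) = Dom2 X" "Cod2 (op2 X) = Cod2 X" "Id1 (op2 X) = Id1 X" "Id2 (op2 X) = Id2 X"
  "Comp1 (op2 X) g f = Comp1 X f g" "VComp (op2 X) = VComp X" "HComp (op2 X) \<beta> \<alpha> = HComp X \<alpha> \<beta>"
  by (simp_all add: op2_def)

lemma prod2_simps [simp]:
  "C0 (X \<times>\<^sub>2 Y) = C0 X \<times> C0 Y" "C1 (X \<times>\<^sub>2 Y) = C1 X \<times> C1 Y" "C2 (X \<times>\<^sub>2 Y) = C2 X \<times> C2 Y"
  "Src (X \<times>\<^sub>2 Y) (f, g) = (Src X f, Src Y g)" "Trg (X \<times>\<^sub>2 Y) (f, g) = (Trg X f, Trg Y g)"
  "Dom2 (X \<times>\<^sub>2 Y) (\<alpha>, \<beta>) = (Dom2 X \<alpha>, Dom2 Y \<beta>)" "Cod2 (X \<times>\<^sub>2 Y) (\<alpha>, \<beta>) = (Cod2 X \<alpha>, Cod2 Y \<beta>)"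
  "Id1 (X \<times>\<^sub>2 Y) (x, y) = (Id1 X x, Id1 Y y)" "Id2 (X \<times>\<^sub>2 Y) (f, g) = (Id2 X f, Id2 Y g)"
  "Comp1 (X \<times>\<^sub>2 Y) (f', g') (f, g) = (Comp1 X f' f, Comp1 Y g' g)"
  "VComp (X \<times>\<^sub>2 Y) (\<alpha>', \<beta>') (\<alpha>, \<beta>) = (VComp X \<alpha>' \<alpha>, VComp Y \<beta>' \<beta>)"
  "HComp (X \<times>\<^sub>2 Y) (\<alpha>', \<beta>') (\<alpha>, \<beta>) = (HComp X \<alpha>' \<alpha>, HComp Y \<beta>' \<beta>)"
  by (simp_all add: prod2_def)

lemma hom_func_simps [simp]:
  "FDom (hom_func X f g) = hom_cat X (Trg X f) (Src X g)" "FCod (hom_func X f g) = hom_cat X (Src X f) (Trg X g)"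
  "\<lbrakk>h \<in> C1 X; Src X h = Trg X f; Trg X h = Src X g\<rbrakk> \<Longrightarrow> FObj (hom_func X f g) h = Comp1 X g (Comp1 X h f)"
  "\<lbrakk>\<gamma> \<in> C2 X; Src X (Dom2 X \<gamma>) = Trg X f; Trg X (Dom2 X \<gamma>) = Src X g\<rbrakk>
    \<Longrightarrow> FArr (hom_func X f g) \<gamma> = HComp X (Id2 X g) (HComp X \<gamma> (Id2 X f))"
  by (simp_all add: hom_func_def Let_def)

lemma hom_ntrans_simps [simp]:
  "NDom (hom_ntrans X \<alpha> \<beta>) = hom_func X (Dom2 X \<alpha>) (Dom2 X \<beta>)"
  "NCod (hom_ntrans X \<alpha> \<beta>) = hom_func X (Cod2 X \<alpha>) (Cod2 X \<beta>)"
  "\<lbrakk>h \<in> C1 X; Src X h = Trg X (Dom2 X \<alpha>); Trg X h = Src X (Dom2 X \<beta>)\<rbrakk>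
    \<Longrightarrow> NMap (hom_ntrans X \<alpha> \<beta>) h = HComp X \<beta> (HComp X (Id2 X h) \<alpha>)"
  by (simp_all add: hom_ntrans_def)

lemma hom_pfunc_simps [simp]:
  "P0 (hom_pfunc X) (x, y) = hom_cat X x y" "P1 (hom_pfunc X) (f, g) = hom_func X f g"
  "P2 (hom_pfunc X) (\<alpha>, \<beta>) = hom_ntrans X \<alpha> \<beta>"
  by (simp_all add: hom_pfunc_def)

section \<open>The hom-pseudofunctor is strict\<close>

context two_category
begin

lemma hom_func_functor [simp]: "\<lbrakk>f \<in> C1 X; g \<in> C1 X\<rbrakk> \<Longrightarrow> is_functor (hom_func X f g)"
proof (rule is_functor.intro, goal_cases)
  case (10 \<gamma> \<delta>)
  \<comment> \<open>Whiskering by \<open>f\<close> and then by \<open>g\<close> respects vertical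
    composition, by two interchanges with identity 2-cells.\<close>
  then show ?case
    using interchange[of "Id2 X f" "Id2 X f" \<gamma> \<delta>]
      interchange[of "HComp X \<gamma> (Id2 X f)" "HComp X \<delta> (Id2 X f)" "Id2 X g" "Id2 X g"] by simp
qed (simp_all, simp_all add: hom_func_def Let_def)

text \<open>Both sides of the naturality square equal the horizontal composite of \<beta>, \<gamma>
  and \<alpha>, each by two interchanges.\<close>

lemma hom_ntrans_ntrans [simp]: "\<lbrakk>\<alpha> \<in> C2 X; \<beta> \<in> C2 X\<rbrakk> \<Longrightarrow> is_ntrans (hom_ntrans X \<alpha> \<beta>)"
proof (rule is_ntrans.intro, goal_cases)
  case (9 \<gamma>)
  let ?h = "Dom2 X \<gamma>" and ?h' = "Cod2 X \<gamma>"
  from 9 have \<gamma>: "\<gamma> \<in> C2 X" "Src X ?h = Trg X (Dom2 X \<alpha>)" "Trg X ?h = Src X (Dom2 X \<beta>)" by simp_all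
  have "VComp X (HComp X \<beta> (HComp X (Id2 X ?h') \<alpha>)) (HComp X (Id2 X (Dom2 X \<beta>)) (HComp X \<gamma> (Id2 X (Dom2 X \<alpha>)))) =
     HComp X \<beta> (HComp X \<gamma> \<alpha>)"
    using 9 \<gamma> interchange[of "HComp X \<gamma> (Id2 X (Dom2 X \<alpha>))" "HComp X (Id2 X ?h') \<alpha>" "Id2 X (Dom2 X \<beta>)" \<beta>]
      interchange[of "Id2 X (Dom2 X \<alpha>)" \<alpha> \<gamma> "Id2 X ?h'"] by simp
  moreover have "VComp X (HComp X (Id2 X (Cod2 X \<beta>)) (HComp X \<gamma> (Id2 X (Cod2 X \<alpha>)))) (HComp X \<beta> (HComp X (Id2 X ?h) \<alpha>)) =
     HComp X \<beta> (HComp X \<gamma> \<alpha>)"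
    using 9 \<gamma> interchange[of "HComp X (Id2 X ?h) \<alpha>" "HComp X \<gamma> (Id2 X (Cod2 X \<alpha>))" \<beta> "Id2 X (Cod2 X \<beta>)"]
      interchange[of \<alpha> "Id2 X (Cod2 X \<alpha>)" "Id2 X ?h" \<gamma>] by simp
  ultimately show ?case using 9 \<gamma> by simp
qed (simp_all, simp_all add: hom_ntrans_def)

lemma strict_hom_pfunc: "strict_pf (op2 X \<times>\<^sub>2 X) (hom_pfunc X)"
proof -
  \<comment> \<open>The first argument is contravariant: \<open>Comp1 X f f'\<close> is the
    composite of \<open>f'\<close> after \<open>f\<close> in \<open>op2 X\<close>.\<close>
  have c: "hom_func X (Comp1 X f f') (Comp1 X g' g) = hom_func X f' g' \<odot> hom_func X f g"
    if "f \<in> C1 X" "g \<in> C1 X" "f' \<in> C1 X" "g' \<in> C1 X" "Src X f = Trg X f'" "Trg X g = Src X g'" for f g f' g'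
    using that by (intro func_eqI) (simp_all add: Comp1_assoc HComp_assoc flip: HComp_Id2)
  have i: "hom_func X (Id1 X x) (Id1 X y) = id_func (hom_cat X x y)" if "x \<in> C0 X" "y \<in> C0 X" for x y
    using that by (intro func_eqI) simp_all
  have n: "hom_ntrans X (Id2 X f) (Id2 X g) = id_nt (hom_func X f g)" if "f \<in> C1 X" "g \<in> C1 X" for f g
    using that by (intro ntrans_eqI) simp_all
  have X: "two_category X" by unfold_locales
  show ?thesis
  proof (intro strict_pf.intro strict_pf_axioms.intro, goal_cases)
    case 1 then show ?case using X by simp
  next
    case (10 f g) then show ?case by (cases f; cases g) (simp add: c)
  next
    case (12 f g) then show ?case by (cases f; cases g) (simp add: hom_pfunc_def)
  next
    case (13 x) then show ?case by (cases x) (simp add: hom_pfunc_def)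
  qed (auto simp: n i)
qed

end

section \<open>Reindexing along a strict 2-functor\<close>

lemma reindex_simps [simp]:
  "P0 (reindex k0 k1 k2 T) x = P0 T (k0 x)" "P1 (reindex k0 k1 k2 T) f = P1 T (k1 f)"
  "P2 (reindex k0 k1 k2 T) \<alpha> = P2 T (k2 \<alpha>)" "PComp (reindex k0 k1 k2 T) g f = PComp T (k1 g) (k1 f)"
  "PUnit (reindex k0 k1 k2 T) x = PUnit T (k0 x)"
  by (simp_all add: reindex_def)

lemma pseudofunctor_reindex:
  assumes X: "two_category X" and T: "pseudofunctor Y Z T"
    and k: "\<And>x. x \<in> C0 X \<Longrightarrow> k0 x \<in> C0 Y" "\<And>f. f \<in> C1 X \<Longrightarrow> k1 f \<in> C1 Y" "\<And>\<alpha>. \<alpha> \<in> C2 X \<Longrightarrow> k2 \<alpha> \<in> C2 Y"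
      "\<And>f. f \<in> C1 X \<Longrightarrow> Src Y (k1 f) = k0 (Src X f)" "\<And>f. f \<in> C1 X \<Longrightarrow> Trg Y (k1 f) = k0 (Trg X f)"
      "\<And>\<alpha>. \<alpha> \<in> C2 X \<Longrightarrow> Dom2 Y (k2 \<alpha>) = k1 (Dom2 X \<alpha>)" "\<And>\<alpha>. \<alpha> \<in> C2 X \<Longrightarrow> Cod2 Y (k2 \<alpha>) = k1 (Cod2 X \<alpha>)"
      "\<And>x. x \<in> C0 X \<Longrightarrow> k1 (Id1 X x) = Id1 Y (k0 x)" "\<And>f. f \<in> C1 X \<Longrightarrow> k2 (Id2 X f) = Id2 Y (k1 f)"
      "\<And>f g. \<lbrakk>f \<in> C1 X; g \<in> C1 X; Trg X f = Src X g\<rbrakk> \<Longrightarrow> k1 (Comp1 X g f) = Comp1 Y (k1 g) (k1 f)"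
      "\<And>\<alpha> \<beta>. \<lbrakk>\<alpha> \<in> C2 X; \<beta> \<in> C2 X; Cod2 X \<alpha> = Dom2 X \<beta>\<rbrakk> \<Longrightarrow> k2 (VComp X \<beta> \<alpha>) = VComp Y (k2 \<beta>) (k2 \<alpha>)"
      "\<And>\<alpha> \<beta>. \<lbrakk>\<alpha> \<in> C2 X; \<beta> \<in> C2 X; Trg X (Dom2 X \<alpha>) = Src X (Dom2 X \<beta>)\<rbrakk> \<Longrightarrow> k2 (HComp X \<beta> \<alpha>) = HComp Y (k2 \<beta>) (k2 \<alpha>)"
  shows "pseudofunctor X Z (reindex k0 k1 k2 T)"
proof -
  interpret X: two_category X by fact
  interpret T: pseudofunctor Y Z T by fact
  show ?thesis
  proof (rule pseudofunctor.intro, goal_cases)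
    case (17 f g h)
    then show ?case using T.PComp_assoc[of "k1 f" "k1 g" "k1 h"] by (simp add: k)
  next
    case (18 f)
    then show ?case using T.PComp_unit_right[of "k1 f"] by (simp add: k)
  next
    case (19 f)
    then show ?case using T.PComp_unit_left[of "k1 f"] by (simp add: k)
  next
    case (13 \<alpha> \<beta>)
    then show ?case using T.PComp_natural[of "k2 \<alpha>" "k2 \<beta>"] by (simp add: k)
  qed (simp_all add: k T.P0_in T.P1_in T.Src_P1 T.Trg_P1 T.P2_in T.Dom2_P2 T.Cod2_P2 T.P2_Id2 T.P2_VComp
      T.PComp_iso T.Dom2_PComp T.Cod2_PComp T.PUnit_iso T.Dom2_PUnit T.Cod2_PUnit)
qed

section \<open>Commuting squares under a pseudofunctor\<close>

context cat_pf
begin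

text \<open>Drawn with \<open>b\<close> on top, \<open>b'\<close> at the bottom, \<open>a'\<close>
  on the left and \<open>a\<close> on the right. In this picture \<open>csq_vpaste\<close> stacks
  two squares vertically and \<open>csq_hpaste\<close> puts them side by side.\<close>

definition csq where
  "csq p q r s a b b' a' \<longleftrightarrow> a \<in> C1 X \<and> b \<in> C1 X \<and> b' \<in> C1 X \<and> a' \<in> C1 X \<and>
     Src X b = p \<and> Trg X b = q \<and> Src X a = q \<and> Trg X a = s \<and>
     Src X a' = p \<and> Trg X a' = r \<and> Src X b' = r \<and> Trg X b' = s \<and> Comp1 X a b = Comp1 X b' a'"

text \<open>The exchange isomorphism \<open>F a \<circ> F b \<cong> F (a \<circ> b) = F (b' \<circ> a') \<cong> F b' \<circ> F a'\<close> of a commuting square.\<close>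

definition ex where
  "ex a b b' a' w = Comp (P0 F (Trg X a)) (inv_arr (P0 F (Trg X a)) (ph b' a' w)) (ph a b w)"

lemma csqD:
  assumes "csq p q r s a b b' a'"
  shows "a \<in> C1 X" "b \<in> C1 X" "b' \<in> C1 X" "a' \<in> C1 X"
     "Src X b = p" "Trg X b = q" "Src X a = q" "Trg X a = s" "Src X a' = p" "Trg X a' = r" "Src X b' = r" "Trg X b' = s"
     "p \<in> C0 X" "q \<in> C0 X" "r \<in> C0 X" "s \<in> C0 X"
     "Comp1 X a b = Comp1 X b' a'"
  using assms one_cells(1)[of b] one_cells(1)[of a] one_cells(2)[of a] one_cells(2)[of a'] unfolding csq_def by auto

text \<open>The last equation determines the exchange cell, because \<open>ph b' a' w\<close> is
  invertible. Later proofs use this equation instead of the inverse in the definition.\<close>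

lemma ex:
  assumes sq: "csq p q r s a b b' a'" and w: "w \<in> Obj (P0 F p)"
  shows "iso_arr (P0 F s) (ex a b b' a' w)" "ex a b b' a' w \<in> Arr (P0 F s)"
    "Dom (P0 F s) (ex a b b' a' w) = fo a (fo b w)" "Cod (P0 F s) (ex a b b' a' w) = fo b' (fo a' w)"
    "Comp (P0 F s) (ph b' a' w) (ex a b b' a' w) = ph a b w"
proof -
  note [simp] = csqD(1-16)[OF sq] w
  have e: "Comp1 X a b = Comp1 X b' a'" using csqD(17)[OF sq] .
  have i: "iso_arr (P0 F s) (ph b' a' w)" "iso_arr (P0 F s) (ph a b w)" by (rule ph; simp)+
  show 1: "iso_arr (P0 F s) (ex a b b' a' w)" unfolding ex_def
    using i by (simp add: e)
  show "ex a b b' a' w \<in> Arr (P0 F s)" using iso_arrD[OF 1] .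
  show "Dom (P0 F s) (ex a b b' a' w) = fo a (fo b w)" "Cod (P0 F s) (ex a b b' a' w) = fo b' (fo a' w)"
    unfolding ex_def using i by (simp_all add: e)
  have "Comp (P0 F s) (ph b' a' w) (ex a b b' a' w) =
      Comp (P0 F s) (Comp (P0 F s) (ph b' a' w) (inv_arr (P0 F s) (ph b' a' w))) (ph a b w)"
    unfolding ex_def using i by (simp add: e Comp_assoc' del: inv_arr_right)
  also have "\<dots> = ph a b w" using i by (simp add: e)
  finally show "Comp (P0 F s) (ph b' a' w) (ex a b b' a' w) = ph a b w" .
qed

text \<open>Hypothesis \<open>e\<close> says that the 2-cells between the two squares commute as a
  cylinder. After cancelling \<open>ph d' c' w\<close>, only naturality of the comparison cells in
  2-cells remains; \<open>ex_natural\<close> does the same for arrows.\<close>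

lemma ex_natural2:
  assumes sq: "csq p q r s a b b' a'" and sq': "csq p q r s c d d' c'" and w: "w \<in> Obj (P0 F p)"
    and c2: "\<alpha> \<in> C2 X" "\<beta> \<in> C2 X" "\<alpha>' \<in> C2 X" "\<beta>' \<in> C2 X"
    and d2: "Dom2 X \<alpha> = a" "Cod2 X \<alpha> = c" "Dom2 X \<beta> = b" "Cod2 X \<beta> = d"
      "Dom2 X \<alpha>' = a'" "Cod2 X \<alpha>' = c'" "Dom2 X \<beta>' = b'" "Cod2 X \<beta>' = d'"
    and e: "HComp X \<alpha> \<beta> = HComp X \<beta>' \<alpha>'"
  shows "Comp (P0 F s) (ex c d d' c' w) (Comp (P0 F s) (fc \<alpha> (fo d w)) (fa a (fc \<beta> w))) =
    Comp (P0 F s) (Comp (P0 F s) (fc \<beta>' (fo c' w)) (fa b' (fc \<alpha>' w))) (ex a b b' a' w)"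
proof -
  let ?C = "P0 F s"
  note [simp] = csqD(1-16)[OF sq] csqD(1-16)[OF sq'] w c2 d2 ex(1-4)[OF sq w] ex(1-4)[OF sq' w]
  have n: "fc \<alpha> (fo d w) \<in> Arr ?C" "fc \<beta> w \<in> Arr (P0 F q)" "fc \<beta>' (fo c' w) \<in> Arr ?C" "fc \<alpha>' w \<in> Arr (P0 F r)"
    "Dom ?C (fc \<alpha> (fo d w)) = fo a (fo d w)" "Cod ?C (fc \<alpha> (fo d w)) = fo c (fo d w)"
    "Dom (P0 F q) (fc \<beta> w) = fo b w" "Cod (P0 F q) (fc \<beta> w) = fo d w"
    "Dom ?C (fc \<beta>' (fo c' w)) = fo b' (fo c' w)" "Cod ?C (fc \<beta>' (fo c' w)) = fo d' (fo c' w)"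
    "Dom (P0 F r) (fc \<alpha>' w) = fo a' w" "Cod (P0 F r) (fc \<alpha>' w) = fo c' w"
    using is_ntransD(6-8)[of "P2 F \<alpha>" ?C "fo d w"] is_ntransD(6-8)[of "P2 F \<beta>" "P0 F q" w]
      is_ntransD(6-8)[of "P2 F \<alpha>'" "P0 F r" w] is_ntransD(6-8)[of "P2 F \<beta>'" ?C "fo c' w"] by simp_all
  have h: "fc (HComp X \<beta>' \<alpha>') w \<in> Arr ?C" "Dom ?C (fc (HComp X \<beta>' \<alpha>') w) = fo (Comp1 X b' a') w"
    using is_ntransD(6-8)[of "P2 F (HComp X \<beta>' \<alpha>')" ?C w] by simp_all
  note [simp] = n h
  have p: "iso_arr ?C (ph d' c' w)" by (rule ph; simp)
  show ?thesis
  proof (rule iso_mono[OF _ p])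
    let ?A = "Comp ?C (fc \<alpha> (fo d w)) (fa a (fc \<beta> w))" and ?B = "Comp ?C (fc \<beta>' (fo c' w)) (fa b' (fc \<alpha>' w))"
    have "Comp ?C (ph d' c' w) (Comp ?C (ex c d d' c' w) ?A) = Comp ?C (ph c d w) ?A"
      unfolding ex(5)[OF sq' w, symmetric] by (subst Comp_assoc') simp_all
    also have "\<dots> = Comp ?C (fc (HComp X \<alpha> \<beta>) w) (ph a b w)"
      using ph_natural2[of \<beta> \<alpha> w] by simp
    also have "\<dots> = Comp ?C (Comp ?C (fc (HComp X \<beta>' \<alpha>') w) (ph b' a' w)) (ex a b b' a' w)"
      unfolding ex(5)[OF sq w, symmetric] e by (subst Comp_assoc') simp_all
    also have "\<dots> = Comp ?C (Comp ?C (ph d' c' w) ?B) (ex a b b' a' w)"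
      using ph_natural2[of \<alpha>' \<beta>' w] by simp
    also have "\<dots> = Comp ?C (ph d' c' w) (Comp ?C ?B (ex a b b' a' w))"
      by (subst Comp_assoc') simp_all
    finally show "Comp ?C (ph d' c' w) (Comp ?C (ex c d d' c' w) ?A) = Comp ?C (ph d' c' w) (Comp ?C ?B (ex a b b' a' w))" .
  qed simp_all
qed

lemma ex_natural:
  assumes sq: "csq p q r s a b b' a'" and m: "m \<in> Arr (P0 F p)" "Dom (P0 F p) m = w" "Cod (P0 F p) m = w'"
  shows "Comp (P0 F s) (ex a b b' a' w') (fa a (fa b m)) = Comp (P0 F s) (fa b' (fa a' m)) (ex a b b' a' w)"
proof -
  let ?C = "P0 F s"
  note [simp] = csqD(1-16)[OF sq] m
  have w: "w \<in> Obj (P0 F p)" "w' \<in> Obj (P0 F p)"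
    using category.Dom_in[of "P0 F p" m] category.Cod_in[of "P0 F p" m] by simp_all
  note [simp] = w ex(1-4)[OF sq w(1)] ex(1-4)[OF sq w(2)]
  have p: "iso_arr ?C (ph b' a' w')" by (rule ph; simp)
  show ?thesis
  proof (rule iso_mono[OF _ p])
    have "Comp ?C (ph b' a' w') (Comp ?C (ex a b b' a' w') (fa a (fa b m))) = Comp ?C (ph a b w') (fa a (fa b m))"
      unfolding ex(5)[OF sq w(2), symmetric] by (subst Comp_assoc') simp_all
    also have "\<dots> = Comp ?C (fa (Comp1 X a b) m) (ph a b w)"
      using ph_natural[of b a m] by simp
    also have "\<dots> = Comp ?C (Comp ?C (fa (Comp1 X b' a') m) (ph b' a' w)) (ex a b b' a' w)"
      unfolding ex(5)[OF sq w(1), symmetric] csqD(17)[OF sq] by (subst Comp_assoc') simp_all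
    also have "\<dots> = Comp ?C (Comp ?C (ph b' a' w') (fa b' (fa a' m))) (ex a b b' a' w)"
      using ph_natural[of a' b' m] by simp
    also have "\<dots> = Comp ?C (ph b' a' w') (Comp ?C (fa b' (fa a' m)) (ex a b b' a' w))"
      by (subst Comp_assoc') simp_all
    finally show "Comp ?C (ph b' a' w') (Comp ?C (ex a b b' a' w') (fa a (fa b m))) =
      Comp ?C (ph b' a' w') (Comp ?C (fa b' (fa a' m)) (ex a b b' a' w))" .
  qed simp_all
qed

lemma csq_vpaste: "\<lbrakk>csq p q r s a b b' a'; csq r s r' s' c b' b'' c'\<rbrakk> \<Longrightarrow> csq p q r' s' (Comp1 X c a) b b'' (Comp1 X c' a')"
  unfolding csq_def by (auto simp: Comp1_assoc) (simp flip: Comp1_assoc)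

lemma csq_hpaste: "\<lbrakk>csq p q r s a b b' a'; csq p' p r' r a' d d' a''\<rbrakk> \<Longrightarrow> csq p' q r' s a (Comp1 X b d) (Comp1 X b' d') a''"
  unfolding csq_def by (auto simp: Comp1_assoc) (simp flip: Comp1_assoc, simp add: Comp1_assoc)

text \<open>Composed with the comparison cell of the path along left and bottom, each exchange is
  absorbed by its own comparison cell. What remains is three instances of associativity of the
  comparison cells.\<close>

lemma ex_vpaste:
  assumes sq: "csq p q r s a b b' a'" and sq': "csq r s r' s' c b' b'' c'" and w: "w \<in> Obj (P0 F p)"
  shows "Comp (P0 F s') (ex (Comp1 X c a) b b'' (Comp1 X c' a') w) (ph c a (fo b w)) =
    Comp (P0 F s') (fa b'' (ph c' a' w)) (Comp (P0 F s') (ex c b' b'' c' (fo a' w)) (fa c (ex a b b' a' w)))"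
proof -
  let ?C = "P0 F s'"
  have sq2: "csq p q r' s' (Comp1 X c a) b b'' (Comp1 X c' a')" using sq sq' by (rule csq_vpaste)
  note [simp] = csqD(1-16)[OF sq] csqD(1-16)[OF sq'] w
  have w': "fo a' w \<in> Obj (P0 F r)" by simp
  let ?E1 = "ex a b b' a' w" and ?E2 = "ex c b' b'' c' (fo a' w)" and ?E = "ex (Comp1 X c a) b b'' (Comp1 X c' a') w"
  note [simp] = ex(1-4)[OF sq w] ex(1-4)[OF sq' w'] ex(1-4)[OF sq2 w]
  have p: "iso_arr ?C (ph b'' (Comp1 X c' a') w)" by (rule ph; simp)
  show ?thesis
  proof (rule iso_mono[OF _ p])
    have "Comp ?C (ph b'' (Comp1 X c' a') w) (Comp ?C ?E (ph c a (fo b w))) = Comp ?C (ph (Comp1 X c a) b w) (ph c a (fo b w))"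
      unfolding ex(5)[OF sq2 w, symmetric] by (subst Comp_assoc') simp_all
    also have "\<dots> = Comp ?C (ph c (Comp1 X a b) w) (fa c (ph a b w))"
      using ph_assoc[of b a c w] by simp
    finally have 1: "Comp ?C (ph b'' (Comp1 X c' a') w) (Comp ?C ?E (ph c a (fo b w))) =
       Comp ?C (ph c (Comp1 X a b) w) (fa c (ph a b w))" .
    have "Comp ?C (ph b'' (Comp1 X c' a') w) (Comp ?C (fa b'' (ph c' a' w)) (Comp ?C ?E2 (fa c ?E1))) =
       Comp ?C (ph (Comp1 X b'' c') a' w) (Comp ?C (ph b'' c' (fo a' w)) (Comp ?C ?E2 (fa c ?E1)))"
      by (rule rew_left) (use ph_assoc[of a' c' b'' w] in simp_all)
    also have "Comp ?C (ph b'' c' (fo a' w)) (Comp ?C ?E2 (fa c ?E1)) = Comp ?C (ph c b' (fo a' w)) (fa c ?E1)"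
      unfolding ex(5)[OF sq' w', symmetric] by (subst Comp_assoc') simp_all
    also have "Comp ?C (ph (Comp1 X b'' c') a' w) (Comp ?C (ph c b' (fo a' w)) (fa c ?E1)) =
       Comp ?C (ph c (Comp1 X b' a') w) (Comp ?C (fa c (ph b' a' w)) (fa c ?E1))"
      unfolding csqD(17)[OF sq', symmetric] by (rule rew_left) (use ph_assoc[of a' b' c w] in simp_all)
    also have "Comp ?C (fa c (ph b' a' w)) (fa c ?E1) = fa c (ph a b w)"
      unfolding ex(5)[OF sq w, symmetric] by simp
    finally show "Comp ?C (ph b'' (Comp1 X c' a') w) (Comp ?C ?E (ph c a (fo b w))) =
       Comp ?C (ph b'' (Comp1 X c' a') w) (Comp ?C (fa b'' (ph c' a' w)) (Comp ?C ?E2 (fa c ?E1)))"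
      unfolding 1 csqD(17)[OF sq] by simp
  qed simp_all
qed

text \<open>As in \<open>ex_vpaste\<close>: the exchanges are absorbed and \<open>ph_assoc\<close>
  is used three times, now with composites on the horizontal sides.\<close>

lemma ex_hpaste:
  assumes sq: "csq p q r s a b b' a'" and sq': "csq p' p r' r a' d d' a''" and w: "w \<in> Obj (P0 F p')"
  shows "Comp (P0 F s) (ex a (Comp1 X b d) (Comp1 X b' d') a'' w) (fa a (ph b d w)) =
    Comp (P0 F s) (ph b' d' (fo a'' w)) (Comp (P0 F s) (fa b' (ex a' d d' a'' w)) (ex a b b' a' (fo d w)))"
proof -
  let ?C = "P0 F s"
  have sq2: "csq p' q r' s a (Comp1 X b d) (Comp1 X b' d') a''" using sq sq' by (rule csq_hpaste)
  note [simp] = csqD(1-16)[OF sq] csqD(1-16)[OF sq'] w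
  have w': "fo d w \<in> Obj (P0 F p)" by simp
  let ?E1 = "ex a b b' a' (fo d w)" and ?E2 = "ex a' d d' a'' w" and ?E = "ex a (Comp1 X b d) (Comp1 X b' d') a'' w"
  note [simp] = ex(1-4)[OF sq w'] ex(1-4)[OF sq' w] ex(1-4)[OF sq2 w]
  have p: "iso_arr ?C (ph (Comp1 X b' d') a'' w)" by (rule ph; simp)
  show ?thesis
  proof (rule iso_mono[OF _ p])
    have "Comp ?C (ph (Comp1 X b' d') a'' w) (Comp ?C ?E (fa a (ph b d w))) = Comp ?C (ph a (Comp1 X b d) w) (fa a (ph b d w))"
      unfolding ex(5)[OF sq2 w, symmetric] by (subst Comp_assoc') simp_all
    also have "\<dots> = Comp ?C (ph (Comp1 X a b) d w) (ph a b (fo d w))"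
      using ph_assoc[of d b a w] by simp
    finally have 1: "Comp ?C (ph (Comp1 X b' d') a'' w) (Comp ?C ?E (fa a (ph b d w))) =
       Comp ?C (ph (Comp1 X a b) d w) (ph a b (fo d w))" .
    have "Comp ?C (ph (Comp1 X b' d') a'' w) (Comp ?C (ph b' d' (fo a'' w)) (Comp ?C (fa b' ?E2) ?E1)) =
       Comp ?C (ph b' (Comp1 X d' a'') w) (Comp ?C (fa b' (ph d' a'' w)) (Comp ?C (fa b' ?E2) ?E1))"
      by (rule rew_left) (use ph_assoc[of a'' d' b' w] in simp_all)
    also have "Comp ?C (fa b' (ph d' a'' w)) (Comp ?C (fa b' ?E2) ?E1) = Comp ?C (fa b' (ph a' d w)) ?E1"
      unfolding ex(5)[OF sq' w, symmetric] by (simp add: Comp_assoc')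
    also have "Comp ?C (ph b' (Comp1 X d' a'') w) (Comp ?C (fa b' (ph a' d w)) ?E1) =
       Comp ?C (ph (Comp1 X b' a') d w) (Comp ?C (ph b' a' (fo d w)) ?E1)"
      unfolding csqD(17)[OF sq', symmetric] by (rule rew_left) (use ph_assoc[of d a' b' w] in simp_all)
    also have "Comp ?C (ph b' a' (fo d w)) ?E1 = ph a b (fo d w)"
      by (rule ex(5)[OF sq w'])
    finally show "Comp ?C (ph (Comp1 X b' d') a'' w) (Comp ?C ?E (fa a (ph b d w))) =
       Comp ?C (ph (Comp1 X b' d') a'' w) (Comp ?C (ph b' d' (fo a'' w)) (Comp ?C (fa b' ?E2) ?E1))"
      unfolding 1 csqD(17)[OF sq] by simp
  qed simp_all
qed

lemma csq_id1: "\<lbrakk>b \<in> C1 X; Src X b = p; Trg X b = q\<rbrakk> \<Longrightarrow> csq p q p q (Id1 X q) b b (Id1 X p)"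
  unfolding csq_def by auto

lemma csq_id2: "\<lbrakk>a \<in> C1 X; Src X a = p; Trg X a = q\<rbrakk> \<Longrightarrow> csq p p q q a (Id1 X p) (Id1 X q) a"
  unfolding csq_def by auto

text \<open>After composition with \<open>ph b (Id1 X p) w\<close> both sides are identities, one by
  the left and one by the right unit law.\<close>

lemma ex_unit1:
  assumes b: "b \<in> C1 X" "Src X b = p" "Trg X b = q" and w: "w \<in> Obj (P0 F p)"
  shows "Comp (P0 F q) (ex (Id1 X q) b b (Id1 X p) w) (un q (fo b w)) = fa b (un p w)"
proof -
  let ?C = "P0 F q"
  have sq: "csq p q p q (Id1 X q) b b (Id1 X p)" using b by (rule csq_id1)
  note [simp] = csqD(1-16)[OF sq] w ex(1-4)[OF sq w]
  have p: "iso_arr ?C (ph b (Id1 X p) w)" by (rule ph; simp)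
  show ?thesis
  proof (rule iso_mono[OF _ p])
    have "Comp ?C (ph b (Id1 X p) w) (Comp ?C (ex (Id1 X q) b b (Id1 X p) w) (un q (fo b w))) =
       Comp ?C (ph (Id1 X q) b w) (un q (fo b w))"
      unfolding ex(5)[OF sq w, symmetric] by (subst Comp_assoc') simp_all
    also have "\<dots> = Comp ?C (ph b (Id1 X p) w) (fa b (un p w))"
      using ph_unit_left[of b q w] ph_unit_right[of b p w] by simp
    finally show "Comp ?C (ph b (Id1 X p) w) (Comp ?C (ex (Id1 X q) b b (Id1 X p) w) (un q (fo b w))) =
       Comp ?C (ph b (Id1 X p) w) (fa b (un p w))" .
  qed simp_all
qed

lemma ex_unit2:
  assumes a: "a \<in> C1 X" "Src X a = p" "Trg X a = q" and w: "w \<in> Obj (P0 F p)"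
  shows "Comp (P0 F q) (ex a (Id1 X p) (Id1 X q) a w) (fa a (un p w)) = un q (fo a w)"
proof -
  let ?C = "P0 F q"
  have sq: "csq p p q q a (Id1 X p) (Id1 X q) a" using a by (rule csq_id2)
  note [simp] = csqD(1-16)[OF sq] w ex(1-4)[OF sq w]
  have p: "iso_arr ?C (ph (Id1 X q) a w)" by (rule ph; simp)
  show ?thesis
  proof (rule iso_mono[OF _ p])
    have "Comp ?C (ph (Id1 X q) a w) (Comp ?C (ex a (Id1 X p) (Id1 X q) a w) (fa a (un p w))) =
       Comp ?C (ph a (Id1 X p) w) (fa a (un p w))"
      unfolding ex(5)[OF sq w, symmetric] by (subst Comp_assoc') simp_all
    also have "\<dots> = Comp ?C (ph (Id1 X q) a w) (un q (fo a w))"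
      using ph_unit_left[of a q w] ph_unit_right[of a p w] by simp
    finally show "Comp ?C (ph (Id1 X q) a w) (Comp ?C (ex a (Id1 X p) (Id1 X q) a w) (fa a (un p w))) =
       Comp ?C (ph (Id1 X q) a w) (un q (fo a w))" .
  qed simp_all
qed

end

section \<open>The partial pseudoend as a pseudofunctor\<close>

text \<open>The maps \<open>k0\<close>, \<open>k1\<close>, \<open>k2\<close> form a strict 2-functor \<open>X \<times> Y \<rightarrow> Z\<close>. Keeping \<open>Z\<close> apart
  from \<open>X \<times> Y\<close> covers both orders of the two variables at once.\<close>

locale curry = X: two_category X + G: strict_pf Y G + R: cat_pf Z R
  for X :: "('x0, 'x1, 'x2) two_cat" and Y :: "('y0, 'y1, 'y2) two_cat" and Z :: "('z0, 'z1, 'z2) two_cat"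
    and G :: "('y0, 'y1, 'y2, 'og, 'mg) cat_pfunc" and R :: "('z0, 'z1, 'z2, 'o, 'm) cat_pfunc" +
  fixes k0 :: "'x0 \<Rightarrow> 'y0 \<Rightarrow> 'z0" and k1 :: "'x1 \<Rightarrow> 'y1 \<Rightarrow> 'z1" and k2 :: "'x2 \<Rightarrow> 'y2 \<Rightarrow> 'z2"
  assumes k0_in [simp]: "\<lbrakk>x \<in> C0 X; y \<in> C0 Y\<rbrakk> \<Longrightarrow> k0 x y \<in> C0 Z"
    and k1_in [simp]: "\<lbrakk>f \<in> C1 X; g \<in> C1 Y\<rbrakk> \<Longrightarrow> k1 f g \<in> C1 Z"
    and k2_in [simp]: "\<lbrakk>\<alpha> \<in> C2 X; \<beta> \<in> C2 Y\<rbrakk> \<Longrightarrow> k2 \<alpha> \<beta> \<in> C2 Z"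
    and Src_k1 [simp]: "\<lbrakk>f \<in> C1 X; g \<in> C1 Y\<rbrakk> \<Longrightarrow> Src Z (k1 f g) = k0 (Src X f) (Src Y g)"
    and Trg_k1 [simp]: "\<lbrakk>f \<in> C1 X; g \<in> C1 Y\<rbrakk> \<Longrightarrow> Trg Z (k1 f g) = k0 (Trg X f) (Trg Y g)"
    and Dom2_k2 [simp]: "\<lbrakk>\<alpha> \<in> C2 X; \<beta> \<in> C2 Y\<rbrakk> \<Longrightarrow> Dom2 Z (k2 \<alpha> \<beta>) = k1 (Dom2 X \<alpha>) (Dom2 Y \<beta>)"
    and Cod2_k2 [simp]: "\<lbrakk>\<alpha> \<in> C2 X; \<beta> \<in> C2 Y\<rbrakk> \<Longrightarrow> Cod2 Z (k2 \<alpha> \<beta>) = k1 (Cod2 X \<alpha>) (Cod2 Y \<beta>)"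
    and k1_Id1 [simp]: "\<lbrakk>x \<in> C0 X; y \<in> C0 Y\<rbrakk> \<Longrightarrow> k1 (Id1 X x) (Id1 Y y) = Id1 Z (k0 x y)"
    and k2_Id2 [simp]: "\<lbrakk>f \<in> C1 X; g \<in> C1 Y\<rbrakk> \<Longrightarrow> k2 (Id2 X f) (Id2 Y g) = Id2 Z (k1 f g)"
    and Comp1_k1 [simp]: "\<lbrakk>f \<in> C1 X; g \<in> C1 Y; f' \<in> C1 X; g' \<in> C1 Y; Trg X f = Src X f'; Trg Y g = Src Y g'\<rbrakk>
      \<Longrightarrow> Comp1 Z (k1 f' g') (k1 f g) = k1 (Comp1 X f' f) (Comp1 Y g' g)"
    and VComp_k2 [simp]: "\<lbrakk>\<alpha> \<in> C2 X; \<beta> \<in> C2 Y; \<alpha>' \<in> C2 X; \<beta>' \<in> C2 Y; Cod2 X \<alpha> = Dom2 X \<alpha>'; Cod2 Y \<beta> = Dom2 Y \<beta>'\<rbrakk>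
      \<Longrightarrow> VComp Z (k2 \<alpha>' \<beta>') (k2 \<alpha> \<beta>) = k2 (VComp X \<alpha>' \<alpha>) (VComp Y \<beta>' \<beta>)"
    and HComp_k2 [simp]: "\<lbrakk>\<alpha> \<in> C2 X; \<beta> \<in> C2 Y; \<alpha>' \<in> C2 X; \<beta>' \<in> C2 Y;
        Trg X (Dom2 X \<alpha>) = Src X (Dom2 X \<alpha>'); Trg Y (Dom2 Y \<beta>) = Src Y (Dom2 Y \<beta>')\<rbrakk>
      \<Longrightarrow> HComp Z (k2 \<alpha>' \<beta>') (k2 \<alpha> \<beta>) = k2 (HComp X \<alpha>' \<alpha>) (HComp Y \<beta>' \<beta>)"
begin

text \<open>In the application this is literally \<open>fix_A\<close> or \<open>fix_B\<close>, which
  turns the required description of the partial pseudoends into an identity.\<close>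

definition slice where
  "slice x = reindex (k0 x) (k1 (Id1 X x)) (k2 (Id2 X (Id1 X x))) R"

lemma slice_simps:
  "P0 (slice x) y = P0 R (k0 x y)" "P1 (slice x) g = P1 R (k1 (Id1 X x) g)"
  "P2 (slice x) \<beta> = P2 R (k2 (Id2 X (Id1 X x)) \<beta>)"
  "PComp (slice x) g' g = PComp R (k1 (Id1 X x) g') (k1 (Id1 X x) g)" "PUnit (slice x) y = PUnit R (k0 x y)"
  by (simp_all add: slice_def)

lemma ps_slice:
  assumes "x \<in> C0 X"
  shows "ps Y G (slice x)"
proof -
  have "pseudofunctor Y CAT (slice x)"
    unfolding slice_def
    by (rule pseudofunctor_reindex[OF G.two_category_axioms R.pf.pseudofunctor_axioms]) (use assms in simp_all)
  then show ?thesis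
    by (intro ps.intro cat_pf.intro G.strict_pf_axioms G.two_category_axioms)
qed

text \<open>Facts about transformations into a slice, restated in terms of \<open>R\<close>, so that
  all computations take place in the categories \<open>P0 R (k0 x y)\<close>.\<close>

lemmas sl_simps [simp] = ps.o_simps[OF ps_slice, unfolded slice_simps]
  and sl_md [simp] = ps.md_simps[OF ps_slice, unfolded slice_simps]
  and sl_mod [simp] = ps.modification_MDom[OF ps_slice] ps.modification_MCod[OF ps_slice]
    ps.category_PS_hom[OF ps_slice] ps.modification_Comp[OF ps_slice] ps.modification_Idn[OF ps_slice]
  and sl_natural = ps.o2_natural[OF ps_slice, unfolded slice_simps]
  and sl_natural2 = ps.o2_natural2[OF ps_slice, unfolded slice_simps]
  and sl_Comp1 = ps.o2_Comp1[OF ps_slice, unfolded slice_simps]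
  and sl_Id1 = ps.o2_Id1[OF ps_slice, unfolded slice_simps]
  and sl_md_natural = ps.md_natural[OF ps_slice, unfolded slice_simps]
  and sl_md_modif = ps.md_modif[OF ps_slice, unfolded slice_simps]
  and sl_md_Comp [simp] = ps.md_Comp[OF ps_slice, unfolded slice_simps]
  and sl_md_Idn [simp] = ps.md_Idn[OF ps_slice, unfolded slice_simps]

section \<open>Exchanging a 1-cell of \<open>X\<close> with a 1-cell of \<open>Y\<close>\<close>

abbreviation "L f y \<equiv> k1 f (Id1 Y y)"
abbreviation "V x g \<equiv> k1 (Id1 X x) g"

lemma csq_LV:
  assumes "f \<in> C1 X" "g \<in> C1 Y" "Src X f = x" "Trg X f = x'" "Src Y g = y" "Trg Y g = y'"
  shows "R.csq (k0 x y) (k0 x' y) (k0 x y') (k0 x' y') (V x' g) (L f y) (L f y') (V x g)"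
  using assms unfolding R.csq_def by auto

text \<open>The direction is dictated by \<open>post\<close>: its component at \<open>g\<close>
  starts at \<open>V x' g\<close> applied to the image under \<open>L f y\<close>, and \<sigma> can
  act only once \<open>L f\<close> has been moved to the outside.\<close>

definition chi where
  "chi f g = R.ex (V (Trg X f) g) (L f (Src Y g)) (L f (Trg Y g)) (V (Src X f) g)"

lemma chi [simp]:
  assumes fg: "f \<in> C1 X" "g \<in> C1 Y" and w: "w \<in> Obj (P0 R (k0 (Src X f) (Src Y g)))"
    and xy: "Trg X f = x'" "Trg Y g = y'"
  shows "iso_arr (P0 R (k0 x' y')) (chi f g w)" "chi f g w \<in> Arr (P0 R (k0 x' y'))"
    "Dom (P0 R (k0 x' y')) (chi f g w) = R.fo (V x' g) (R.fo (L f (Src Y g)) w)"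
    "Cod (P0 R (k0 x' y')) (chi f g w) = R.fo (L f y') (R.fo (V (Src X f) g) w)"
  using R.ex(1-4)[OF csq_LV[OF fg refl refl refl refl] w] unfolding chi_def xy by simp_all

lemma ph_chi:
  assumes "f \<in> C1 X" "g \<in> C1 Y" "Src X f = x" "Trg X f = x'" "Src Y g = y" "Trg Y g = y'"
    "w \<in> Obj (P0 R (k0 x y))"
  shows "Comp (P0 R (k0 x' y')) (R.ph (L f y') (V x g) w) (chi f g w) = R.ph (V x' g) (L f y) w"
  using R.ex(5)[OF csq_LV[OF assms(1-6)] assms(7)] unfolding chi_def assms(3-6) .

lemma chi_natural:
  assumes fg: "f \<in> C1 X" "g \<in> C1 Y" and xy: "Src X f = x" "Trg X f = x'" "Src Y g = y" "Trg Y g = y'"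
    and m: "m \<in> Arr (P0 R (k0 x y))" "Dom (P0 R (k0 x y)) m = w" "Cod (P0 R (k0 x y)) m = w'"
  shows "Comp (P0 R (k0 x' y')) (chi f g w') (R.fa (V x' g) (R.fa (L f y) m)) =
    Comp (P0 R (k0 x' y')) (R.fa (L f y') (R.fa (V x g) m)) (chi f g w)"
  using R.ex_natural[OF csq_LV[OF fg xy] m] unfolding chi_def xy .

text \<open>The two whiskerings agree, which is the cylinder condition that
  \<open>ex_natural2\<close> asks for.\<close>

lemma whisker_k2:
  assumes "f \<in> C1 X" "\<beta> \<in> C2 Y" "Src Y (Dom2 Y \<beta>) = y" "Trg Y (Dom2 Y \<beta>) = y'" "Src X f = x" "Trg X f = x'"
  shows "HComp Z (k2 (Id2 X (Id1 X x')) \<beta>) (Id2 Z (L f y)) = k2 (Id2 X f) \<beta>"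
    "HComp Z (Id2 Z (L f y')) (k2 (Id2 X (Id1 X x)) \<beta>) = k2 (Id2 X f) \<beta>"
proof -
  have v: "x \<in> C0 X" "x' \<in> C0 X" "y \<in> C0 Y" "y' \<in> C0 Y" using assms by auto
  show "HComp Z (k2 (Id2 X (Id1 X x')) \<beta>) (Id2 Z (L f y)) = k2 (Id2 X f) \<beta>"
    \<comment> \<open>The simplifier turns \<open>k2\<close> of two identities into
      \<open>Id2 Z\<close>, where \<open>HComp_k2\<close> no longer matches, so its instance is
      supplied by hand.\<close>
    using HComp_k2[of "Id2 X f" "Id2 Y (Id1 Y y)" "Id2 X (Id1 X x')" \<beta>] assms v by (simp del: HComp_k2)
  show "HComp Z (Id2 Z (L f y')) (k2 (Id2 X (Id1 X x)) \<beta>) = k2 (Id2 X f) \<beta>"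
    using HComp_k2[of "Id2 X (Id1 X x)" \<beta> "Id2 X f" "Id2 Y (Id1 Y y')"] assms v by (simp del: HComp_k2)
qed

lemma whisker_k2':
  assumes "g \<in> C1 Y" "\<alpha> \<in> C2 X" "Src X (Dom2 X \<alpha>) = x" "Trg X (Dom2 X \<alpha>) = x'" "Src Y g = y" "Trg Y g = y'"
  shows "HComp Z (k2 \<alpha> (Id2 Y (Id1 Y y'))) (Id2 Z (V x g)) = k2 \<alpha> (Id2 Y g)"
    "HComp Z (Id2 Z (V x' g)) (k2 \<alpha> (Id2 Y (Id1 Y y))) = k2 \<alpha> (Id2 Y g)"
proof -
  have v: "x \<in> C0 X" "x' \<in> C0 X" "y \<in> C0 Y" "y' \<in> C0 Y" using assms by auto
  show "HComp Z (k2 \<alpha> (Id2 Y (Id1 Y y'))) (Id2 Z (V x g)) = k2 \<alpha> (Id2 Y g)"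
    using HComp_k2[of "Id2 X (Id1 X x)" "Id2 Y g" \<alpha> "Id2 Y (Id1 Y y')"] assms v by (simp del: HComp_k2)
  show "HComp Z (Id2 Z (V x' g)) (k2 \<alpha> (Id2 Y (Id1 Y y))) = k2 \<alpha> (Id2 Y g)"
    using HComp_k2[of \<alpha> "Id2 Y (Id1 Y y)" "Id2 X (Id1 X x')" "Id2 Y g"] assms v by (simp del: HComp_k2)
qed

lemma chi_natural2:
  assumes f: "f \<in> C1 X" and \<beta>: "\<beta> \<in> C2 Y" and xy: "Src X f = x" "Trg X f = x'"
      "Src Y (Dom2 Y \<beta>) = y" "Trg Y (Dom2 Y \<beta>) = y'"
    and w: "w \<in> Obj (P0 R (k0 x y))"
  shows "Comp (P0 R (k0 x' y')) (chi f (Cod2 Y \<beta>) w) (R.fc (k2 (Id2 X (Id1 X x')) \<beta>) (R.fo (L f y) w)) =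
    Comp (P0 R (k0 x' y')) (R.fa (L f y') (R.fc (k2 (Id2 X (Id1 X x)) \<beta>) w)) (chi f (Dom2 Y \<beta>) w)"
proof -
  have s: "Src Y (Cod2 Y \<beta>) = y" "Trg Y (Cod2 Y \<beta>) = y'" using \<beta> xy by simp_all
  have v: "x \<in> C0 X" "x' \<in> C0 X" "y \<in> C0 Y" "y' \<in> C0 Y"
    using f \<beta> xy by auto
  show ?thesis
    using R.ex_natural2[OF csq_LV[OF f _ xy] csq_LV[OF f _ xy(1,2) s] w, of "k2 (Id2 X (Id1 X x')) \<beta>" "Id2 Z (L f y)"
      "k2 (Id2 X (Id1 X x)) \<beta>" "Id2 Z (L f y')"] f \<beta> w v xy(3,4) s xy(1,2)
    by (simp add: chi_def whisker_k2)
qed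

lemma chi_natural2':
  assumes g: "g \<in> C1 Y" and \<alpha>: "\<alpha> \<in> C2 X" and xy: "Src X (Dom2 X \<alpha>) = x" "Trg X (Dom2 X \<alpha>) = x'"
      "Src Y g = y" "Trg Y g = y'"
    and w: "w \<in> Obj (P0 R (k0 x y))"
  shows "Comp (P0 R (k0 x' y')) (chi (Cod2 X \<alpha>) g w) (R.fa (V x' g) (R.fc (k2 \<alpha> (Id2 Y (Id1 Y y))) w)) =
    Comp (P0 R (k0 x' y')) (R.fc (k2 \<alpha> (Id2 Y (Id1 Y y'))) (R.fo (V x g) w)) (chi (Dom2 X \<alpha>) g w)"
proof -
  have s: "Src X (Cod2 X \<alpha>) = x" "Trg X (Cod2 X \<alpha>) = x'" using \<alpha> xy by simp_all
  have v: "x \<in> C0 X" "x' \<in> C0 X" "y \<in> C0 Y" "y' \<in> C0 Y"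
    using g \<alpha> xy by auto
  show ?thesis
    using R.ex_natural2[OF csq_LV[OF _ g xy] csq_LV[OF _ g s xy(3,4)] w, of "Id2 Z (V x' g)" "k2 \<alpha> (Id2 Y (Id1 Y y))"
      "Id2 Z (V x g)" "k2 \<alpha> (Id2 Y (Id1 Y y'))"] g \<alpha> w v xy(3,4) s xy(1,2)
    by (simp add: chi_def whisker_k2')
qed

text \<open>The laws of \<open>chi\<close> split by direction. Pasting and unit in \<open>Y\<close>
  (\<open>chi_vpaste\<close>, \<open>chi_unit1\<close>) make \<open>post f \<sigma>\<close> a
  transformation; pasting and unit in \<open>X\<close> (\<open>chi_hpaste\<close>,
  \<open>chi_unit2\<close>) make the comparison cells of \<open>TB\<close> modifications.\<close>

lemma chi_vpaste:
  assumes f: "f \<in> C1 X" "Src X f = x" "Trg X f = x'" and g: "g \<in> C1 Y" "Src Y g = y" "Trg Y g = y'"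
    and g': "g' \<in> C1 Y" "Src Y g' = y'" "Trg Y g' = y''" and w: "w \<in> Obj (P0 R (k0 x y))"
  shows "Comp (P0 R (k0 x' y'')) (chi f (Comp1 Y g' g) w) (R.ph (V x' g') (V x' g) (R.fo (L f y) w)) =
    Comp (P0 R (k0 x' y'')) (R.fa (L f y'') (R.ph (V x g') (V x g) w))
      (Comp (P0 R (k0 x' y'')) (chi f g' (R.fo (V x g) w)) (R.fa (V x' g') (chi f g w)))"
proof -
  have v: "x \<in> C0 X" "x' \<in> C0 X" using f by auto
  show ?thesis
    using R.ex_vpaste[OF csq_LV[OF f(1) g(1) f(2,3) g(2,3)] csq_LV[OF f(1) g'(1) f(2,3) g'(2,3)] w] f g g' v
    by (simp add: chi_def)
qed

lemma chi_hpaste: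
  assumes f: "f \<in> C1 X" "Src X f = x" "Trg X f = x'" and f': "f' \<in> C1 X" "Src X f' = x'" "Trg X f' = x''"
    and g: "g \<in> C1 Y" "Src Y g = y" "Trg Y g = y'" and w: "w \<in> Obj (P0 R (k0 x y))"
  shows "Comp (P0 R (k0 x'' y')) (chi (Comp1 X f' f) g w) (R.fa (V x'' g) (R.ph (L f' y) (L f y) w)) =
    Comp (P0 R (k0 x'' y')) (R.ph (L f' y') (L f y') (R.fo (V x g) w))
      (Comp (P0 R (k0 x'' y')) (R.fa (L f' y') (chi f g w)) (chi f' g (R.fo (L f y) w)))"
proof -
  have v: "y \<in> C0 Y" "y' \<in> C0 Y" using g by auto
  show ?thesis
    using R.ex_hpaste[OF csq_LV[OF f'(1) g(1) f'(2,3) g(2,3)] csq_LV[OF f(1) g(1) f(2,3) g(2,3)] w] f g f' v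
    by (simp add: chi_def)
qed

lemma chi_unit1:
  assumes f: "f \<in> C1 X" "Src X f = x" "Trg X f = x'" and y: "y \<in> C0 Y" and w: "w \<in> Obj (P0 R (k0 x y))"
  shows "Comp (P0 R (k0 x' y)) (chi f (Id1 Y y) w) (R.un (k0 x' y) (R.fo (L f y) w)) = R.fa (L f y) (R.un (k0 x y) w)"
proof -
  have v: "x \<in> C0 X" "x' \<in> C0 X" using f by auto
  show ?thesis
    using R.ex_unit1[OF _ _ _ w, of "L f y" "k0 x' y"] f y v by (simp add: chi_def)
qed

lemma chi_unit2:
  assumes g: "g \<in> C1 Y" "Src Y g = y" "Trg Y g = y'" and x: "x \<in> C0 X" and w: "w \<in> Obj (P0 R (k0 x y))"
  shows "Comp (P0 R (k0 x y')) (chi (Id1 X x) g w) (R.fa (V x g) (R.un (k0 x y) w)) = R.un (k0 x y') (R.fo (V x g) w)"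
proof -
  have v: "y \<in> C0 Y" "y' \<in> C0 Y" using g by auto
  show ?thesis
    using R.ex_unit2[OF _ _ _ w, of "V x g" "k0 x y'"] g x v by (simp add: chi_def)
qed

section \<open>Postcomposition with cells of \<open>X\<close>\<close>

definition post where
  "post f \<sigma> = mkpt Y G (slice (Trg X f)) (\<lambda>y v. R.fo (L f y) (o0 \<sigma> y v)) (\<lambda>y n. R.fa (L f y) (o1 \<sigma> y n))
     (\<lambda>g v. Comp (P0 R (k0 (Trg X f) (Trg Y g))) (R.fa (L f (Trg Y g)) (o2 \<sigma> g v)) (chi f g (o0 \<sigma> (Src Y g) v)))"

lemma post_simps [simp]:
  "\<lbrakk>y \<in> C0 Y; v \<in> Obj (P0 G y)\<rbrakk> \<Longrightarrow> o0 (post f \<sigma>) y v = R.fo (L f y) (o0 \<sigma> y v)"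
  "\<lbrakk>y \<in> C0 Y; n \<in> Arr (P0 G y)\<rbrakk> \<Longrightarrow> o1 (post f \<sigma>) y n = R.fa (L f y) (o1 \<sigma> y n)"
  "\<lbrakk>g \<in> C1 Y; v \<in> Obj (P0 G (Src Y g))\<rbrakk> \<Longrightarrow> o2 (post f \<sigma>) g v =
     Comp (P0 R (k0 (Trg X f) (Trg Y g))) (R.fa (L f (Trg Y g)) (o2 \<sigma> g v)) (chi f g (o0 \<sigma> (Src Y g) v))"
  by (simp_all add: post_def)

text \<open>Each axiom is the image of the axiom of \<sigma> under a functor
  \<open>P1 R (L f y)\<close>, pasted with the matching law of \<open>chi\<close>.\<close>

lemma pseudonatural_post [simp]:
  assumes f: "f \<in> C1 X" "Trg X f = x'" and \<sigma>: "pseudonatural Y G (slice (Src X f)) \<sigma>"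
  shows "pseudonatural Y G (slice x') (post f \<sigma>)"
  unfolding post_def f(2)
proof (rule ps.pseudonatural_mkpt[OF ps_slice], goal_cases)
  case 1 show ?case using f by auto
next
  case 2
  have v: "x' \<in> C0 X" using f by auto
  have FArr_iso: "iso_arr (P0 R (k0 x' y)) (R.fa (L f y) m)" if "y \<in> C0 Y" "iso_arr (P0 R (k0 (Src X f) y)) m" for y m
    using iso_FArr[of "P1 R (L f y)" m] that f v by simp
  note [simp] = f \<sigma> v FArr_iso sl_simps[OF X.one_cells(1)[OF f(1)] \<sigma>]
  show ?case unfolding slice_simps
  proof (rule psdataI, unfold slice_simps, goal_cases)
    case (10 g n)
    show ?case
      by (rule paste_squares[where ?f2.0 = "R.fa (L f (Trg Y g)) (R.fa (V (Src X f) g) (o1 \<sigma> (Src Y g) n))"])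
       (use 10 chi_natural[OF f(1) 10(1) refl f(2) refl refl _ refl refl, of "o1 \<sigma> (Src Y g) n"]
         arg_cong[OF sl_natural[OF _ \<sigma> 10], of "R.fa (L f (Trg Y g))"] in simp_all)
  next
    case (11 \<beta> v)
    let ?g = "Dom2 Y \<beta>" and ?g' = "Cod2 Y \<beta>"
    let ?o = "o0 \<sigma> (Src Y ?g) v"
    have "Comp (P0 R (k0 x' (Trg Y ?g))) (Comp (P0 R (k0 x' (Trg Y ?g))) (R.fa (L f (Trg Y ?g)) (o2 \<sigma> ?g' v)) (chi f ?g' ?o))
          (R.fc (k2 (Id2 X (Id1 X x')) \<beta>) (R.fo (L f (Src Y ?g)) ?o)) =
       Comp (P0 R (k0 x' (Trg Y ?g))) (R.fa (L f (Trg Y ?g)) (o1 \<sigma> (Trg Y ?g) (NMap (P2 G \<beta>) v)))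
         (Comp (P0 R (k0 x' (Trg Y ?g))) (R.fa (L f (Trg Y ?g)) (o2 \<sigma> ?g v)) (chi f ?g ?o))"
      by (rule paste_squares[where ?f2.0 = "R.fa (L f (Trg Y ?g)) (R.fc (k2 (Id2 X (Id1 X (Src X f))) \<beta>) ?o)"])
       (use 11 chi_natural2[OF f(1) 11(1) refl f(2) refl refl, of ?o]
         arg_cong[OF sl_natural2[OF _ \<sigma> 11], of "R.fa (L f (Trg Y ?g))"] in simp_all)
    then show ?case using 11 by simp
  next
    case (12 g g' v)
    let ?C = "P0 R (k0 x' (Trg Y g'))" and ?o = "o0 \<sigma> (Src Y g) v" and ?v = "FObj (P1 G g) v" and ?x = "Src X f"
    let ?L = "L f (Trg Y g')"
    have "Comp ?C (Comp ?C (R.fa ?L (o2 \<sigma> (Comp1 Y g' g) v)) (chi f (Comp1 Y g' g) ?o))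
          (R.ph (V x' g') (V x' g) (R.fo (L f (Src Y g)) ?o)) =
        Comp ?C (R.fa ?L (o2 \<sigma> (Comp1 Y g' g) v)) (Comp ?C (R.fa ?L (R.ph (V ?x g') (V ?x g) ?o))
          (Comp ?C (chi f g' (R.fo (V ?x g) ?o)) (R.fa (V x' g') (chi f g ?o))))"
      using 12 chi_vpaste[OF f(1) refl f(2) 12(1) refl refl 12(2) _ refl, of ?o] by (simp add: Comp_assoc')
    also have "\<dots> = Comp ?C (R.fa ?L (o2 \<sigma> g' ?v)) (Comp ?C (R.fa ?L (R.fa (V ?x g') (o2 \<sigma> g v)))
        (Comp ?C (chi f g' (R.fo (V ?x g) ?o)) (R.fa (V x' g') (chi f g ?o))))"
      by (rule rew_left) (use 12 arg_cong[OF sl_Comp1[OF _ \<sigma> 12], of "R.fa ?L"] in simp_all)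
    \<comment> \<open>Naturality of \<open>chi f g'\<close> at the arrow
      \<open>o2 \<sigma> g v\<close> moves the exchange to the left, so that the components of
      \<open>post f \<sigma>\<close> at \<open>g'\<close> and at \<open>g\<close> become
      visible.\<close>
    also have "Comp ?C (R.fa ?L (R.fa (V ?x g') (o2 \<sigma> g v))) (Comp ?C (chi f g' (R.fo (V ?x g) ?o)) (R.fa (V x' g') (chi f g ?o)))
       = Comp ?C (chi f g' (o0 \<sigma> (Trg Y g) ?v)) (Comp ?C (R.fa (V x' g') (R.fa (L f (Trg Y g)) (o2 \<sigma> g v))) (R.fa (V x' g') (chi f g ?o)))"
      by (rule rew_left[OF chi_natural[OF f(1) 12(2) refl f(2) _ refl, symmetric]]) (use 12 in simp_all)
    finally show ?case using 12 by (simp add: Comp_assoc')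
  next
    case (13 y v)
    have "Comp (P0 R (k0 x' y)) (Comp (P0 R (k0 x' y)) (R.fa (L f y) (o2 \<sigma> (Id1 Y y) v)) (chi f (Id1 Y y) (o0 \<sigma> y v)))
         (R.un (k0 x' y) (R.fo (L f y) (o0 \<sigma> y v))) =
      Comp (P0 R (k0 x' y)) (R.fa (L f y) (o2 \<sigma> (Id1 Y y) v)) (R.fa (L f y) (R.un (k0 (Src X f) y) (o0 \<sigma> y v)))"
      using 13 chi_unit1[OF f(1) refl f(2) 13(1), of "o0 \<sigma> y v"] by (simp add: Comp_assoc')
    also have "\<dots> = R.fa (L f y) (Idn (P0 R (k0 (Src X f) y)) (o0 \<sigma> y v))"
      using 13 arg_cong[OF sl_Id1[OF _ \<sigma> 13], of "R.fa (L f y)"] by simp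
    finally show ?case using 13 by simp
  qed (simp_all, auto)
qed

text \<open>This and the next three modifications become the values of \<open>TB\<close> on arrows
  and 2-cells and its composition and unit cells.\<close>

definition postm where
  "postm f \<Gamma> = mkmd Y G (post f (MDom \<Gamma>)) (post f (MCod \<Gamma>)) (\<lambda>y v. R.fa (L f y) (md \<Gamma> y v))"

definition post2 where
  "post2 \<alpha> \<sigma> = mkmd Y G (post (Dom2 X \<alpha>) \<sigma>) (post (Cod2 X \<alpha>) \<sigma>) (\<lambda>y v. R.fc (k2 \<alpha> (Id2 Y (Id1 Y y))) (o0 \<sigma> y v))"

definition post_comp where
  "post_comp f' f \<sigma> = mkmd Y G (post f' (post f \<sigma>)) (post (Comp1 X f' f) \<sigma>) (\<lambda>y v. R.ph (L f' y) (L f y) (o0 \<sigma> y v))"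

definition post_unit where
  "post_unit x \<sigma> = mkmd Y G \<sigma> (post (Id1 X x) \<sigma>) (\<lambda>y v. R.un (k0 x y) (o0 \<sigma> y v))"

lemma post_md_simps [simp]:
  "MDom (postm f \<Gamma>) = post f (MDom \<Gamma>)" "MCod (postm f \<Gamma>) = post f (MCod \<Gamma>)"
  "MDom (post2 \<alpha> \<sigma>) = post (Dom2 X \<alpha>) \<sigma>" "MCod (post2 \<alpha> \<sigma>) = post (Cod2 X \<alpha>) \<sigma>"
  "MDom (post_comp f' f \<sigma>) = post f' (post f \<sigma>)" "MCod (post_comp f' f \<sigma>) = post (Comp1 X f' f) \<sigma>"
  "MDom (post_unit x \<sigma>) = \<sigma>" "MCod (post_unit x \<sigma>) = post (Id1 X x) \<sigma>"
  "\<lbrakk>y \<in> C0 Y; v \<in> Obj (P0 G y)\<rbrakk> \<Longrightarrow> md (postm f \<Gamma>) y v = R.fa (L f y) (md \<Gamma> y v)"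
  "\<lbrakk>y \<in> C0 Y; v \<in> Obj (P0 G y)\<rbrakk> \<Longrightarrow> md (post2 \<alpha> \<sigma>) y v = R.fc (k2 \<alpha> (Id2 Y (Id1 Y y))) (o0 \<sigma> y v)"
  "\<lbrakk>y \<in> C0 Y; v \<in> Obj (P0 G y)\<rbrakk> \<Longrightarrow> md (post_comp f' f \<sigma>) y v = R.ph (L f' y) (L f y) (o0 \<sigma> y v)"
  "\<lbrakk>y \<in> C0 Y; v \<in> Obj (P0 G y)\<rbrakk> \<Longrightarrow> md (post_unit x \<sigma>) y v = R.un (k0 x y) (o0 \<sigma> y v)"
  by (simp_all add: postm_def post2_def post_comp_def post_unit_def)

lemma modification_postm [simp]:
  assumes f: "f \<in> C1 X" "Trg X f = x'" and \<Gamma>: "modification Y G (slice (Src X f)) \<Gamma>"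
  shows "modification Y G (slice x') (postm f \<Gamma>)"
proof -
  have v: "x' \<in> C0 X" "Src X f \<in> C0 X" using f by auto
  note \<sigma> = sl_mod(1,2)[OF v(2) \<Gamma>]
  note [simp] = f v \<Gamma> \<sigma> sl_simps[OF v(2) \<sigma>(1)] sl_simps[OF v(2) \<sigma>(2)] sl_md[OF v(2) \<Gamma>]
  show ?thesis unfolding postm_def
  proof (rule ps.modification_mkmd[OF ps_slice[OF v(1)]], goal_cases)
    case 3 show ?case
    proof (rule mdata.intro, unfold slice_simps, goal_cases)
      case (4 y n)
      then show ?case using arg_cong[OF sl_md_natural[OF v(2) \<Gamma> 4], of "R.fa (L f y)"] by simp
    next
      case (5 g v)
      let ?C = "P0 R (k0 x' (Trg Y g))" and ?L = "L f (Trg Y g)"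
      have "Comp ?C (Comp ?C (R.fa ?L (o2 (MCod \<Gamma>) g v)) (chi f g (o0 (MCod \<Gamma>) (Src Y g) v)))
           (R.fa (V x' g) (R.fa (L f (Src Y g)) (md \<Gamma> (Src Y g) v))) =
         Comp ?C (R.fa ?L (md \<Gamma> (Trg Y g) (FObj (P1 G g) v)))
            (Comp ?C (R.fa ?L (o2 (MDom \<Gamma>) g v)) (chi f g (o0 (MDom \<Gamma>) (Src Y g) v)))"
        by (rule paste_squares[where ?f2.0 = "R.fa ?L (R.fa (V (Src X f) g) (md \<Gamma> (Src Y g) v))"])
          (use 5 chi_natural[OF f(1) 5(1) refl f(2) refl refl _ refl refl, of "md \<Gamma> (Src Y g) v"]
            arg_cong[OF sl_md_modif[OF v(2) \<Gamma> 5], of "R.fa ?L"] in simp_all)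
      then show ?case using 5 by simp
    qed simp_all
  qed simp_all
qed

text \<open>Compatibility with \<open>g\<close> pastes naturality of \<open>chi\<close> in the
  2-cell \<alpha> with naturality of \<open>R.fc\<close> at the arrow
  \<open>o2 \<sigma> g v\<close>.\<close>

lemma modification_post2 [simp]:
  assumes \<alpha>: "\<alpha> \<in> C2 X" "Trg X (Dom2 X \<alpha>) = x'" and \<sigma>: "pseudonatural Y G (slice (Src X (Dom2 X \<alpha>))) \<sigma>"
  shows "modification Y G (slice x') (post2 \<alpha> \<sigma>)"
proof -
  let ?x = "Src X (Dom2 X \<alpha>)"
  have v: "x' \<in> C0 X" "?x \<in> C0 X" using \<alpha> by auto
  note [simp] = v \<alpha> \<sigma> sl_simps[OF v(2) \<sigma>]
  show ?thesis unfolding post2_def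
  proof (rule ps.modification_mkmd[OF ps_slice[OF v(1)]], goal_cases)
    case 3 show ?case
    proof (rule mdata.intro, unfold slice_simps, goal_cases)
      case (4 y n)
      then show ?case using R.fc_natural[of "k2 \<alpha> (Id2 Y (Id1 Y y))" "o1 \<sigma> y n"] by simp
    next
      case (5 g v)
      let ?C = "P0 R (k0 x' (Trg Y g))" and ?L = "L (Dom2 X \<alpha>) (Trg Y g)" and ?L' = "L (Cod2 X \<alpha>) (Trg Y g)"
      let ?o = "o0 \<sigma> (Src Y g) v"
      have "Comp ?C (Comp ?C (R.fa ?L' (o2 \<sigma> g v)) (chi (Cod2 X \<alpha>) g ?o))
           (R.fa (V x' g) (R.fc (k2 \<alpha> (Id2 Y (Id1 Y (Src Y g)))) ?o)) =
         Comp ?C (R.fc (k2 \<alpha> (Id2 Y (Id1 Y (Trg Y g)))) (o0 \<sigma> (Trg Y g) (FObj (P1 G g) v)))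
            (Comp ?C (R.fa ?L (o2 \<sigma> g v)) (chi (Dom2 X \<alpha>) g ?o))"
        by (rule paste_squares[where ?f2.0 = "R.fc (k2 \<alpha> (Id2 Y (Id1 Y (Trg Y g)))) (R.fo (V ?x g) ?o)"])
          (use 5 chi_natural2'[OF 5(1) \<alpha>(1) refl \<alpha>(2) refl refl, of ?o]
            R.fc_natural[of "k2 \<alpha> (Id2 Y (Id1 Y (Trg Y g)))" "o2 \<sigma> g v"] in simp_all)
      then show ?case using 5 by simp
    qed simp_all
  qed simp_all
qed

text \<open>\<open>chi_hpaste\<close> splits the exchange for the composite; naturality of the
  comparison cell at \<open>o2 \<sigma> g v\<close> then moves that cell to the outside.\<close>

lemma modification_post_comp [simp]:
  assumes f: "f \<in> C1 X" and f': "f' \<in> C1 X" "Trg X f = Src X f'" "Trg X f' = x''"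
    and \<sigma>: "pseudonatural Y G (slice (Src X f)) \<sigma>"
  shows "modification Y G (slice x'') (post_comp f' f \<sigma>)"
proof -
  let ?x = "Src X f" and ?x' = "Src X f'"
  have v: "?x' \<in> C0 X" "?x \<in> C0 X" "x'' \<in> C0 X" using f f' by auto
  note [simp] = v f f' \<sigma> sl_simps[OF v(2) \<sigma>]
  show ?thesis unfolding post_comp_def
  proof (rule ps.modification_mkmd[OF ps_slice[OF v(3)]], goal_cases)
    case 3 show ?case
    proof (rule mdata.intro, unfold slice_simps, goal_cases)
      case (4 y n)
      then show ?case using R.ph_natural[of "L f y" "L f' y" "o1 \<sigma> y n"] by simp
    next
      case (5 g v)
      let ?C = "P0 R (k0 x'' (Trg Y g))" and ?f = "Comp1 X f' f" and ?y = "Src Y g" and ?y' = "Trg Y g"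
      let ?o = "o0 \<sigma> ?y v" and ?o' = "o0 \<sigma> ?y' (FObj (P1 G g) v)"
      have "Comp ?C (Comp ?C (R.fa (L ?f ?y') (o2 \<sigma> g v)) (chi ?f g ?o)) (R.fa (V x'' g) (R.ph (L f' ?y) (L f ?y) ?o)) =
          Comp ?C (R.fa (L ?f ?y') (o2 \<sigma> g v)) (Comp ?C (R.ph (L f' ?y') (L f ?y') (R.fo (V ?x g) ?o))
           (Comp ?C (R.fa (L f' ?y') (chi f g ?o)) (chi f' g (R.fo (L f ?y) ?o))))"
        using 5 chi_hpaste[OF f refl f'(2) f'(1) refl f'(3) 5(1) refl refl, of ?o] by (simp add: Comp_assoc')
      also have "\<dots> = Comp ?C (R.ph (L f' ?y') (L f ?y') ?o') (Comp ?C (R.fa (L f' ?y') (R.fa (L f ?y') (o2 \<sigma> g v)))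
           (Comp ?C (R.fa (L f' ?y') (chi f g ?o)) (chi f' g (R.fo (L f ?y) ?o))))"
        by (rule rew_left) (use 5 R.ph_natural[of "L f ?y'" "L f' ?y'" "o2 \<sigma> g v"] in simp_all)
      finally show ?case using 5 by (simp add: Comp_assoc')
    qed simp_all
  qed simp_all
qed

text \<open>\<open>chi_unit2\<close> absorbs the exchange with an identity, and naturality of the
  unit cell at \<open>o2 \<sigma> g v\<close> does the rest.\<close>

lemma modification_post_unit [simp]:
  assumes x: "x \<in> C0 X" and \<sigma>: "pseudonatural Y G (slice x) \<sigma>"
  shows "modification Y G (slice x) (post_unit x \<sigma>)"
proof -
  note [simp] = x \<sigma> sl_simps[OF x \<sigma>]
  show ?thesis unfolding post_unit_def
  proof (rule ps.modification_mkmd[OF ps_slice[OF x]], goal_cases)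
    case 3 show ?case
    proof (rule mdata.intro, unfold slice_simps, goal_cases)
      case (4 y n)
      then show ?case using R.un_natural[of "k0 x y" "o1 \<sigma> y n"] by simp
    next
      case (5 g v)
      let ?y = "Src Y g" and ?y' = "Trg Y g"
      let ?C = "P0 R (k0 x ?y')" and ?o = "o0 \<sigma> ?y v" and ?o' = "o0 \<sigma> ?y' (FObj (P1 G g) v)"
      have "Comp ?C (Comp ?C (R.fa (L (Id1 X x) ?y') (o2 \<sigma> g v)) (chi (Id1 X x) g ?o)) (R.fa (V x g) (R.un (k0 x ?y) ?o)) =
          Comp ?C (R.fa (L (Id1 X x) ?y') (o2 \<sigma> g v)) (R.un (k0 x ?y') (R.fo (V x g) ?o))"
        using 5 chi_unit2[OF 5(1) refl refl x, of ?o] by (simp add: Comp_assoc')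
      also have "\<dots> = Comp ?C (R.un (k0 x ?y') ?o') (o2 \<sigma> g v)"
        using 5 R.un_natural[of "k0 x ?y'" "o2 \<sigma> g v"] by simp
      finally show ?case using 5 by simp
    qed simp_all
  qed simp_all
qed

end

context curry
begin

section \<open>The partial pseudoend as a pseudofunctor\<close>

definition TB1 where
  "TB1 f = \<lparr>FDom = PS_hom Y G (slice (Src X f)), FCod = PS_hom Y G (slice (Trg X f)),
     FObj = (\<lambda>\<sigma>\<in>Obj (PS_hom Y G (slice (Src X f))). post f \<sigma>),
     FArr = (\<lambda>\<Gamma>\<in>Arr (PS_hom Y G (slice (Src X f))). postm f \<Gamma>)\<rparr>"

definition TB where
  "TB = \<lparr>P0 = (\<lambda>x. PS_hom Y G (slice x)), P1 = TB1,
     P2 = (\<lambda>\<alpha>. \<lparr>NDom = TB1 (Dom2 X \<alpha>), NCod = TB1 (Cod2 X \<alpha>),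
       NMap = (\<lambda>\<sigma>\<in>Obj (PS_hom Y G (slice (Src X (Dom2 X \<alpha>)))). post2 \<alpha> \<sigma>)\<rparr>),
     PComp = (\<lambda>f' f. \<lparr>NDom = TB1 f' \<odot> TB1 f, NCod = TB1 (Comp1 X f' f),
       NMap = (\<lambda>\<sigma>\<in>Obj (PS_hom Y G (slice (Src X f))). post_comp f' f \<sigma>)\<rparr>),
     PUnit = (\<lambda>x. \<lparr>NDom = id_func (PS_hom Y G (slice x)), NCod = TB1 (Id1 X x),
       NMap = (\<lambda>\<sigma>\<in>Obj (PS_hom Y G (slice x)). post_unit x \<sigma>)\<rparr>)\<rparr>"

lemma TB_simps [simp]:
  "P0 TB x = PS_hom Y G (slice x)" "FDom (P1 TB f) = PS_hom Y G (slice (Src X f))"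
  "FCod (P1 TB f) = PS_hom Y G (slice (Trg X f))"
  "pseudonatural Y G (slice (Src X f)) \<sigma> \<Longrightarrow> FObj (P1 TB f) \<sigma> = post f \<sigma>"
  "modification Y G (slice (Src X f)) \<Gamma> \<Longrightarrow> FArr (P1 TB f) \<Gamma> = postm f \<Gamma>"
  "NDom (P2 TB \<alpha>) = P1 TB (Dom2 X \<alpha>)" "NCod (P2 TB \<alpha>) = P1 TB (Cod2 X \<alpha>)"
  "pseudonatural Y G (slice (Src X (Dom2 X \<alpha>))) \<sigma> \<Longrightarrow> NMap (P2 TB \<alpha>) \<sigma> = post2 \<alpha> \<sigma>"
  "NDom (PComp TB f' f) = P1 TB f' \<odot> P1 TB f" "NCod (PComp TB f' f) = P1 TB (Comp1 X f' f)"
  "pseudonatural Y G (slice (Src X f)) \<sigma> \<Longrightarrow> NMap (PComp TB f' f) \<sigma> = post_comp f' f \<sigma>"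
  "NDom (PUnit TB x) = id_func (PS_hom Y G (slice x))" "NCod (PUnit TB x) = P1 TB (Id1 X x)"
  "pseudonatural Y G (slice x) \<sigma> \<Longrightarrow> NMap (PUnit TB x) \<sigma> = post_unit x \<sigma>"
  by (simp_all add: TB_def TB1_def)

lemma TB_ext:
  "FObj (P1 TB f) \<in> extensional (Obj (PS_hom Y G (slice (Src X f))))"
  "FArr (P1 TB f) \<in> extensional (Arr (PS_hom Y G (slice (Src X f))))"
  "NMap (P2 TB \<alpha>) \<in> extensional (Obj (PS_hom Y G (slice (Src X (Dom2 X \<alpha>)))))"
  "NMap (PComp TB f' f) \<in> extensional (Obj (PS_hom Y G (slice (Src X f))))"
  "NMap (PUnit TB x) \<in> extensional (Obj (PS_hom Y G (slice x)))"
  by (simp_all add: TB_def TB1_def)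

lemmas slice_modif_eqI = ps.modif_eqI[OF ps_slice]
lemmas slice_iso_I = ps.iso_PS_homI[OF ps_slice, unfolded slice_simps]

lemma TB_functor: "is_functor (P1 TB f)" if f: "f \<in> C1 X"
proof -
  have v: "Src X f \<in> C0 X" "Trg X f \<in> C0 X" using f by simp_all
  note [simp] = f v sl_md_Comp[OF v(1)] sl_md_Comp[OF v(2)] sl_md_Idn[OF v(1)] sl_md_Idn[OF v(2)]
    sl_md[OF v(1)] sl_simps[OF v(1)]
  show ?thesis
  proof (rule is_functor.intro, goal_cases)
    case (9 \<sigma>)
    then show ?case by simp (rule slice_modif_eqI[OF v(2)], simp_all)
  next
    case (10 \<Gamma> \<Delta>)
    then show ?case by simp (rule slice_modif_eqI[OF v(2)], simp_all)
  qed (simp_all add: TB_ext)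
qed

lemma TB_ntrans: "is_ntrans (P2 TB \<alpha>)" if \<alpha>: "\<alpha> \<in> C2 X"
proof -
  have v: "Src X (Dom2 X \<alpha>) \<in> C0 X" "Trg X (Dom2 X \<alpha>) \<in> C0 X" using \<alpha> by simp_all
  note [simp] = \<alpha> v sl_md_Comp[OF v(2)] sl_md[OF v(1)] sl_simps[OF v(1)]
  show ?thesis
  proof (rule is_ntrans.intro, goal_cases)
    case (9 \<Gamma>)
    then have \<Gamma>: "modification Y G (slice (Src X (Dom2 X \<alpha>))) \<Gamma>" by simp
    have n: "Comp (P0 R (k0 (Trg X (Dom2 X \<alpha>)) y)) (R.fc (k2 \<alpha> (Id2 Y (Id1 Y y))) (o0 (MCod \<Gamma>) y v))
         (R.fa (L (Dom2 X \<alpha>) y) (md \<Gamma> y v)) =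
       Comp (P0 R (k0 (Trg X (Dom2 X \<alpha>)) y)) (R.fa (L (Cod2 X \<alpha>) y) (md \<Gamma> y v))
         (R.fc (k2 \<alpha> (Id2 Y (Id1 Y y))) (o0 (MDom \<Gamma>) y v))" if "y \<in> C0 Y" "v \<in> Obj (P0 G y)" for y v
      using R.fc_natural[of "k2 \<alpha> (Id2 Y (Id1 Y y))" "md \<Gamma> y v"] that \<Gamma> by simp
    show ?case using \<Gamma> by simp (rule slice_modif_eqI[OF v(2)], simp_all add: n)
  qed (simp_all add: TB_ext TB_functor)
qed

text \<open>Naturality in \<Gamma> is naturality of the comparison cells of \<open>R\<close> at the
  arrows \<open>md \<Gamma> y v\<close>. Invertibility is tested on components, twice: by
  \<open>nat_isoI\<close> and then inside \<open>PS_hom\<close>.\<close>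

lemma TB_PComp: "is_nat_iso (PComp TB f' f)" if f: "f \<in> C1 X" "f' \<in> C1 X" "Trg X f = Src X f'"
proof -
  have v: "Src X f \<in> C0 X" "Trg X f' \<in> C0 X" "Src X f' \<in> C0 X" using f by simp_all
  note [simp] = f v sl_md_Comp[OF v(2)] sl_md[OF v(1)] sl_simps[OF v(1)] TB_functor
  have nt: "is_ntrans (PComp TB f' f)"
  proof (rule is_ntrans.intro, goal_cases)
    case (9 \<Gamma>)
    then have \<Gamma>: "modification Y G (slice (Src X f)) \<Gamma>" by simp
    have n: "Comp (P0 R (k0 (Trg X f') y)) (R.ph (L f' y) (L f y) (o0 (MCod \<Gamma>) y v))
         (R.fa (L f' y) (R.fa (L f y) (md \<Gamma> y v))) =
       Comp (P0 R (k0 (Trg X f') y)) (R.fa (L (Comp1 X f' f) y) (md \<Gamma> y v))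
         (R.ph (L f' y) (L f y) (o0 (MDom \<Gamma>) y v))" if "y \<in> C0 Y" "v \<in> Obj (P0 G y)" for y v
      using R.ph_natural[of "L f y" "L f' y" "md \<Gamma> y v"] that \<Gamma> by simp
    show ?case using \<Gamma> by simp (rule slice_modif_eqI[OF v(2)], simp_all add: n)
  qed (simp_all add: TB_ext)
  then show ?thesis
  proof (rule nat_isoI, goal_cases)
    case (1 \<sigma>)
    then show ?case by simp (rule slice_iso_I[OF v(2)], simp_all)
  qed
qed

lemma TB_PUnit: "is_nat_iso (PUnit TB x)" if v: "x \<in> C0 X"
proof -
  note [simp] = v sl_md_Comp[OF v] sl_md[OF v] sl_simps[OF v] TB_functor
  have nt: "is_ntrans (PUnit TB x)"
  proof (rule is_ntrans.intro, goal_cases)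
    case (9 \<Gamma>)
    then have \<Gamma>: "modification Y G (slice x) \<Gamma>" by simp
    have n: "Comp (P0 R (k0 x y)) (R.un (k0 x y) (o0 (MCod \<Gamma>) y v)) (md \<Gamma> y v) =
       Comp (P0 R (k0 x y)) (R.fa (L (Id1 X x) y) (md \<Gamma> y v)) (R.un (k0 x y) (o0 (MDom \<Gamma>) y v))"
       if "y \<in> C0 Y" "v \<in> Obj (P0 G y)" for y v
      using R.un_natural[of "k0 x y" "md \<Gamma> y v"] that \<Gamma> by simp
    show ?case using \<Gamma> by simp (rule slice_modif_eqI[OF v], simp_all add: n)
  qed (simp_all add: TB_ext)
  then show ?thesis
  proof (rule nat_isoI, goal_cases)
    case (1 \<sigma>)
    then show ?case by simp (rule slice_iso_I[OF v], simp_all)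
  qed
qed

text \<open>Modifications are compared componentwise, and the component of each law at
  \<open>y\<close> and \<open>v\<close> is the same law of \<open>R\<close> for the cells of
  \<open>X\<close> paired with identities on \<open>y\<close>, evaluated at
  \<open>o0 \<sigma> y v\<close>.\<close>

lemma pseudofunctor_TB: "pseudofunctor X CAT TB"
proof (rule pseudofunctor_CATI[OF X.two_category_axioms], goal_cases)
  case (14 f \<sigma>)
  have v: "Src X f \<in> C0 X" "Trg X f \<in> C0 X" using 14 by simp_all
  note [simp] = v sl_md_Idn[OF v(2)] sl_simps[OF v(1)]
  show ?case using 14 by simp (rule slice_modif_eqI[OF v(2)], simp_all)
next
  case (15 \<alpha> \<beta> \<sigma>)
  have v: "Src X (Dom2 X \<alpha>) \<in> C0 X" "Trg X (Dom2 X \<alpha>) \<in> C0 X" using 15 by simp_all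
  have s: "Src X (Dom2 X \<beta>) = Src X (Dom2 X \<alpha>)" "Trg X (Dom2 X \<beta>) = Trg X (Dom2 X \<alpha>)"
    using X.Src_Cod2[OF 15(1)] X.Trg_Cod2[OF 15(1)] 15(3) by auto
  \<comment> \<open>The identity 2-cell on \<open>y\<close> is its own vertical composite, so
    \<open>VComp_k2\<close> read backwards splits the 2-cell. The horizontal case below is
    analogous.\<close>
  have k: "k2 (VComp X \<beta> \<alpha>) (Id2 Y (Id1 Y y)) = VComp Z (k2 \<beta> (Id2 Y (Id1 Y y))) (k2 \<alpha> (Id2 Y (Id1 Y y)))" if "y \<in> C0 Y" for y
    using VComp_k2[of \<alpha> "Id2 Y (Id1 Y y)" \<beta> "Id2 Y (Id1 Y y)"] 15 that by (simp del: VComp_k2)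
  note [simp] = v s sl_md_Comp[OF v(2)] sl_simps[OF v(1)]
  show ?case using 15 by simp (rule slice_modif_eqI[OF v(2)], simp_all add: k R.fc_VComp del: VComp_k2)
next
  case (16 \<alpha> \<beta> \<sigma>)
  let ?x = "Src X (Dom2 X \<alpha>)" and ?z = "Trg X (Dom2 X \<beta>)"
  have v: "?x \<in> C0 X" "Src X (Dom2 X \<beta>) \<in> C0 X" "?z \<in> C0 X" using 16 by simp_all
  note [simp] = v sl_md_Comp[OF v(3)] sl_md_Comp[OF v(2)] sl_simps[OF v(1)] sl_simps[OF v(2)]
  have k: "k2 (HComp X \<beta> \<alpha>) (Id2 Y (Id1 Y y)) = HComp Z (k2 \<beta> (Id2 Y (Id1 Y y))) (k2 \<alpha> (Id2 Y (Id1 Y y)))" if "y \<in> C0 Y" for y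
    using HComp_k2[of \<alpha> "Id2 Y (Id1 Y y)" \<beta> "Id2 Y (Id1 Y y)"] 16 that by (simp del: HComp_k2)
  have n: "Comp (P0 R (k0 ?z y)) (R.ph (L (Cod2 X \<beta>) y) (L (Cod2 X \<alpha>) y) w)
     (Comp (P0 R (k0 ?z y)) (R.fc (k2 \<beta> (Id2 Y (Id1 Y y))) (R.fo (L (Cod2 X \<alpha>) y) w))
       (R.fa (L (Dom2 X \<beta>) y) (R.fc (k2 \<alpha> (Id2 Y (Id1 Y y))) w))) =
     Comp (P0 R (k0 ?z y)) (R.fc (HComp Z (k2 \<beta> (Id2 Y (Id1 Y y))) (k2 \<alpha> (Id2 Y (Id1 Y y)))) w)
       (R.ph (L (Dom2 X \<beta>) y) (L (Dom2 X \<alpha>) y) w)" if "y \<in> C0 Y" "w \<in> Obj (P0 R (k0 ?x y))" for y w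
    using R.ph_natural2[of "k2 \<alpha> (Id2 Y (Id1 Y y))" "k2 \<beta> (Id2 Y (Id1 Y y))" w] 16 that by simp
  show ?case using 16 by simp (rule slice_modif_eqI[OF v(3)], simp_all add: k n del: HComp_k2)
next
  case (17 f g h \<sigma>)
  have v: "Src X f \<in> C0 X" "Src X g \<in> C0 X" "Src X h \<in> C0 X" "Trg X h \<in> C0 X" using 17 by simp_all
  note [simp] = v sl_md_Comp[OF v(4)] sl_simps[OF v(1)]
  have a: "Comp (P0 R (k0 (Trg X h) y)) (R.ph (L h y) (L (Comp1 X g f) y) w) (R.fa (L h y) (R.ph (L g y) (L f y) w)) =
    Comp (P0 R (k0 (Trg X h) y)) (R.ph (L (Comp1 X h g) y) (L f y) w) (R.ph (L h y) (L g y) (R.fo (L f y) w))"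
    if "y \<in> C0 Y" "w \<in> Obj (P0 R (k0 (Src X f) y))" for y w
    using R.ph_assoc[of "L f y" "L g y" "L h y" w] 17 that by simp
  show ?case using 17 by simp (rule slice_modif_eqI[OF v(4)], simp_all add: a X.Comp1_assoc)
next
  case (18 f \<sigma>)
  have v: "Src X f \<in> C0 X" "Trg X f \<in> C0 X" using 18 by simp_all
  note [simp] = v sl_md_Idn[OF v(2)] sl_md_Comp[OF v(2)] sl_simps[OF v(1)]
  have a: "Comp (P0 R (k0 (Trg X f) y)) (R.ph (L f y) (Id1 Z (k0 (Src X f) y)) w) (R.fa (L f y) (R.un (k0 (Src X f) y) w)) =
      Idn (P0 R (k0 (Trg X f) y)) (R.fo (L f y) w)"
    if "y \<in> C0 Y" "w \<in> Obj (P0 R (k0 (Src X f) y))" for y w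
    using R.ph_unit_right[of "L f y" "k0 (Src X f) y" w] 18 that by simp
  show ?case using 18 by simp (rule slice_modif_eqI[OF v(2)], simp_all add: a)
next
  case (19 f \<sigma>)
  have v: "Src X f \<in> C0 X" "Trg X f \<in> C0 X" using 19 by simp_all
  note [simp] = v sl_md_Idn[OF v(2)] sl_md_Comp[OF v(2)] sl_simps[OF v(1)] sl_simps[OF v(2)]
  have a: "Comp (P0 R (k0 (Trg X f) y)) (R.ph (Id1 Z (k0 (Trg X f) y)) (L f y) w) (R.un (k0 (Trg X f) y) (R.fo (L f y) w)) =
      Idn (P0 R (k0 (Trg X f) y)) (R.fo (L f y) w)"
    if "y \<in> C0 Y" "w \<in> Obj (P0 R (k0 (Src X f) y))" for y w
    using R.ph_unit_left[of "L f y" "k0 (Trg X f) y" w] 19 that by simp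
  show ?case using 19 by simp (rule slice_modif_eqI[OF v(2)], simp_all add: a)
qed (simp_all add: TB_functor TB_ntrans TB_PComp TB_PUnit)

end

section \<open>Currying\<close>

text \<open>Given only well-typed components \<open>t\<close>, the axiom for composites is a condition on pairs of
  composable 1-cells. Associativity of the comparison cells makes it behave like a cocycle condition: on the four faces
  of a composable triple, three instances imply the fourth.\<close>

context ps
begin

section \<open>Spreading the composition axiom and naturality along composites\<close>

definition mult where
  "mult s0 t a b \<longleftrightarrow> (\<forall>u\<in>Obj (P0 F (Src X b)).
     Comp (P0 G (Trg X a)) (t (Comp1 X a b) u) (G.ph a b (s0 (Src X b) u)) =
     Comp (P0 G (Trg X a)) (t a (FObj (P1 F b) u)) (G.fa a (t b u)))"

lemma multD:
  assumes "mult s0 t a b" "u \<in> Obj (P0 F x)" "Src X b = x"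
  shows "Comp (P0 G (Trg X a)) (t (Comp1 X a b) u) (G.ph a b (s0 x u)) =
     Comp (P0 G (Trg X a)) (t a (FObj (P1 F b) u)) (G.fa a (t b u))"
  using assms unfolding mult_def by auto

text \<open>The common core of \<open>mult_right\<close> and \<open>mult_left\<close>:
  multiplicativity at \<open>b\<close>, \<open>c\<close> is applied inside \<open>a\<close>, then
  multiplicativity at \<open>a\<close>, \<open>b\<close>, and naturality of \<open>ph a b\<close>
  brings \<open>t c u\<close> outside.\<close>

lemma mult_assoc:
  assumes st: "pstyped X F G s0 s1 t"
    and abc: "a \<in> C1 X" "b \<in> C1 X" "c \<in> C1 X" "Trg X c = Src X b" "Trg X b = Src X a"
    and u: "u \<in> Obj (P0 F (Src X c))" and m: "mult s0 t a b" "mult s0 t b c"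
  shows "Comp (P0 G (Trg X a)) (Comp (P0 G (Trg X a)) (t a (FObj (P1 F (Comp1 X b c)) u)) (G.fa a (t (Comp1 X b c) u)))
      (G.fa a (G.ph b c (s0 (Src X c) u))) =
    Comp (P0 G (Trg X a)) (Comp (P0 G (Trg X a)) (t (Comp1 X a b) (FObj (P1 F c) u)) (G.fa (Comp1 X a b) (t c u)))
      (G.ph a b (G.fo c (s0 (Src X c) u)))"
proof -
  interpret st: pstyped X F G s0 s1 t by fact
  let ?D = "P0 G (Trg X a)" and ?s = "s0 (Src X c) u" and ?cu = "FObj (P1 F c) u"
  note [simp] = abc u st.s_simps
  have "Comp ?D (Comp ?D (t a (FObj (P1 F (Comp1 X b c)) u)) (G.fa a (t (Comp1 X b c) u))) (G.fa a (G.ph b c ?s)) =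
      Comp ?D (t a (FObj (P1 F b) ?cu)) (G.fa a (Comp (P0 G (Trg X b)) (t (Comp1 X b c) u) (G.ph b c ?s)))"
    by (simp add: Comp_assoc')
  also have "\<dots> = Comp ?D (t a (FObj (P1 F b) ?cu)) (G.fa a (Comp (P0 G (Trg X b)) (t b ?cu) (G.fa b (t c u))))"
    using multD[OF m(2) u refl] by (simp only:)
  also have "\<dots> = Comp ?D (Comp ?D (t a (FObj (P1 F b) ?cu)) (G.fa a (t b ?cu))) (G.fa a (G.fa b (t c u)))"
    by (simp add: Comp_assoc')
  also have "\<dots> = Comp ?D (Comp ?D (t (Comp1 X a b) ?cu) (G.ph a b (s0 (Src X b) ?cu))) (G.fa a (G.fa b (t c u)))"
    using multD[OF m(1), of ?cu "Src X b"] by simp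
  also have "\<dots> = Comp ?D (t (Comp1 X a b) ?cu) (Comp ?D (G.ph a b (s0 (Src X b) ?cu)) (G.fa a (G.fa b (t c u))))"
    by (simp add: Comp_assoc')
  also have "Comp ?D (G.ph a b (s0 (Src X b) ?cu)) (G.fa a (G.fa b (t c u))) =
     Comp ?D (G.fa (Comp1 X a b) (t c u)) (G.ph a b (G.fo c ?s))"
    using G.ph_natural[of b a "t c u"] by simp
  finally show ?thesis by (simp add: Comp_assoc')
qed

text \<open>Tested after precomposition with the image under \<open>a\<close> of the comparison cell
  of \<open>b\<close> and \<open>c\<close>, where associativity of comparison cells identifies the
  two bracketings.\<close>

lemma mult_right:
  assumes st: "pstyped X F G s0 s1 t"
    and abc: "a \<in> C1 X" "b \<in> C1 X" "c \<in> C1 X" "Trg X c = Src X b" "Trg X b = Src X a"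
    and m: "mult s0 t a b" "mult s0 t b c" "mult s0 t (Comp1 X a b) c"
  shows "mult s0 t a (Comp1 X b c)"
  unfolding mult_def
proof
  fix u assume "u \<in> Obj (P0 F (Src X (Comp1 X b c)))"
  then have u: "u \<in> Obj (P0 F (Src X c))" using abc by simp
  interpret st: pstyped X F G s0 s1 t by fact
  let ?D = "P0 G (Trg X a)" and ?s = "s0 (Src X c) u"
  note [simp] = abc u st.s_simps
  have i: "iso_arr ?D (G.fa a (G.ph b c ?s))" using iso_FArr[of "P1 G a" "G.ph b c ?s"] by simp
  have "Comp ?D (t (Comp1 X a (Comp1 X b c)) u) (G.ph a (Comp1 X b c) ?s) =
     Comp ?D (t a (FObj (P1 F (Comp1 X b c)) u)) (G.fa a (t (Comp1 X b c) u))"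
  proof (rule iso_epi[OF _ i])
    have "Comp ?D (Comp ?D (t (Comp1 X a (Comp1 X b c)) u) (G.ph a (Comp1 X b c) ?s)) (G.fa a (G.ph b c ?s)) =
       Comp ?D (Comp ?D (t (Comp1 X (Comp1 X a b) c) u) (G.ph (Comp1 X a b) c ?s)) (G.ph a b (G.fo c ?s))"
      using G.ph_assoc[of c b a ?s] by (simp add: Comp_assoc' F.Comp1_assoc)
    also have "\<dots> = Comp ?D (Comp ?D (t a (FObj (P1 F (Comp1 X b c)) u)) (G.fa a (t (Comp1 X b c) u))) (G.fa a (G.ph b c ?s))"
      using multD[OF m(3) u refl] mult_assoc[OF st abc u m(1,2)] by simp
    finally show "Comp ?D (Comp ?D (t (Comp1 X a (Comp1 X b c)) u) (G.ph a (Comp1 X b c) ?s)) (G.fa a (G.ph b c ?s)) = \<dots>" .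
  qed (simp_all add: F.Comp1_assoc)
  then show "Comp ?D (t (Comp1 X a (Comp1 X b c)) u) (G.ph a (Comp1 X b c) (s0 (Src X (Comp1 X b c)) u)) =
     Comp ?D (t a (FObj (P1 F (Comp1 X b c)) u)) (G.fa a (t (Comp1 X b c) u))" by simp
qed

text \<open>The same comparison as in \<open>mult_right\<close>, cancelling the comparison cell of
  \<open>a\<close> and \<open>b\<close> instead.\<close>

lemma mult_left:
  assumes st: "pstyped X F G s0 s1 t"
    and abc: "a \<in> C1 X" "b \<in> C1 X" "c \<in> C1 X" "Trg X c = Src X b" "Trg X b = Src X a"
    and m: "mult s0 t a b" "mult s0 t b c" "mult s0 t a (Comp1 X b c)"
  shows "mult s0 t (Comp1 X a b) c"
  unfolding mult_def
proof
  fix u assume u: "u \<in> Obj (P0 F (Src X c))"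
  interpret st: pstyped X F G s0 s1 t by fact
  let ?D = "P0 G (Trg X a)" and ?s = "s0 (Src X c) u"
  note [simp] = abc u st.s_simps
  have i: "iso_arr ?D (G.ph a b (G.fo c ?s))" by simp
  have "Comp ?D (t (Comp1 X (Comp1 X a b) c) u) (G.ph (Comp1 X a b) c ?s) =
     Comp ?D (t (Comp1 X a b) (FObj (P1 F c) u)) (G.fa (Comp1 X a b) (t c u))"
  proof (rule iso_epi[OF _ i])
    have "Comp ?D (Comp ?D (t (Comp1 X (Comp1 X a b) c) u) (G.ph (Comp1 X a b) c ?s)) (G.ph a b (G.fo c ?s)) =
       Comp ?D (Comp ?D (t (Comp1 X a (Comp1 X b c)) u) (G.ph a (Comp1 X b c) ?s)) (G.fa a (G.ph b c ?s))"
      using G.ph_assoc[of c b a ?s] by (simp add: Comp_assoc' F.Comp1_assoc)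
    also have "\<dots> = Comp ?D (Comp ?D (t (Comp1 X a b) (FObj (P1 F c) u)) (G.fa (Comp1 X a b) (t c u))) (G.ph a b (G.fo c ?s))"
      using multD[OF m(3), of u "Src X c"] mult_assoc[OF st abc u m(1,2)] by simp
    finally show "Comp ?D (Comp ?D (t (Comp1 X (Comp1 X a b) c) u) (G.ph (Comp1 X a b) c ?s)) (G.ph a b (G.fo c ?s)) = \<dots>" .
  qed (simp_all add: F.Comp1_assoc)
  then show "Comp (P0 G (Trg X (Comp1 X a b))) (t (Comp1 X (Comp1 X a b) c) u) (G.ph (Comp1 X a b) c ?s) =
     Comp (P0 G (Trg X (Comp1 X a b))) (t (Comp1 X a b) (FObj (P1 F c) u)) (G.fa (Comp1 X a b) (t c u))" by simp
qed

definition nat1 where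
  "nat1 s1 t a \<longleftrightarrow> (\<forall>m\<in>Arr (P0 F (Src X a)).
     Comp (P0 G (Trg X a)) (t a (Cod (P0 F (Src X a)) m)) (G.fa a (s1 (Src X a) m)) =
     Comp (P0 G (Trg X a)) (s1 (Trg X a) (FArr (P1 F a) m)) (t a (Dom (P0 F (Src X a)) m)))"

lemma nat1D:
  assumes "nat1 s1 t a" "m \<in> Arr (P0 F x)" "Src X a = x" "Trg X a = y"
  shows "Comp (P0 G y) (t a (Cod (P0 F x) m)) (G.fa a (s1 x m)) =
     Comp (P0 G y) (s1 y (FArr (P1 F a) m)) (t a (Dom (P0 F x) m))"
  using assms unfolding nat1_def by auto

text \<open>On a multiplicative pair the component at the composite is, up to an invertible cell,
  composed of the two given components, and their naturality squares paste.\<close>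

lemma nat1_Comp1:
  assumes st: "pstyped X F G s0 s1 t" and ab: "a \<in> C1 X" "b \<in> C1 X" "Trg X b = Src X a"
    and m: "mult s0 t a b" and n: "nat1 s1 t a" "nat1 s1 t b"
  shows "nat1 s1 t (Comp1 X a b)"
  unfolding nat1_def
proof
  fix m assume "m \<in> Arr (P0 F (Src X (Comp1 X a b)))"
  then have m': "m \<in> Arr (P0 F (Src X b))" using ab by simp
  interpret st: pstyped X F G s0 s1 t by fact
  let ?D = "P0 G (Trg X a)" and ?E = "P0 G (Src X a)" and ?x = "Src X b"
  let ?u = "Dom (P0 F ?x) m" and ?v = "Cod (P0 F ?x) m"
  note [simp] = ab m' st.s_simps
  have i: "iso_arr ?D (G.ph a b (s0 ?x ?u))" by simp
  have "Comp ?D (t (Comp1 X a b) ?v) (G.fa (Comp1 X a b) (s1 ?x m)) =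
     Comp ?D (s1 (Trg X a) (FArr (P1 F (Comp1 X a b)) m)) (t (Comp1 X a b) ?u)"
  proof (rule iso_epi[OF _ i])
    have "Comp ?D (Comp ?D (t (Comp1 X a b) ?v) (G.fa (Comp1 X a b) (s1 ?x m))) (G.ph a b (s0 ?x ?u)) =
       Comp ?D (t (Comp1 X a b) ?v) (Comp ?D (G.ph a b (s0 ?x ?v)) (G.fa a (G.fa b (s1 ?x m))))"
      using G.ph_natural[of b a "s1 ?x m"] by (simp add: Comp_assoc')
    also have "\<dots> = Comp ?D (t a (FObj (P1 F b) ?v)) (Comp ?D (G.fa a (t b ?v)) (G.fa a (G.fa b (s1 ?x m))))"
      by (rule rew_left[OF multD[OF m]]) simp_all
    also have "Comp ?D (G.fa a (t b ?v)) (G.fa a (G.fa b (s1 ?x m))) =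
       Comp ?D (G.fa a (s1 (Src X a) (FArr (P1 F b) m))) (G.fa a (t b ?u))"
      using arg_cong[OF nat1D[OF n(2) m' refl ab(3)], of "G.fa a"] by simp
    also have "Comp ?D (t a (FObj (P1 F b) ?v)) (Comp ?D (G.fa a (s1 (Src X a) (FArr (P1 F b) m))) (G.fa a (t b ?u))) =
       Comp ?D (s1 (Trg X a) (FArr (P1 F a) (FArr (P1 F b) m))) (Comp ?D (t a (FObj (P1 F b) ?u)) (G.fa a (t b ?u)))"
      by (rule rew_left) (use nat1D[OF n(1), of "FArr (P1 F b) m" "Src X a" "Trg X a"] in simp_all)
    also have "Comp ?D (t a (FObj (P1 F b) ?u)) (G.fa a (t b ?u)) = Comp ?D (t (Comp1 X a b) ?u) (G.ph a b (s0 ?x ?u))"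
      by (rule multD[OF m, symmetric]) simp_all
    finally show "Comp ?D (Comp ?D (t (Comp1 X a b) ?v) (G.fa (Comp1 X a b) (s1 ?x m))) (G.ph a b (s0 ?x ?u)) =
       Comp ?D (Comp ?D (s1 (Trg X a) (FArr (P1 F (Comp1 X a b)) m)) (t (Comp1 X a b) ?u)) (G.ph a b (s0 ?x ?u))"
      by (simp add: Comp_assoc')
  qed simp_all
  then show "Comp (P0 G (Trg X (Comp1 X a b))) (t (Comp1 X a b) (Cod (P0 F (Src X (Comp1 X a b))) m))
       (G.fa (Comp1 X a b) (s1 (Src X (Comp1 X a b)) m)) =
     Comp (P0 G (Trg X (Comp1 X a b))) (s1 (Trg X (Comp1 X a b)) (FArr (P1 F (Comp1 X a b)) m))
       (t (Comp1 X a b) (Dom (P0 F (Src X (Comp1 X a b))) m))" by simp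
qed

definition nat2 where
  "nat2 s0 s1 t \<alpha> \<longleftrightarrow> (\<forall>u\<in>Obj (P0 F (Src X (Dom2 X \<alpha>))).
     Comp (P0 G (Trg X (Dom2 X \<alpha>))) (t (Cod2 X \<alpha>) u) (G.fc \<alpha> (s0 (Src X (Dom2 X \<alpha>)) u)) =
     Comp (P0 G (Trg X (Dom2 X \<alpha>))) (s1 (Trg X (Dom2 X \<alpha>)) (NMap (P2 F \<alpha>) u)) (t (Dom2 X \<alpha>) u))"

lemma nat2D:
  assumes "nat2 s0 s1 t \<alpha>" "u \<in> Obj (P0 F x)" "Src X (Dom2 X \<alpha>) = x" "Trg X (Dom2 X \<alpha>) = y"
  shows "Comp (P0 G y) (t (Cod2 X \<alpha>) u) (G.fc \<alpha> (s0 x u)) =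
     Comp (P0 G y) (s1 y (NMap (P2 F \<alpha>) u)) (t (Dom2 X \<alpha>) u)"
  using assms unfolding nat2_def by auto

text \<open>Multiplicativity is used at the target 1-cells and at the source 1-cells of \<alpha> and
  \<beta>; in between, the two 2-cells are moved past the components one at a time. \<open>H\<close>
  expresses that \<open>P2 F\<close> respects this horizontal composite, which is not among the
  assumptions of \<open>strict_pf\<close>.\<close>

lemma nat2_HComp:
  assumes st: "pstyped X F G s0 s1 t" and ab: "\<alpha> \<in> C2 X" "\<beta> \<in> C2 X" "Trg X (Dom2 X \<beta>) = Src X (Dom2 X \<alpha>)"
    and m: "mult s0 t (Dom2 X \<alpha>) (Dom2 X \<beta>)" "mult s0 t (Cod2 X \<alpha>) (Cod2 X \<beta>)"
    and n: "nat1 s1 t (Dom2 X \<alpha>)" "nat2 s0 s1 t \<alpha>" "nat2 s0 s1 t \<beta>"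
    and H: "\<And>u. u \<in> Obj (P0 F (Src X (Dom2 X \<beta>))) \<Longrightarrow> NMap (P2 F (HComp X \<alpha> \<beta>)) u =
      Comp (P0 F (Trg X (Dom2 X \<alpha>))) (NMap (P2 F \<alpha>) (FObj (P1 F (Cod2 X \<beta>)) u)) (FArr (P1 F (Dom2 X \<alpha>)) (NMap (P2 F \<beta>) u))"
  shows "nat2 s0 s1 t (HComp X \<alpha> \<beta>)"
  unfolding nat2_def
proof
  fix u assume "u \<in> Obj (P0 F (Src X (Dom2 X (HComp X \<alpha> \<beta>))))"
  then have u: "u \<in> Obj (P0 F (Src X (Dom2 X \<beta>)))" using ab by simp
  interpret st: pstyped X F G s0 s1 t by fact
  let ?a = "Dom2 X \<alpha>" and ?b = "Dom2 X \<beta>" and ?a' = "Cod2 X \<alpha>" and ?b' = "Cod2 X \<beta>"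
  let ?D = "P0 G (Trg X ?a)" and ?s = "s0 (Src X ?b) u"
  note [simp] = ab u st.s_simps
  have i: "iso_arr ?D (G.ph ?a ?b ?s)" by simp
  have ty: "G.fc \<alpha> (s0 (Src X ?a) (FObj (P1 F ?b') u)) \<in> Arr ?D" by simp
  have "Comp ?D (t (Comp1 X ?a' ?b') u) (G.fc (HComp X \<alpha> \<beta>) ?s) =
     Comp ?D (s1 (Trg X ?a) (NMap (P2 F (HComp X \<alpha> \<beta>)) u)) (t (Comp1 X ?a ?b) u)"
  proof (rule iso_epi[OF _ i])
    have "Comp ?D (Comp ?D (t (Comp1 X ?a' ?b') u) (G.fc (HComp X \<alpha> \<beta>) ?s)) (G.ph ?a ?b ?s) =
       Comp ?D (t (Comp1 X ?a' ?b') u) (Comp ?D (G.ph ?a' ?b' ?s) (Comp ?D (G.fc \<alpha> (G.fo ?b' ?s)) (G.fa ?a (G.fc \<beta> ?s))))"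
      using G.ph_natural2[of \<beta> \<alpha> ?s] by (simp add: Comp_assoc')
    also have "\<dots> = Comp ?D (t ?a' (FObj (P1 F ?b') u)) (Comp ?D (G.fa ?a' (t ?b' u)) (Comp ?D (G.fc \<alpha> (G.fo ?b' ?s)) (G.fa ?a (G.fc \<beta> ?s))))"
      by (rule rew_left) (use multD[OF m(2) _ refl, of u] in simp_all)
    also have "Comp ?D (G.fa ?a' (t ?b' u)) (Comp ?D (G.fc \<alpha> (G.fo ?b' ?s)) (G.fa ?a (G.fc \<beta> ?s))) =
       Comp ?D (G.fc \<alpha> (s0 (Src X ?a) (FObj (P1 F ?b') u))) (Comp ?D (G.fa ?a (t ?b' u)) (G.fa ?a (G.fc \<beta> ?s)))"
      by (rule rew_left) (use G.fc_natural[of \<alpha> "t ?b' u"] in simp_all)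
    also have "Comp ?D (G.fa ?a (t ?b' u)) (G.fa ?a (G.fc \<beta> ?s)) =
       Comp ?D (G.fa ?a (s1 (Src X ?a) (NMap (P2 F \<beta>) u))) (G.fa ?a (t ?b u))"
      using arg_cong[OF nat2D[OF n(3) u refl ab(3)], of "G.fa ?a"] by simp
    also have "Comp ?D (t ?a' (FObj (P1 F ?b') u)) (Comp ?D (G.fc \<alpha> (s0 (Src X ?a) (FObj (P1 F ?b') u)))
         (Comp ?D (G.fa ?a (s1 (Src X ?a) (NMap (P2 F \<beta>) u))) (G.fa ?a (t ?b u)))) =
       Comp ?D (s1 (Trg X ?a) (NMap (P2 F \<alpha>) (FObj (P1 F ?b') u))) (Comp ?D (t ?a (FObj (P1 F ?b') u))
         (Comp ?D (G.fa ?a (s1 (Src X ?a) (NMap (P2 F \<beta>) u))) (G.fa ?a (t ?b u))))"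
      by (rule rew_left) (use nat2D[OF n(2) _ refl refl, of "FObj (P1 F ?b') u"] in simp_all)
    also have "Comp ?D (t ?a (FObj (P1 F ?b') u)) (Comp ?D (G.fa ?a (s1 (Src X ?a) (NMap (P2 F \<beta>) u))) (G.fa ?a (t ?b u))) =
       Comp ?D (s1 (Trg X ?a) (FArr (P1 F ?a) (NMap (P2 F \<beta>) u))) (Comp ?D (t ?a (FObj (P1 F ?b) u)) (G.fa ?a (t ?b u)))"
      by (rule rew_left) (use nat1D[OF n(1) _ refl refl, of "NMap (P2 F \<beta>) u"] in simp_all)
    also have "Comp ?D (t ?a (FObj (P1 F ?b) u)) (G.fa ?a (t ?b u)) = Comp ?D (t (Comp1 X ?a ?b) u) (G.ph ?a ?b ?s)"
      by (rule multD[OF m(1), symmetric]) simp_all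
    finally show "Comp ?D (Comp ?D (t (Comp1 X ?a' ?b') u) (G.fc (HComp X \<alpha> \<beta>) ?s)) (G.ph ?a ?b ?s) =
       Comp ?D (Comp ?D (s1 (Trg X ?a) (NMap (P2 F (HComp X \<alpha> \<beta>)) u)) (t (Comp1 X ?a ?b) u)) (G.ph ?a ?b ?s)"
      by (simp add: Comp_assoc' H)
  qed (simp_all add: H)
  then show "Comp (P0 G (Trg X (Dom2 X (HComp X \<alpha> \<beta>)))) (t (Cod2 X (HComp X \<alpha> \<beta>)) u)
        (G.fc (HComp X \<alpha> \<beta>) (s0 (Src X (Dom2 X (HComp X \<alpha> \<beta>))) u)) =
     Comp (P0 G (Trg X (Dom2 X (HComp X \<alpha> \<beta>)))) (s1 (Trg X (Dom2 X (HComp X \<alpha> \<beta>))) (NMap (P2 F (HComp X \<alpha> \<beta>)) u))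
        (t (Dom2 X (HComp X \<alpha> \<beta>)) u)" by simp
qed

end

text \<open>Here \<open>k\<close> identifies \<open>Z\<close> with \<open>X \<times> Y\<close>, and \<open>p\<close> identifies \<open>H (k x y)\<close> with \<open>F x \<times> G y\<close>.\<close>

locale curry_iso = curry X Y Z G R k0 k1 k2 + F: strict_pf X F + H: strict_pf Z H
  for X :: "('x0, 'x1, 'x2) two_cat" and Y :: "('y0, 'y1, 'y2) two_cat" and Z :: "('z0, 'z1, 'z2) two_cat"
    and F :: "('x0, 'x1, 'x2, 'of, 'mf) cat_pfunc" and G :: "('y0, 'y1, 'y2, 'og, 'mg) cat_pfunc"
    and H :: "('z0, 'z1, 'z2, 'oh, 'mh) cat_pfunc" and R :: "('z0, 'z1, 'z2, 'o, 'm) cat_pfunc"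
    and k0 :: "'x0 \<Rightarrow> 'y0 \<Rightarrow> 'z0" and k1 :: "'x1 \<Rightarrow> 'y1 \<Rightarrow> 'z1" and k2 :: "'x2 \<Rightarrow> 'y2 \<Rightarrow> 'z2" +
  fixes p0 :: "'of \<Rightarrow> 'og \<Rightarrow> 'oh" and p1 :: "'mf \<Rightarrow> 'mg \<Rightarrow> 'mh"
  assumes k0_inj: "inj (\<lambda>(x, y). k0 x y)" and k1_inj: "inj (\<lambda>(f, g). k1 f g)"
    and p0_inj: "inj (\<lambda>(u, v). p0 u v)" and p1_inj: "inj (\<lambda>(m, n). p1 m n)"
    and k0_surj: "z \<in> C0 Z \<Longrightarrow> \<exists>x\<in>C0 X. \<exists>y\<in>C0 Y. z = k0 x y"
    and k1_surj: "h \<in> C1 Z \<Longrightarrow> \<exists>f\<in>C1 X. \<exists>g\<in>C1 Y. h = k1 f g"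
    and k2_surj: "\<gamma> \<in> C2 Z \<Longrightarrow> \<exists>\<alpha>\<in>C2 X. \<exists>\<beta>\<in>C2 Y. \<gamma> = k2 \<alpha> \<beta>"
    and p0_in [simp]: "\<lbrakk>x \<in> C0 X; y \<in> C0 Y; u \<in> Obj (P0 F x); v \<in> Obj (P0 G y)\<rbrakk> \<Longrightarrow> p0 u v \<in> Obj (P0 H (k0 x y))"
    and p1_in [simp]: "\<lbrakk>x \<in> C0 X; y \<in> C0 Y; m \<in> Arr (P0 F x); n \<in> Arr (P0 G y)\<rbrakk> \<Longrightarrow> p1 m n \<in> Arr (P0 H (k0 x y))"
    and p0_surj: "\<lbrakk>x \<in> C0 X; y \<in> C0 Y; w \<in> Obj (P0 H (k0 x y))\<rbrakk> \<Longrightarrow> \<exists>u\<in>Obj (P0 F x). \<exists>v\<in>Obj (P0 G y). w = p0 u v"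
    and p1_surj: "\<lbrakk>x \<in> C0 X; y \<in> C0 Y; l \<in> Arr (P0 H (k0 x y))\<rbrakk> \<Longrightarrow> \<exists>m\<in>Arr (P0 F x). \<exists>n\<in>Arr (P0 G y). l = p1 m n"
    and Dom_p1 [simp]: "\<lbrakk>x \<in> C0 X; y \<in> C0 Y; m \<in> Arr (P0 F x); n \<in> Arr (P0 G y)\<rbrakk>
      \<Longrightarrow> Dom (P0 H (k0 x y)) (p1 m n) = p0 (Dom (P0 F x) m) (Dom (P0 G y) n)"
    and Cod_p1 [simp]: "\<lbrakk>x \<in> C0 X; y \<in> C0 Y; m \<in> Arr (P0 F x); n \<in> Arr (P0 G y)\<rbrakk>
      \<Longrightarrow> Cod (P0 H (k0 x y)) (p1 m n) = p0 (Cod (P0 F x) m) (Cod (P0 G y) n)"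
    and Idn_p0: "\<lbrakk>x \<in> C0 X; y \<in> C0 Y; u \<in> Obj (P0 F x); v \<in> Obj (P0 G y)\<rbrakk>
      \<Longrightarrow> Idn (P0 H (k0 x y)) (p0 u v) = p1 (Idn (P0 F x) u) (Idn (P0 G y) v)"
    and Comp_p1: "\<lbrakk>x \<in> C0 X; y \<in> C0 Y; m \<in> Arr (P0 F x); n \<in> Arr (P0 G y); m' \<in> Arr (P0 F x); n' \<in> Arr (P0 G y);
        Cod (P0 F x) m = Dom (P0 F x) m'; Cod (P0 G y) n = Dom (P0 G y) n'\<rbrakk>
      \<Longrightarrow> Comp (P0 H (k0 x y)) (p1 m' n') (p1 m n) = p1 (Comp (P0 F x) m' m) (Comp (P0 G y) n' n)"
    and P1_H [simp]: "\<lbrakk>f \<in> C1 X; g \<in> C1 Y; u \<in> Obj (P0 F (Src X f)); v \<in> Obj (P0 G (Src Y g))\<rbrakk>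
      \<Longrightarrow> FObj (P1 H (k1 f g)) (p0 u v) = p0 (FObj (P1 F f) u) (FObj (P1 G g) v)"
      "\<lbrakk>f \<in> C1 X; g \<in> C1 Y; m \<in> Arr (P0 F (Src X f)); n \<in> Arr (P0 G (Src Y g))\<rbrakk>
      \<Longrightarrow> FArr (P1 H (k1 f g)) (p1 m n) = p1 (FArr (P1 F f) m) (FArr (P1 G g) n)"
    and P2_H [simp]: "\<lbrakk>\<alpha> \<in> C2 X; \<beta> \<in> C2 Y; u \<in> Obj (P0 F (Src X (Dom2 X \<alpha>))); v \<in> Obj (P0 G (Src Y (Dom2 Y \<beta>)))\<rbrakk>
      \<Longrightarrow> NMap (P2 H (k2 \<alpha> \<beta>)) (p0 u v) = p1 (NMap (P2 F \<alpha>) u) (NMap (P2 G \<beta>) v)"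
begin

section \<open>From iterated to joint transformations\<close>

sublocale ZR: ps Z H R by unfold_locales

lemma ps_TB: "ps X F TB"
  by (intro ps.intro cat_pf.intro F.strict_pf_axioms X.two_category_axioms pseudofunctor_TB)

text \<open>\<open>Z\<close> and \<open>H\<close> are identified with products only through
  \<open>k0\<close> and \<open>p0\<close>, hence the decoding by \<open>inv\<close>.\<close>

definition K0 where
  "K0 \<tau> z w = (case inv (\<lambda>(x, y). k0 x y) z of (x, y) \<Rightarrow> case inv (\<lambda>(u, v). p0 u v) w of (u, v) \<Rightarrow> o0 (o0 \<tau> x u) y v)"

text \<open>Forced by functoriality: \<open>(m, n)\<close> is \<open>(1, n)\<close> after
  \<open>(m, 1)\<close>. The second factor is a component of a modification, the first an arrow
  value of the inner transformation.\<close>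

definition K1 where
  "K1 \<tau> z l = (case inv (\<lambda>(x, y). k0 x y) z of (x, y) \<Rightarrow> case inv (\<lambda>(m, n). p1 m n) l of (m, n) \<Rightarrow>
     Comp (P0 R (k0 x y)) (o1 (o0 \<tau> x (Cod (P0 F x) m)) y n) (md (o1 \<tau> x m) y (Dom (P0 G y) n)))"

text \<open>The component at \<open>(f, g)\<close> is forced by the factorization \<open>(f, g) = (1, g) \<circ> (f, 1)\<close>.\<close>

definition K2 where
  "K2 \<tau> h w = (case inv (\<lambda>(f, g). k1 f g) h of (f, g) \<Rightarrow> case inv (\<lambda>(u, v). p0 u v) w of (u, v) \<Rightarrow>
     let C = P0 R (k0 (Trg X f) (Trg Y g)) in
     Comp C (Comp C (o2 (o0 \<tau> (Trg X f) (FObj (P1 F f) u)) g v) (R.fa (V (Trg X f) g) (md (o2 \<tau> f u) (Src Y g) v)))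
       (inv_arr C (R.ph (V (Trg X f) g) (L f (Src Y g)) (o0 (o0 \<tau> (Src X f) u) (Src Y g) v))))"

lemma K_simps [simp]:
  "K0 \<tau> (k0 x y) (p0 u v) = o0 (o0 \<tau> x u) y v"
  "K1 \<tau> (k0 x y) (p1 m n) =
     Comp (P0 R (k0 x y)) (o1 (o0 \<tau> x (Cod (P0 F x) m)) y n) (md (o1 \<tau> x m) y (Dom (P0 G y) n))"
  by (simp_all add: K0_def K1_def inv_pair[OF k0_inj] inv_pair[OF p0_inj] inv_pair[OF p1_inj])

lemma K2_eq:
  assumes "Src X f = x" "Trg X f = x'" "Src Y g = y" "Trg Y g = y'"
  shows "K2 \<tau> (k1 f g) (p0 u v) =
     Comp (P0 R (k0 x' y')) (Comp (P0 R (k0 x' y')) (o2 (o0 \<tau> x' (FObj (P1 F f) u)) g v) (R.fa (V x' g) (md (o2 \<tau> f u) y v)))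
       (inv_arr (P0 R (k0 x' y')) (R.ph (V x' g) (L f y) (o0 (o0 \<tau> x u) y v)))"
  using assms by (simp add: K2_def Let_def inv_pair[OF k1_inj] inv_pair[OF p0_inj])

lemma pz_cases:
  assumes "z \<in> C0 Z" "w \<in> Obj (P0 H z)"
  obtains x y u v where "x \<in> C0 X" "y \<in> C0 Y" "u \<in> Obj (P0 F x)" "v \<in> Obj (P0 G y)" "z = k0 x y" "w = p0 u v"
  using k0_surj[OF assms(1)] p0_surj assms(2) by blast

lemma pm_cases:
  assumes "z \<in> C0 Z" "l \<in> Arr (P0 H z)"
  obtains x y m n where "x \<in> C0 X" "y \<in> C0 Y" "m \<in> Arr (P0 F x)" "n \<in> Arr (P0 G y)" "z = k0 x y" "l = p1 m n"
  using k0_surj[OF assms(1)] p1_surj assms(2) by blast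

lemma pf_cases:
  assumes "h \<in> C1 Z" "w \<in> Obj (P0 H (Src Z h))"
  obtains f g u v where "f \<in> C1 X" "g \<in> C1 Y" "u \<in> Obj (P0 F (Src X f))" "v \<in> Obj (P0 G (Src Y g))" "h = k1 f g" "w = p0 u v"
proof -
  obtain f g where fg: "f \<in> C1 X" "g \<in> C1 Y" "h = k1 f g" using k1_surj[OF assms(1)] by blast
  then have "w \<in> Obj (P0 H (k0 (Src X f) (Src Y g)))" using assms(2) by simp
  then obtain u v where "u \<in> Obj (P0 F (Src X f))" "v \<in> Obj (P0 G (Src Y g))" "w = p0 u v"
    using p0_surj fg X.one_cells(1) G.one_cells(1) by blast
  then show ?thesis using that fg by blast
qed

context
  fixes \<tau> assumes \<tau>: "pseudonatural X F TB \<tau>"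
begin

lemma T_pn [simp]: "\<lbrakk>x \<in> C0 X; u \<in> Obj (P0 F x)\<rbrakk> \<Longrightarrow> pseudonatural Y G (slice x) (o0 \<tau> x u)"
  using ps.o_simps(1)[OF ps_TB \<tau>] by simp

lemma M_mod [simp]:
  assumes "x \<in> C0 X" "m \<in> Arr (P0 F x)"
  shows "modification Y G (slice x) (o1 \<tau> x m)" "MDom (o1 \<tau> x m) = o0 \<tau> x (Dom (P0 F x) m)" "MCod (o1 \<tau> x m) = o0 \<tau> x (Cod (P0 F x) m)"
  using ps.o_simps(2-4)[OF ps_TB \<tau> assms] by simp_all

lemma M_mod' [simp]:
  "\<lbrakk>x \<in> C0 X; u \<in> Obj (P0 F x)\<rbrakk> \<Longrightarrow> o1 \<tau> x (Idn (P0 F x) u) = Idn (PS_hom Y G (slice x)) (o0 \<tau> x u)"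
  "\<lbrakk>x \<in> C0 X; m \<in> Arr (P0 F x); n \<in> Arr (P0 F x); Cod (P0 F x) m = Dom (P0 F x) n\<rbrakk>
    \<Longrightarrow> o1 \<tau> x (Comp (P0 F x) n m) = Comp (PS_hom Y G (slice x)) (o1 \<tau> x n) (o1 \<tau> x m)"
  using ps.o_simps(5,6)[OF ps_TB \<tau>] by simp_all

lemma th_mod [simp]:
  assumes f: "f \<in> C1 X" "u \<in> Obj (P0 F (Src X f))" "Trg X f = x'"
  shows "modification Y G (slice x') (o2 \<tau> f u)" "MDom (o2 \<tau> f u) = post f (o0 \<tau> (Src X f) u)" "MCod (o2 \<tau> f u) = o0 \<tau> x' (FObj (P1 F f) u)"
  using ps.o_simps(8-10)[OF ps_TB \<tau> f] T_pn[OF X.one_cells(1)[OF f(1)] f(2)] by simp_all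

lemmas T_simps [simp] = sl_simps[OF _ T_pn]
  and M_simps [simp] = sl_md[OF _ M_mod(1)]
  and th_simps [simp] = sl_md[OF _ th_mod(1)]

lemma th_iso [simp]:
  assumes f: "f \<in> C1 X" "u \<in> Obj (P0 F (Src X f))" "Trg X f = x'" and y: "y \<in> C0 Y" "v \<in> Obj (P0 G y)"
  shows "iso_arr (P0 R (k0 x' y)) (md (o2 \<tau> f u) y v)"
proof -
  have v: "x' \<in> C0 X" using f by auto
  show ?thesis
    using ps.iso_PS_homD[OF ps_slice[OF v] _ y, of "o2 \<tau> f u"] ps.o_simps(7)[OF ps_TB \<tau> f] by (simp add: slice_simps)
qed

text \<open>The axioms of \<tau> are equations between modifications. This lemma and the next three
  take their components at \<open>y\<close> and \<open>v\<close>.\<close>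

lemma th_natural:
  assumes f: "f \<in> C1 X" "m \<in> Arr (P0 F (Src X f))" and y: "y \<in> C0 Y" "v \<in> Obj (P0 G y)"
  shows "Comp (P0 R (k0 (Trg X f) y)) (md (o2 \<tau> f (Cod (P0 F (Src X f)) m)) y v) (R.fa (L f y) (md (o1 \<tau> (Src X f) m) y v)) =
    Comp (P0 R (k0 (Trg X f) y)) (md (o1 \<tau> (Trg X f) (FArr (P1 F f) m)) y v) (md (o2 \<tau> f (Dom (P0 F (Src X f)) m)) y v)"
  using arg_cong[OF ps.o2_natural[OF ps_TB \<tau> f], of "\<lambda>\<Gamma>. md \<Gamma> y v"] f y
    sl_md_Comp[of "Trg X f"] by simp

lemma th_natural2:
  assumes \<alpha>: "\<alpha> \<in> C2 X" "u \<in> Obj (P0 F (Src X (Dom2 X \<alpha>)))" and y: "y \<in> C0 Y" "v \<in> Obj (P0 G y)"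
  shows "Comp (P0 R (k0 (Trg X (Dom2 X \<alpha>)) y)) (md (o2 \<tau> (Cod2 X \<alpha>) u) y v)
      (R.fc (k2 \<alpha> (Id2 Y (Id1 Y y))) (o0 (o0 \<tau> (Src X (Dom2 X \<alpha>)) u) y v)) =
    Comp (P0 R (k0 (Trg X (Dom2 X \<alpha>)) y)) (md (o1 \<tau> (Trg X (Dom2 X \<alpha>)) (NMap (P2 F \<alpha>) u)) y v) (md (o2 \<tau> (Dom2 X \<alpha>) u) y v)"
  using arg_cong[OF ps.o2_natural2[OF ps_TB \<tau> \<alpha>], of "\<lambda>\<Gamma>. md \<Gamma> y v"] \<alpha> y
    sl_md_Comp[of "Trg X (Dom2 X \<alpha>)"] by simp

lemma th_Comp1:
  assumes f: "f \<in> C1 X" "f' \<in> C1 X" "Trg X f = Src X f'" "u \<in> Obj (P0 F (Src X f))" and y: "y \<in> C0 Y" "v \<in> Obj (P0 G y)"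
  shows "Comp (P0 R (k0 (Trg X f') y)) (md (o2 \<tau> (Comp1 X f' f) u) y v) (R.ph (L f' y) (L f y) (o0 (o0 \<tau> (Src X f) u) y v)) =
    Comp (P0 R (k0 (Trg X f') y)) (md (o2 \<tau> f' (FObj (P1 F f) u)) y v) (R.fa (L f' y) (md (o2 \<tau> f u) y v))"
  using arg_cong[OF ps.o2_Comp1[OF ps_TB \<tau> f], of "\<lambda>\<Gamma>. md \<Gamma> y v"] f y sl_md_Comp[of "Trg X f'"] by simp

lemma th_Id1:
  assumes x: "x \<in> C0 X" "u \<in> Obj (P0 F x)" and y: "y \<in> C0 Y" "v \<in> Obj (P0 G y)"
  shows "Comp (P0 R (k0 x y)) (md (o2 \<tau> (Id1 X x) u) y v) (R.un (k0 x y) (o0 (o0 \<tau> x u) y v)) = Idn (P0 R (k0 x y)) (o0 (o0 \<tau> x u) y v)"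
  using arg_cong[OF ps.o2_Id1[OF ps_TB \<tau> x], of "\<lambda>\<Gamma>. md \<Gamma> y v"] x y sl_md_Comp[of x] by simp

end

end

context curry_iso
begin

context
  fixes \<tau> assumes \<tau> [simp]: "pseudonatural X F TB \<tau>"
begin

text \<open>Naturality of the modification \<open>o1 \<tau> x m\<close>. It says that both
  factorizations of \<open>(m, n)\<close> give the same value, which makes \<open>K1\<close>
  functorial.\<close>

lemma N_M:
  assumes "x \<in> C0 X" "y \<in> C0 Y" "m \<in> Arr (P0 F x)" "n \<in> Arr (P0 G y)"
  shows "Comp (P0 R (k0 x y)) (md (o1 \<tau> x m) y (Cod (P0 G y) n)) (o1 (o0 \<tau> x (Dom (P0 F x) m)) y n) =
    Comp (P0 R (k0 x y)) (o1 (o0 \<tau> x (Cod (P0 F x) m)) y n) (md (o1 \<tau> x m) y (Dom (P0 G y) n))"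
  using sl_md_natural[OF assms(1) M_mod(1)[OF \<tau> assms(1,3)] assms(2,4)] assms by simp

text \<open>The last equation is the composition axiom for \<open>V\<close> after \<open>L\<close>.
  It determines \<open>K2\<close>, since the comparison cell is invertible, and replaces the
  definition in what follows.\<close>

lemma K2_fac:
  assumes f: "f \<in> C1 X" "Src X f = x" "Trg X f = x'" and g: "g \<in> C1 Y" "Src Y g = y" "Trg Y g = y'"
    and uv: "u \<in> Obj (P0 F x)" "v \<in> Obj (P0 G y)"
  shows "iso_arr (P0 R (k0 x' y')) (K2 \<tau> (k1 f g) (p0 u v))"
    "Dom (P0 R (k0 x' y')) (K2 \<tau> (k1 f g) (p0 u v)) = R.fo (k1 f g) (o0 (o0 \<tau> x u) y v)"
    "Cod (P0 R (k0 x' y')) (K2 \<tau> (k1 f g) (p0 u v)) = o0 (o0 \<tau> x' (FObj (P1 F f) u)) y' (FObj (P1 G g) v)"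
    "Comp (P0 R (k0 x' y')) (K2 \<tau> (k1 f g) (p0 u v)) (R.ph (V x' g) (L f y) (o0 (o0 \<tau> x u) y v)) =
      Comp (P0 R (k0 x' y')) (o2 (o0 \<tau> x' (FObj (P1 F f) u)) g v) (R.fa (V x' g) (md (o2 \<tau> f u) y v))"
proof -
  have v: "x \<in> C0 X" "x' \<in> C0 X" "y \<in> C0 Y" "y' \<in> C0 Y" using f g by auto
  note [simp] = f g uv v
  have Fu: "FObj (P1 F f) u \<in> Obj (P0 F x')" by simp
  note [simp] = Fu
  have i: "iso_arr (P0 R (k0 x' y')) (R.fa (V x' g) (md (o2 \<tau> f u) y v))"
    using iso_FArr[of "P1 R (V x' g)" "md (o2 \<tau> f u) y v"] by simp
  note [simp] = i
  show "iso_arr (P0 R (k0 x' y')) (K2 \<tau> (k1 f g) (p0 u v))"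
    "Dom (P0 R (k0 x' y')) (K2 \<tau> (k1 f g) (p0 u v)) = R.fo (k1 f g) (o0 (o0 \<tau> x u) y v)"
    "Cod (P0 R (k0 x' y')) (K2 \<tau> (k1 f g) (p0 u v)) = o0 (o0 \<tau> x' (FObj (P1 F f) u)) y' (FObj (P1 G g) v)"
    "Comp (P0 R (k0 x' y')) (K2 \<tau> (k1 f g) (p0 u v)) (R.ph (V x' g) (L f y) (o0 (o0 \<tau> x u) y v)) =
      Comp (P0 R (k0 x' y')) (o2 (o0 \<tau> x' (FObj (P1 F f) u)) g v) (R.fa (V x' g) (md (o2 \<tau> f u) y v))"
    unfolding K2_eq[OF f(2,3) g(2,3)] by (simp_all add: Comp_assoc')
qed

lemma K_typed: "pstyped Z H R (K0 \<tau>) (K1 \<tau>) (K2 \<tau>)"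
proof (rule pstyped.intro, goal_cases)
  case (1 z w)
  show ?case by (rule pz_cases[OF 1]) simp
next
  case (2 z l)
  show ?case by (rule pm_cases[OF 2]) simp
next
  case (3 z l)
  show ?case by (rule pm_cases[OF 3]) simp
next
  case (4 z l)
  show ?case by (rule pm_cases[OF 4]) simp
next
  case (5 z w)
  show ?case by (rule pz_cases[OF 5]) (simp add: Idn_p0)
next
  case (6 z l l')
  obtain x y m n where 1: "x \<in> C0 X" "y \<in> C0 Y" "m \<in> Arr (P0 F x)" "n \<in> Arr (P0 G y)" "z = k0 x y" "l = p1 m n"
    using 6(1,2) by (elim pm_cases)
  obtain m' n' where 2: "m' \<in> Arr (P0 F x)" "n' \<in> Arr (P0 G y)" "l' = p1 m' n'"
    using p1_surj[OF 1(1,2)] 6(3) unfolding 1(5) by blast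
  \<comment> \<open>Composability in \<open>H\<close> is composability in each coordinate, because
    \<open>p0\<close> is injective.\<close>
  have "(Cod (P0 F x) m, Cod (P0 G y) n) = (Dom (P0 F x) m', Dom (P0 G y) n')"
    using 6(4) 1 2 injD[OF p0_inj, of "(Cod (P0 F x) m, Cod (P0 G y) n)" "(Dom (P0 F x) m', Dom (P0 G y) n')"] by simp
  then have c: "Cod (P0 F x) m = Dom (P0 F x) m'" "Cod (P0 G y) n = Dom (P0 G y) n'" by simp_all
  note [simp] = 1 2 c
  let ?C = "P0 R (k0 x y)" and ?u = "Dom (P0 F x) m'" and ?u' = "Cod (P0 F x) m'"
    and ?d = "Dom (P0 G y) n" and ?v = "Dom (P0 G y) n'"
  have "Comp ?C (Comp ?C (o1 (o0 \<tau> x ?u') y n') (o1 (o0 \<tau> x ?u') y n)) (Comp ?C (md (o1 \<tau> x m') y ?d) (md (o1 \<tau> x m) y ?d)) =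
     Comp ?C (o1 (o0 \<tau> x ?u') y n') (Comp ?C (o1 (o0 \<tau> x ?u') y n) (Comp ?C (md (o1 \<tau> x m') y ?d) (md (o1 \<tau> x m) y ?d)))"
    by (simp add: Comp_assoc')
  \<comment> \<open>The two middle factors of the composite trade places by
    \<open>N_M\<close>.\<close>
  also have "Comp ?C (o1 (o0 \<tau> x ?u') y n) (Comp ?C (md (o1 \<tau> x m') y ?d) (md (o1 \<tau> x m) y ?d)) =
     Comp ?C (md (o1 \<tau> x m') y ?v) (Comp ?C (o1 (o0 \<tau> x ?u) y n) (md (o1 \<tau> x m) y ?d))"
    by (rule rew_left) (use N_M[OF 1(1,2) 2(1) 1(4)] in simp_all)
  finally show ?case by (simp add: Comp_p1 Comp_assoc')
next
  case (7 h w h')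
  show ?case unfolding 7(3)[symmetric]
    by (rule pf_cases[OF 7(1,2)]) (simp add: K2_fac)
next
  case (8 h w h')
  show ?case unfolding 8(3)[symmetric]
    by (rule pf_cases[OF 8(1,2)]) (simp add: K2_fac)
next
  case (9 h w h')
  show ?case unfolding 9(3)[symmetric]
    by (rule pf_cases[OF 9(1,2)]) (simp add: K2_fac)
qed

text \<open>An identity, written by the right unit law of \<open>R\<close>, is inserted so that
  \<open>K2_fac\<close> applies; the component of \<tau> at the identity of \<open>x\<close> then
  cancels by the unit axiom \<open>th_Id1\<close>.\<close>

lemma K2_V:
  assumes x: "x \<in> C0 X" "u \<in> Obj (P0 F x)" and g: "g \<in> C1 Y" "v \<in> Obj (P0 G (Src Y g))"
  shows "K2 \<tau> (V x g) (p0 u v) = o2 (o0 \<tau> x u) g v"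
proof -
  let ?y = "Src Y g" and ?y' = "Trg Y g"
  let ?C = "P0 R (k0 x ?y')" and ?s = "o0 (o0 \<tau> x u) ?y v" and ?K = "K2 \<tau> (V x g) (p0 u v)"
  note [simp] = x g
  note K = K2_fac[OF X.one_cells(3-5)[OF x(1)] g(1) refl refl x(2) g(2)]
  have t: "?K \<in> Arr ?C" using K(1) by simp
  have D: "Dom ?C ?K = R.fo (V x g) ?s" using K(2) by simp
  note [simp] = t D
  have "?K = Comp ?C ?K (Comp ?C (R.ph (V x g) (Id1 Z (k0 x ?y)) ?s) (R.fa (V x g) (R.un (k0 x ?y) ?s)))"
    using R.ph_unit_right[of "V x g" "k0 x ?y" ?s] by simp
  also have "\<dots> = Comp ?C (o2 (o0 \<tau> x u) g v) (Comp ?C (R.fa (V x g) (md (o2 \<tau> (Id1 X x) u) ?y v)) (R.fa (V x g) (R.un (k0 x ?y) ?s)))"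
    by (rule rew_left) (use K(4) in simp_all)
  also have "Comp ?C (R.fa (V x g) (md (o2 \<tau> (Id1 X x) u) ?y v)) (R.fa (V x g) (R.un (k0 x ?y) ?s)) = Idn ?C (R.fo (V x g) ?s)"
    using arg_cong[OF th_Id1[OF \<tau> x, of ?y v], of "R.fa (V x g)"] by simp
  finally show ?thesis by simp
qed

text \<open>Dual to \<open>K2_V\<close>: the left unit law of \<open>R\<close> is inserted, the unit
  cell is moved past \<open>md (o2 \<tau> f u) y v\<close> by naturality, and the unit axiom of the
  inner transformation removes it.\<close>

lemma K2_L:
  assumes f: "f \<in> C1 X" "u \<in> Obj (P0 F (Src X f))" and y: "y \<in> C0 Y" "v \<in> Obj (P0 G y)"
  shows "K2 \<tau> (L f y) (p0 u v) = md (o2 \<tau> f u) y v"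
proof -
  let ?x = "Src X f" and ?x' = "Trg X f"
  let ?C = "P0 R (k0 ?x' y)" and ?s = "o0 (o0 \<tau> ?x u) y v" and ?K = "K2 \<tau> (L f y) (p0 u v)"
  note [simp] = f y
  note K = K2_fac[OF f(1) refl refl G.one_cells(3-5)[OF y(1)] f(2) y(2)]
  have t: "?K \<in> Arr ?C" using K(1) by simp
  have D: "Dom ?C ?K = R.fo (L f y) ?s" using K(2) by simp
  note [simp] = t D
  let ?t = "o2 (o0 \<tau> ?x' (FObj (P1 F f) u)) (Id1 Y y) v"
  have "?K = Comp ?C ?K (Comp ?C (R.ph (Id1 Z (k0 ?x' y)) (L f y) ?s) (R.un (k0 ?x' y) (R.fo (L f y) ?s)))"
    using R.ph_unit_left[of "L f y" "k0 ?x' y" ?s] by simp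
  also have "\<dots> = Comp ?C ?t (Comp ?C (R.fa (Id1 Z (k0 ?x' y)) (md (o2 \<tau> f u) y v)) (R.un (k0 ?x' y) (R.fo (L f y) ?s)))"
    by (rule rew_left) (use K(4) in simp_all)
  also have "Comp ?C (R.fa (Id1 Z (k0 ?x' y)) (md (o2 \<tau> f u) y v)) (R.un (k0 ?x' y) (R.fo (L f y) ?s)) =
     Comp ?C (R.un (k0 ?x' y) (o0 (o0 \<tau> ?x' (FObj (P1 F f) u)) y v)) (md (o2 \<tau> f u) y v)"
    using R.un_natural[of "k0 ?x' y" "md (o2 \<tau> f u) y v"] by simp
  also have "Comp ?C ?t (Comp ?C (R.un (k0 ?x' y) (o0 (o0 \<tau> ?x' (FObj (P1 F f) u)) y v)) (md (o2 \<tau> f u) y v)) =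
     Comp ?C (Comp ?C ?t (R.un (k0 ?x' y) (o0 (o0 \<tau> ?x' (FObj (P1 F f) u)) y v))) (md (o2 \<tau> f u) y v)"
    by (simp add: Comp_assoc')
  also have "\<dots> = md (o2 \<tau> f u) y v"
    using sl_Id1[of ?x' "o0 \<tau> ?x' (FObj (P1 F f) u)" y v] by simp
  finally show ?thesis .
qed

lemma multI:
  assumes "\<And>u v. \<lbrakk>u \<in> Obj (P0 F (Src X f)); v \<in> Obj (P0 G (Src Y g))\<rbrakk> \<Longrightarrow>
     Comp (P0 R (k0 (Trg X f') (Trg Y g'))) (K2 \<tau> (k1 (Comp1 X f' f) (Comp1 Y g' g)) (p0 u v))
       (R.ph (k1 f' g') (k1 f g) (o0 (o0 \<tau> (Src X f) u) (Src Y g) v)) =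
     Comp (P0 R (k0 (Trg X f') (Trg Y g'))) (K2 \<tau> (k1 f' g') (p0 (FObj (P1 F f) u) (FObj (P1 G g) v)))
       (R.fa (k1 f' g') (K2 \<tau> (k1 f g) (p0 u v)))"
    and "f \<in> C1 X" "f' \<in> C1 X" "Trg X f = Src X f'" "g \<in> C1 Y" "g' \<in> C1 Y" "Trg Y g = Src Y g'"
  shows "ZR.mult (K0 \<tau>) (K2 \<tau>) (k1 f' g') (k1 f g)"
  unfolding ZR.mult_def
proof
  fix w assume w: "w \<in> Obj (P0 H (Src Z (k1 f g)))"
  then obtain u v where "u \<in> Obj (P0 F (Src X f))" "v \<in> Obj (P0 G (Src Y g))" "w = p0 u v"
    using p0_surj[of "Src X f" "Src Y g" w] assms by auto
  then show "Comp (P0 R (Trg Z (k1 f' g'))) (K2 \<tau> (Comp1 Z (k1 f' g') (k1 f g)) w)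
       (R.ph (k1 f' g') (k1 f g) (K0 \<tau> (Src Z (k1 f g)) w)) =
     Comp (P0 R (Trg Z (k1 f' g'))) (K2 \<tau> (k1 f' g') (FObj (P1 H (k1 f g)) w)) (R.fa (k1 f' g') (K2 \<tau> (k1 f g) w))"
    using assms by simp
qed

text \<open>First of the four basic pairs. It holds by construction of \<open>K2\<close>;
  \<open>mult_VV\<close> and \<open>mult_LL\<close> are the composition axioms of
  \<open>o0 \<tau> x u\<close> and of \<tau>.\<close>

lemma mult_VL: 
  assumes "f \<in> C1 X" "g \<in> C1 Y" "Trg X f = x'" "Src Y g = y"
  shows "ZR.mult (K0 \<tau>) (K2 \<tau>) (V x' g) (L f y)"
proof -
  have v: "x' \<in> C0 X" "y \<in> C0 Y" using assms by auto
  show ?thesis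
    by (rule multI) (use assms v K2_fac(4)[OF assms(1) refl assms(3) assms(2,4) refl] in \<open>simp_all add: K2_V K2_L\<close>)
qed

lemma mult_VV: 
  assumes "x \<in> C0 X" "g \<in> C1 Y" "g' \<in> C1 Y" "Trg Y g = Src Y g'"
  shows "ZR.mult (K0 \<tau>) (K2 \<tau>) (V x g') (V x g)"
proof (rule multI)
  fix u v assume "u \<in> Obj (P0 F (Src X (Id1 X x)))" "v \<in> Obj (P0 G (Src Y g))"
  then show "Comp (P0 R (k0 (Trg X (Id1 X x)) (Trg Y g'))) (K2 \<tau> (k1 (Comp1 X (Id1 X x) (Id1 X x)) (Comp1 Y g' g)) (p0 u v))
       (R.ph (V x g') (V x g) (o0 (o0 \<tau> (Src X (Id1 X x)) u) (Src Y g) v)) =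
     Comp (P0 R (k0 (Trg X (Id1 X x)) (Trg Y g'))) (K2 \<tau> (V x g') (p0 (FObj (P1 F (Id1 X x)) u) (FObj (P1 G g) v)))
       (R.fa (V x g') (K2 \<tau> (V x g) (p0 u v)))"
    using sl_Comp1[of x "o0 \<tau> x u" g g' v] assms by (simp add: K2_V)
qed (use assms in simp_all)

lemma mult_LL:
  assumes "y \<in> C0 Y" "f \<in> C1 X" "f' \<in> C1 X" "Trg X f = Src X f'"
  shows "ZR.mult (K0 \<tau>) (K2 \<tau>) (L f' y) (L f y)"
proof (rule multI)
  fix u v assume "u \<in> Obj (P0 F (Src X f))" "v \<in> Obj (P0 G (Src Y (Id1 Y y)))"
  then show "Comp (P0 R (k0 (Trg X f') (Trg Y (Id1 Y y)))) (K2 \<tau> (k1 (Comp1 X f' f) (Comp1 Y (Id1 Y y) (Id1 Y y))) (p0 u v))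
       (R.ph (L f' y) (L f y) (o0 (o0 \<tau> (Src X f) u) (Src Y (Id1 Y y)) v)) =
     Comp (P0 R (k0 (Trg X f') (Trg Y (Id1 Y y)))) (K2 \<tau> (L f' y) (p0 (FObj (P1 F f) u) (FObj (P1 G (Id1 Y y)) v)))
       (R.fa (L f' y) (K2 \<tau> (L f y) (p0 u v)))"
    using th_Comp1[OF \<tau>, of f f' u y v] assms by (simp add: K2_L)
qed (use assms in simp_all)

text \<open>The basic pair in the opposite order. After precomposition with \<open>chi f g\<close>
  it turns into the factorization defining \<open>K2\<close>, and the difference is the law of the
  modification \<open>o2 \<tau> f u\<close> at \<open>g\<close>.\<close>

lemma mult_LV:
  assumes f: "f \<in> C1 X" "Src X f = x" and g: "g \<in> C1 Y" "Trg Y g = y'"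
  shows "ZR.mult (K0 \<tau>) (K2 \<tau>) (L f y') (V x g)"
proof -
  let ?x' = "Trg X f" and ?y = "Src Y g"
  let ?C = "P0 R (k0 ?x' y')"
  have v: "x \<in> C0 X" "y' \<in> C0 Y" using f g by auto
  note [simp] = f g v
  have "Comp ?C (K2 \<tau> (k1 f g) (p0 u v)) (R.ph (L f y') (V x g) (o0 (o0 \<tau> x u) ?y v)) =
     Comp ?C (md (o2 \<tau> f u) y' (FObj (P1 G g) v)) (R.fa (L f y') (o2 (o0 \<tau> x u) g v))"
    if uv: "u \<in> Obj (P0 F x)" "v \<in> Obj (P0 G ?y)" for u v
  proof -
    let ?s = "o0 (o0 \<tau> x u) ?y v" and ?K = "K2 \<tau> (k1 f g) (p0 u v)"
    note [simp] = uv
    note K = K2_fac[OF f refl g(1) refl g(2) uv]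
    have e: "Comp ?C (R.ph (L f y') (V x g) ?s) (chi f g ?s) = R.ph (V ?x' g) (L f ?y) ?s"
      by (rule ph_chi) simp_all
    have t: "?K \<in> Arr ?C" "Dom ?C ?K = R.fo (k1 f g) ?s" "Cod ?C ?K = o0 (o0 \<tau> ?x' (FObj (P1 F f) u)) y' (FObj (P1 G g) v)"
      using K(1,2,3) by simp_all
    note [simp] = t
    have i: "iso_arr ?C (chi f g ?s)" by simp
    show ?thesis
    proof (rule iso_epi[OF _ i])
      have "Comp ?C (Comp ?C ?K (R.ph (L f y') (V x g) ?s)) (chi f g ?s) = Comp ?C ?K (R.ph (V ?x' g) (L f ?y) ?s)"
        unfolding e[symmetric] by (simp add: Comp_assoc')
      also have "\<dots> = Comp ?C (o2 (o0 \<tau> ?x' (FObj (P1 F f) u)) g v) (R.fa (V ?x' g) (md (o2 \<tau> f u) ?y v))"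
        by (rule K(4))
      also have "\<dots> = Comp ?C (Comp ?C (md (o2 \<tau> f u) y' (FObj (P1 G g) v)) (R.fa (L f y') (o2 (o0 \<tau> x u) g v))) (chi f g ?s)"
        using sl_md_modif[of ?x' "o2 \<tau> f u" g v] by (simp add: Comp_assoc')
      finally show "Comp ?C (Comp ?C ?K (R.ph (L f y') (V x g) ?s)) (chi f g ?s) = \<dots>" .
    qed simp_all
  qed
  then show ?thesis
    by (intro multI) (simp_all add: K2_V K2_L)
qed

text \<open>From here the multiplicative pairs grow one factor at a time: \<open>k1 f g\<close> is
  written as \<open>V\<close> after \<open>L\<close>, and the triple is rebracketed.\<close>

lemma mult_V_any:
  assumes f: "f \<in> C1 X" "Trg X f = x'" and g: "g \<in> C1 Y" "g' \<in> C1 Y" "Trg Y g = Src Y g'"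
  shows "ZR.mult (K0 \<tau>) (K2 \<tau>) (V x' g') (k1 f g)"
proof -
  have v: "x' \<in> C0 X" using f by auto
  have "ZR.mult (K0 \<tau>) (K2 \<tau>) (V x' g') (Comp1 Z (V x' g) (L f (Src Y g)))"
    by (rule ZR.mult_right[OF K_typed]) (use f g v mult_VL mult_VV in simp_all)
  then show ?thesis using f g v by simp
qed

lemma mult_any_L:
  assumes f: "f \<in> C1 X" "f' \<in> C1 X" "Trg X f = Src X f'" and g: "g \<in> C1 Y" "Src Y g = y"
  shows "ZR.mult (K0 \<tau>) (K2 \<tau>) (k1 f' g) (L f y)"
proof -
  have v: "y \<in> C0 Y" using g by auto
  have "ZR.mult (K0 \<tau>) (K2 \<tau>) (Comp1 Z (V (Trg X f') g) (L f' y)) (L f y)"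
    by (rule ZR.mult_left[OF K_typed]) (use f g v mult_VL mult_LL in \<open>simp_all del: F.P1_Comp1\<close>)
  then show ?thesis using f g v by simp
qed

text \<open>The triple is \<open>L\<close>, \<open>V\<close>, \<open>L\<close>. Its first pair is
  \<open>mult_LV\<close>, and the composite \<open>k1 f' g\<close> formed by that pair meets the
  last factor in \<open>mult_any_L\<close>.\<close>

lemma mult_L_any:
  assumes f: "f \<in> C1 X" "f' \<in> C1 X" "Trg X f = Src X f'" and g: "g \<in> C1 Y" "Trg Y g = y'"
  shows "ZR.mult (K0 \<tau>) (K2 \<tau>) (L f' y') (k1 f g)"
proof -
  have v: "y' \<in> C0 Y" using g by auto
  have "ZR.mult (K0 \<tau>) (K2 \<tau>) (L f' y') (Comp1 Z (V (Src X f') g) (L f (Src Y g)))"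
    by (rule ZR.mult_right[OF K_typed]) (use f g v mult_VL mult_LV mult_any_L in simp_all)
  then show ?thesis using f g v by simp
qed

text \<open>With \<open>(f', g')\<close> split as \<open>V\<close> after \<open>L\<close>,
  \<open>mult_L_any\<close> handles the inner factor and \<open>mult_V_any\<close> the outer
  one.\<close>

lemma mult_any:
  assumes f: "f \<in> C1 X" "f' \<in> C1 X" "Trg X f = Src X f'" and g: "g \<in> C1 Y" "g' \<in> C1 Y" "Trg Y g = Src Y g'"
  shows "ZR.mult (K0 \<tau>) (K2 \<tau>) (k1 f' g') (k1 f g)"
proof -
  have "ZR.mult (K0 \<tau>) (K2 \<tau>) (Comp1 Z (V (Trg X f') g') (L f' (Src Y g'))) (k1 f g)"
    by (rule ZR.mult_left[OF K_typed]) (use f g mult_VL mult_L_any mult_V_any in simp_all)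
  then show ?thesis using f g by simp
qed

lemma nat1I:
  assumes "\<And>m n. \<lbrakk>m \<in> Arr (P0 F (Src X f)); n \<in> Arr (P0 G (Src Y g))\<rbrakk> \<Longrightarrow>
     Comp (P0 R (k0 (Trg X f) (Trg Y g))) (K2 \<tau> (k1 f g) (p0 (Cod (P0 F (Src X f)) m) (Cod (P0 G (Src Y g)) n)))
       (R.fa (k1 f g) (K1 \<tau> (k0 (Src X f) (Src Y g)) (p1 m n))) =
     Comp (P0 R (k0 (Trg X f) (Trg Y g))) (K1 \<tau> (k0 (Trg X f) (Trg Y g)) (p1 (FArr (P1 F f) m) (FArr (P1 G g) n)))
       (K2 \<tau> (k1 f g) (p0 (Dom (P0 F (Src X f)) m) (Dom (P0 G (Src Y g)) n)))"
    and "f \<in> C1 X" "g \<in> C1 Y"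
  shows "ZR.nat1 (K1 \<tau>) (K2 \<tau>) (k1 f g)"
  unfolding ZR.nat1_def
proof
  fix l assume l: "l \<in> Arr (P0 H (Src Z (k1 f g)))"
  then obtain m n where "m \<in> Arr (P0 F (Src X f))" "n \<in> Arr (P0 G (Src Y g))" "l = p1 m n"
    using p1_surj[of "Src X f" "Src Y g" l] assms by auto
  then show "Comp (P0 R (Trg Z (k1 f g))) (K2 \<tau> (k1 f g) (Cod (P0 H (Src Z (k1 f g))) l)) (R.fa (k1 f g) (K1 \<tau> (Src Z (k1 f g)) l)) =
     Comp (P0 R (Trg Z (k1 f g))) (K1 \<tau> (Trg Z (k1 f g)) (FArr (P1 H (k1 f g)) l)) (K2 \<tau> (k1 f g) (Dom (P0 H (Src Z (k1 f g))) l))"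
    using assms by (simp del: K_simps)
qed

text \<open>The two factors of \<open>K1\<close> are passed in turn:
  \<open>o2 (o0 \<tau> x u') g\<close> is natural in \<open>n\<close>, where \<open>u'\<close> is
  the codomain of \<open>m\<close>, and \<open>o1 \<tau> x m\<close> satisfies the modification law
  at \<open>g\<close>.\<close>

lemma nat1_V:
  assumes x: "x \<in> C0 X" and g: "g \<in> C1 Y"
  shows "ZR.nat1 (K1 \<tau>) (K2 \<tau>) (V x g)"
proof (rule nat1I)
  fix m n assume "m \<in> Arr (P0 F (Src X (Id1 X x)))" and n: "n \<in> Arr (P0 G (Src Y g))"
  then have m: "m \<in> Arr (P0 F x)" using x by simp
  note [simp] = x g m n
  let ?y = "Src Y g" and ?y' = "Trg Y g"
  let ?C = "P0 R (k0 x ?y')"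
  let ?u = "Dom (P0 F x) m" and ?u' = "Cod (P0 F x) m" and ?v = "Dom (P0 G ?y) n" and ?v' = "Cod (P0 G ?y) n"
  have "Comp ?C (o2 (o0 \<tau> x ?u') g ?v') (Comp ?C (R.fa (V x g) (o1 (o0 \<tau> x ?u') ?y n)) (R.fa (V x g) (md (o1 \<tau> x m) ?y ?v))) =
     Comp ?C (o1 (o0 \<tau> x ?u') ?y' (FArr (P1 G g) n)) (Comp ?C (o2 (o0 \<tau> x ?u') g ?v) (R.fa (V x g) (md (o1 \<tau> x m) ?y ?v)))"
    by (rule rew_left) (use sl_natural[of x "o0 \<tau> x ?u'" g n] in simp_all)
  also have "Comp ?C (o2 (o0 \<tau> x ?u') g ?v) (R.fa (V x g) (md (o1 \<tau> x m) ?y ?v)) =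
     Comp ?C (md (o1 \<tau> x m) ?y' (FObj (P1 G g) ?v)) (o2 (o0 \<tau> x ?u) g ?v)"
    using sl_md_modif[of x "o1 \<tau> x m" g ?v] by simp
  finally show "Comp (P0 R (k0 (Trg X (Id1 X x)) (Trg Y g))) (K2 \<tau> (V x g) (p0 (Cod (P0 F (Src X (Id1 X x))) m) (Cod (P0 G (Src Y g)) n)))
       (R.fa (V x g) (K1 \<tau> (k0 (Src X (Id1 X x)) (Src Y g)) (p1 m n))) =
     Comp (P0 R (k0 (Trg X (Id1 X x)) (Trg Y g))) (K1 \<tau> (k0 (Trg X (Id1 X x)) (Trg Y g)) (p1 (FArr (P1 F (Id1 X x)) m) (FArr (P1 G g) n)))
       (K2 \<tau> (V x g) (p0 (Dom (P0 F (Src X (Id1 X x))) m) (Dom (P0 G (Src Y g)) n)))"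
    by (simp add: K2_V Comp_assoc')
qed (use x g in simp_all)

text \<open>Again the factors are passed in turn: the modification \<open>o2 \<tau> f u'\<close> is
  natural in \<open>n\<close>, where \<open>u'\<close> is the codomain of \<open>m\<close>, and the
  components of \<tau> at \<open>f\<close> are natural in \<open>m\<close>.\<close>

lemma nat1_L:
  assumes f: "f \<in> C1 X" and y: "y \<in> C0 Y"
  shows "ZR.nat1 (K1 \<tau>) (K2 \<tau>) (L f y)"
proof (rule nat1I)
  fix m n assume m: "m \<in> Arr (P0 F (Src X f))" and "n \<in> Arr (P0 G (Src Y (Id1 Y y)))"
  then have n: "n \<in> Arr (P0 G y)" using y by simp
  note [simp] = f y m n
  let ?x = "Src X f" and ?x' = "Trg X f"
  let ?C = "P0 R (k0 ?x' y)"
  let ?u = "Dom (P0 F ?x) m" and ?u' = "Cod (P0 F ?x) m" and ?v = "Dom (P0 G y) n" and ?v' = "Cod (P0 G y) n"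
  have "Comp ?C (md (o2 \<tau> f ?u') y ?v') (Comp ?C (R.fa (L f y) (o1 (o0 \<tau> ?x ?u') y n)) (R.fa (L f y) (md (o1 \<tau> ?x m) y ?v))) =
     Comp ?C (o1 (o0 \<tau> ?x' (FObj (P1 F f) ?u')) y n) (Comp ?C (md (o2 \<tau> f ?u') y ?v) (R.fa (L f y) (md (o1 \<tau> ?x m) y ?v)))"
    by (rule rew_left) (use sl_md_natural[of ?x' "o2 \<tau> f ?u'" y n] in simp_all)
  also have "Comp ?C (md (o2 \<tau> f ?u') y ?v) (R.fa (L f y) (md (o1 \<tau> ?x m) y ?v)) =
     Comp ?C (md (o1 \<tau> ?x' (FArr (P1 F f) m)) y ?v) (md (o2 \<tau> f ?u) y ?v)"
    by (rule th_natural) simp_all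
  finally show "Comp (P0 R (k0 (Trg X f) (Trg Y (Id1 Y y)))) (K2 \<tau> (L f y) (p0 (Cod (P0 F (Src X f)) m) (Cod (P0 G (Src Y (Id1 Y y))) n)))
       (R.fa (L f y) (K1 \<tau> (k0 (Src X f) (Src Y (Id1 Y y))) (p1 m n))) =
     Comp (P0 R (k0 (Trg X f) (Trg Y (Id1 Y y)))) (K1 \<tau> (k0 (Trg X f) (Trg Y (Id1 Y y))) (p1 (FArr (P1 F f) m) (FArr (P1 G (Id1 Y y)) n)))
       (K2 \<tau> (L f y) (p0 (Dom (P0 F (Src X f)) m) (Dom (P0 G (Src Y (Id1 Y y))) n)))"
    by (simp add: K2_L Comp_assoc')
qed (use f y in simp_all)

lemma nat1_any:
  assumes f: "f \<in> C1 X" and g: "g \<in> C1 Y"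
  shows "ZR.nat1 (K1 \<tau>) (K2 \<tau>) (k1 f g)"
proof -
  have "ZR.nat1 (K1 \<tau>) (K2 \<tau>) (Comp1 Z (V (Trg X f) g) (L f (Src Y g)))"
    by (rule ZR.nat1_Comp1[OF K_typed]) (use f g mult_VL nat1_V nat1_L in simp_all)
  then show ?thesis using f g by simp
qed

lemma nat2I:
  assumes "\<And>u v. \<lbrakk>u \<in> Obj (P0 F (Src X (Dom2 X \<alpha>))); v \<in> Obj (P0 G (Src Y (Dom2 Y \<beta>)))\<rbrakk> \<Longrightarrow>
     Comp (P0 R (k0 (Trg X (Dom2 X \<alpha>)) (Trg Y (Dom2 Y \<beta>)))) (K2 \<tau> (k1 (Cod2 X \<alpha>) (Cod2 Y \<beta>)) (p0 u v))
       (R.fc (k2 \<alpha> \<beta>) (o0 (o0 \<tau> (Src X (Dom2 X \<alpha>)) u) (Src Y (Dom2 Y \<beta>)) v)) =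
     Comp (P0 R (k0 (Trg X (Dom2 X \<alpha>)) (Trg Y (Dom2 Y \<beta>))))
       (K1 \<tau> (k0 (Trg X (Dom2 X \<alpha>)) (Trg Y (Dom2 Y \<beta>))) (p1 (NMap (P2 F \<alpha>) u) (NMap (P2 G \<beta>) v)))
       (K2 \<tau> (k1 (Dom2 X \<alpha>) (Dom2 Y \<beta>)) (p0 u v))"
    and "\<alpha> \<in> C2 X" "\<beta> \<in> C2 Y"
  shows "ZR.nat2 (K0 \<tau>) (K1 \<tau>) (K2 \<tau>) (k2 \<alpha> \<beta>)"
  unfolding ZR.nat2_def
proof
  fix w assume w: "w \<in> Obj (P0 H (Src Z (Dom2 Z (k2 \<alpha> \<beta>))))"
  then obtain u v where "u \<in> Obj (P0 F (Src X (Dom2 X \<alpha>)))" "v \<in> Obj (P0 G (Src Y (Dom2 Y \<beta>)))" "w = p0 u v"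
    using p0_surj[of "Src X (Dom2 X \<alpha>)" "Src Y (Dom2 Y \<beta>)" w] assms by auto
  then show "Comp (P0 R (Trg Z (Dom2 Z (k2 \<alpha> \<beta>)))) (K2 \<tau> (Cod2 Z (k2 \<alpha> \<beta>)) w) (R.fc (k2 \<alpha> \<beta>) (K0 \<tau> (Src Z (Dom2 Z (k2 \<alpha> \<beta>))) w)) =
     Comp (P0 R (Trg Z (Dom2 Z (k2 \<alpha> \<beta>)))) (K1 \<tau> (Trg Z (Dom2 Z (k2 \<alpha> \<beta>))) (NMap (P2 H (k2 \<alpha> \<beta>)) w)) (K2 \<tau> (Dom2 Z (k2 \<alpha> \<beta>)) w)"
    using assms by (simp del: K_simps(2))
qed

lemma nat2_V:
  assumes x: "x \<in> C0 X" and \<beta>: "\<beta> \<in> C2 Y"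
  shows "ZR.nat2 (K0 \<tau>) (K1 \<tau>) (K2 \<tau>) (k2 (Id2 X (Id1 X x)) \<beta>)"
  by (rule nat2I) (use x \<beta> sl_natural2[of x] in \<open>simp_all add: K2_V\<close>)

lemma nat2_L:
  assumes y: "y \<in> C0 Y" and \<alpha>: "\<alpha> \<in> C2 X"
  shows "ZR.nat2 (K0 \<tau>) (K1 \<tau>) (K2 \<tau>) (k2 \<alpha> (Id2 Y (Id1 Y y)))"
  by (rule nat2I) (use y \<alpha> th_natural2[OF \<tau> \<alpha>] in \<open>simp_all add: K2_L\<close>)

text \<open>\<open>(\<alpha>, \<beta>)\<close> is the horizontal composite of
  \<open>(1, \<beta>)\<close> with \<open>(\<alpha>, 1)\<close>; naturality at these two is the
  2-cell axiom of the inner and of the outer transformation.\<close>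

lemma nat2_any:
  assumes \<alpha>: "\<alpha> \<in> C2 X" and \<beta>: "\<beta> \<in> C2 Y"
  shows "ZR.nat2 (K0 \<tau>) (K1 \<tau>) (K2 \<tau>) (k2 \<alpha> \<beta>)"
proof -
  let ?x = "Src X (Dom2 X \<alpha>)" and ?x' = "Trg X (Dom2 X \<alpha>)" and ?y = "Src Y (Dom2 Y \<beta>)"
  have c: "HComp Z (k2 (Id2 X (Id1 X ?x')) \<beta>) (k2 \<alpha> (Id2 Y (Id1 Y ?y))) = k2 \<alpha> \<beta>"
    using \<alpha> \<beta> by simp
  have "ZR.nat2 (K0 \<tau>) (K1 \<tau>) (K2 \<tau>) (HComp Z (k2 (Id2 X (Id1 X ?x')) \<beta>) (k2 \<alpha> (Id2 Y (Id1 Y ?y))))"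
  proof (rule ZR.nat2_HComp[OF K_typed], goal_cases)
    case (9 w)
    then obtain u v where "u \<in> Obj (P0 F ?x)" "v \<in> Obj (P0 G ?y)" "w = p0 u v"
      using p0_surj[of ?x ?y w] \<alpha> \<beta> by auto
    then show ?case using \<alpha> \<beta> unfolding c by (simp add: Comp_p1)
  qed (use \<alpha> \<beta> mult_VL nat1_V nat2_V nat2_L in simp_all)
  then show ?thesis unfolding c .
qed

lemma K_data: "psdata Z H R (K0 \<tau>) (K1 \<tau>) (K2 \<tau>)"
proof (intro psdata.intro psdata_axioms.intro K_typed, goal_cases)
  case (1 h l)
  obtain f g where f: "f \<in> C1 X" "g \<in> C1 Y" "h = k1 f g" using k1_surj[OF 1(1)] by blast
  show ?case unfolding f(3)
    by (rule ZR.nat1D[OF nat1_any[OF f(1,2)] 1(2)[unfolded f(3)] refl refl])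
next
  case (2 \<gamma> w)
  obtain \<alpha> \<beta> where f: "\<alpha> \<in> C2 X" "\<beta> \<in> C2 Y" "\<gamma> = k2 \<alpha> \<beta>" using k2_surj[OF 2(1)] by blast
  show ?case unfolding f(3)
    by (rule ZR.nat2D[OF nat2_any[OF f(1,2)] 2(2)[unfolded f(3)] refl refl])
next
  case (3 h h' w)
  obtain f g where f: "f \<in> C1 X" "g \<in> C1 Y" "h = k1 f g" using k1_surj[OF 3(1)] by blast
  obtain f' g' where f': "f' \<in> C1 X" "g' \<in> C1 Y" "h' = k1 f' g'" using k1_surj[OF 3(2)] by blast
  have "(Trg X f, Trg Y g) = (Src X f', Src Y g')"
    using 3(3) f f' injD[OF k0_inj, of "(Trg X f, Trg Y g)" "(Src X f', Src Y g')"] by simp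
  then show ?case unfolding f(3) f'(3)
    by (intro ZR.multD[OF mult_any 3(4)[unfolded f(3)] refl]) (use f f' in simp_all)
next
  case (4 z w)
  then show ?case
  proof (elim pz_cases)
    fix x y u v assume a: "x \<in> C0 X" "y \<in> C0 Y" "u \<in> Obj (P0 F x)" "v \<in> Obj (P0 G y)" "z = k0 x y" "w = p0 u v"
    \<comment> \<open>The identity of \<open>k0 x y\<close> is \<open>V x (Id1 Y y)\<close>, so by
      \<open>K2_V\<close> the unit axiom is that of the inner transformation.\<close>
    then show ?thesis using sl_Id1[of x "o0 \<tau> x u" y v] K2_V[of x u "Id1 Y y" v] by simp
  qed
qed

end

end

section \<open>From joint to iterated transformations\<close>

context curry_iso
begin

definition inner where
  "inner \<sigma> x u = mkpt Y G (slice x) (\<lambda>y v. o0 \<sigma> (k0 x y) (p0 u v)) (\<lambda>y n. o1 \<sigma> (k0 x y) (p1 (Idn (P0 F x) u) n))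
     (\<lambda>g v. o2 \<sigma> (V x g) (p0 u v))"

definition innerm where
  "innerm \<sigma> x m = mkmd Y G (inner \<sigma> x (Dom (P0 F x) m)) (inner \<sigma> x (Cod (P0 F x) m))
     (\<lambda>y v. o1 \<sigma> (k0 x y) (p1 m (Idn (P0 G y) v)))"

definition innert where
  "innert \<sigma> f u = mkmd Y G (post f (inner \<sigma> (Src X f) u)) (inner \<sigma> (Trg X f) (FObj (P1 F f) u))
     (\<lambda>y v. o2 \<sigma> (L f y) (p0 u v))"

definition J0 where
  "J0 \<sigma> = mkpt X F TB (inner \<sigma>) (innerm \<sigma>) (innert \<sigma>)"

definition innerJ where
  "innerJ \<Gamma> x u = mkmd Y G (inner (MDom \<Gamma>) x u) (inner (MCod \<Gamma>) x u) (\<lambda>y v. md \<Gamma> (k0 x y) (p0 u v))"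

definition J1 where
  "J1 \<Gamma> = mkmd X F (J0 (MDom \<Gamma>)) (J0 (MCod \<Gamma>)) (innerJ \<Gamma>)"

lemma inner_simps [simp]:
  "\<lbrakk>y \<in> C0 Y; v \<in> Obj (P0 G y)\<rbrakk> \<Longrightarrow> o0 (inner \<sigma> x u) y v = o0 \<sigma> (k0 x y) (p0 u v)"
  "\<lbrakk>y \<in> C0 Y; n \<in> Arr (P0 G y)\<rbrakk> \<Longrightarrow> o1 (inner \<sigma> x u) y n = o1 \<sigma> (k0 x y) (p1 (Idn (P0 F x) u) n)"
  "\<lbrakk>g \<in> C1 Y; v \<in> Obj (P0 G (Src Y g))\<rbrakk> \<Longrightarrow> o2 (inner \<sigma> x u) g v = o2 \<sigma> (V x g) (p0 u v)"
  "MDom (innerm \<sigma> x m) = inner \<sigma> x (Dom (P0 F x) m)" "MCod (innerm \<sigma> x m) = inner \<sigma> x (Cod (P0 F x) m)"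
  "\<lbrakk>y \<in> C0 Y; v \<in> Obj (P0 G y)\<rbrakk> \<Longrightarrow> md (innerm \<sigma> x m) y v = o1 \<sigma> (k0 x y) (p1 m (Idn (P0 G y) v))"
  "MDom (innert \<sigma> f u) = post f (inner \<sigma> (Src X f) u)" "MCod (innert \<sigma> f u) = inner \<sigma> (Trg X f) (FObj (P1 F f) u)"
  "\<lbrakk>y \<in> C0 Y; v \<in> Obj (P0 G y)\<rbrakk> \<Longrightarrow> md (innert \<sigma> f u) y v = o2 \<sigma> (L f y) (p0 u v)"
  "MDom (innerJ \<Gamma> x u) = inner (MDom \<Gamma>) x u" "MCod (innerJ \<Gamma> x u) = inner (MCod \<Gamma>) x u"
  "\<lbrakk>y \<in> C0 Y; v \<in> Obj (P0 G y)\<rbrakk> \<Longrightarrow> md (innerJ \<Gamma> x u) y v = md \<Gamma> (k0 x y) (p0 u v)"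
  by (simp_all add: inner_def innerm_def innert_def innerJ_def)

lemma J_simps [simp]:
  "\<lbrakk>x \<in> C0 X; u \<in> Obj (P0 F x)\<rbrakk> \<Longrightarrow> o0 (J0 \<sigma>) x u = inner \<sigma> x u"
  "\<lbrakk>x \<in> C0 X; m \<in> Arr (P0 F x)\<rbrakk> \<Longrightarrow> o1 (J0 \<sigma>) x m = innerm \<sigma> x m"
  "\<lbrakk>f \<in> C1 X; u \<in> Obj (P0 F (Src X f))\<rbrakk> \<Longrightarrow> o2 (J0 \<sigma>) f u = innert \<sigma> f u"
  "MDom (J1 \<Gamma>) = J0 (MDom \<Gamma>)" "MCod (J1 \<Gamma>) = J0 (MCod \<Gamma>)"
  "\<lbrakk>x \<in> C0 X; u \<in> Obj (P0 F x)\<rbrakk> \<Longrightarrow> md (J1 \<Gamma>) x u = innerJ \<Gamma> x u"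
  by (simp_all add: J0_def J1_def)

context
  fixes \<sigma> assumes \<sigma> [simp]: "pseudonatural Z H R \<sigma>"
begin

lemma o1_p1_Idn [simp]:
  "\<lbrakk>x \<in> C0 X; y \<in> C0 Y; u \<in> Obj (P0 F x); v \<in> Obj (P0 G y)\<rbrakk>
    \<Longrightarrow> o1 \<sigma> (k0 x y) (p1 (Idn (P0 F x) u) (Idn (P0 G y) v)) = Idn (P0 R (k0 x y)) (o0 \<sigma> (k0 x y) (p0 u v))"
  by (simp flip: Idn_p0)

lemma o1_p1_Comp:
  assumes "x \<in> C0 X" "y \<in> C0 Y" "m \<in> Arr (P0 F x)" "n \<in> Arr (P0 G y)" "m' \<in> Arr (P0 F x)" "n' \<in> Arr (P0 G y)"
        "Cod (P0 F x) m = Dom (P0 F x) m'" "Cod (P0 G y) n = Dom (P0 G y) n'"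
  shows "Comp (P0 R (k0 x y)) (o1 \<sigma> (k0 x y) (p1 m' n')) (o1 \<sigma> (k0 x y) (p1 m n)) =
    o1 \<sigma> (k0 x y) (p1 (Comp (P0 F x) m' m) (Comp (P0 G y) n' n))"
  using assms ZR.o_simps(6)[OF \<sigma>, of "k0 x y" "p1 m n" "p1 m' n'"] by (simp add: Comp_p1)

lemma inner_pn [simp]:
  assumes x: "x \<in> C0 X" "u \<in> Obj (P0 F x)"
  shows "pseudonatural Y G (slice x) (inner \<sigma> x u)"
  unfolding inner_def
proof (rule ps.pseudonatural_mkpt[OF ps_slice[OF x(1)]], rule psdataI, unfold slice_simps, goal_cases)
  case (10 g n)
  then show ?case using x ZR.o2_natural[OF \<sigma>, of "V x g" "p1 (Idn (P0 F x) u) n"] by simp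
next
  case (11 \<beta> v)
  then show ?case using x ZR.o2_natural2[OF \<sigma>, of "k2 (Id2 X (Id1 X x)) \<beta>" "p0 u v"] by simp
next
  case (12 g g' v)
  then show ?case using x ZR.o2_Comp1[OF \<sigma>, of "V x g" "V x g'" "p0 u v"] by simp
next
  case (13 y v)
  then show ?case using x ZR.o2_Id1[OF \<sigma>, of "k0 x y" "p0 u v"] by simp
qed (use x in \<open>auto simp: o1_p1_Comp\<close>)

text \<open>Naturality holds because \<open>(m, 1)\<close> and \<open>(1, n)\<close> commute under
  the functor \<open>T0 \<sigma> (k0 x y)\<close>; the modification law is naturality of \<sigma> at
  \<open>V x g\<close> for the arrow \<open>(m, 1)\<close>.\<close>

lemma innerm_mod [simp]:
  assumes x: "x \<in> C0 X" "m \<in> Arr (P0 F x)"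
  shows "modification Y G (slice x) (innerm \<sigma> x m)"
  unfolding innerm_def
proof (rule ps.modification_mkmd[OF ps_slice[OF x(1)]], goal_cases)
  case 3 show ?case
  proof (rule mdata.intro, unfold slice_simps, goal_cases)
    case (4 y n)
    then show ?case using x by (simp add: o1_p1_Comp)
  next
    case (5 g v)
    then show ?case using x ZR.o2_natural[OF \<sigma>, of "V x g" "p1 m (Idn (P0 G (Src Y g)) v)"] by simp
  qed (use x in simp_all)
qed (use x in simp_all)

text \<open>Both sides of the law at \<open>g\<close> compute \<sigma> at \<open>(f, g)\<close>,
  through \<open>(1, g) o (f, 1)\<close> and through \<open>(f, 1) o (1, g)\<close>. The two
  comparison cells differ by \<open>chi f g\<close>, which is the exchange built into
  \<open>post\<close>.\<close>

lemma innert_mod [simp]: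
  assumes f: "f \<in> C1 X" "u \<in> Obj (P0 F (Src X f))" "Trg X f = x'"
  shows "modification Y G (slice x') (innert \<sigma> f u)"
proof -
  have v: "x' \<in> C0 X" "Src X f \<in> C0 X" using f by auto
  note [simp] = f v
  show ?thesis
    unfolding innert_def f(3)
  proof (rule ps.modification_mkmd[OF ps_slice[OF v(1)]], goal_cases)
    case 3 show ?case
    proof (rule mdata.intro, unfold slice_simps, goal_cases)
      case (4 y n)
      then show ?case using ZR.o2_natural[OF \<sigma>, of "L f y" "p1 (Idn (P0 F (Src X f)) u) n"] by simp
    next
      case (5 g v)
      let ?x = "Src X f" and ?y = "Src Y g" and ?y' = "Trg Y g"
      let ?C = "P0 R (k0 x' ?y')" and ?s = "o0 \<sigma> (k0 ?x ?y) (p0 u v)"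
      note [simp] = 5
      have e: "Comp ?C (R.ph (L f ?y') (V ?x g) ?s) (chi f g ?s) = R.ph (V x' g) (L f ?y) ?s"
        by (rule ph_chi) simp_all
      have "Comp ?C (o2 \<sigma> (V x' g) (p0 (FObj (P1 F f) u) v)) (R.fa (V x' g) (o2 \<sigma> (L f ?y) (p0 u v))) =
         Comp ?C (o2 \<sigma> (k1 f g) (p0 u v)) (R.ph (V x' g) (L f ?y) ?s)"
        using ZR.o2_Comp1[OF \<sigma>, of "L f ?y" "V x' g" "p0 u v"] by simp
      also have "\<dots> = Comp ?C (Comp ?C (o2 \<sigma> (k1 f g) (p0 u v)) (R.ph (L f ?y') (V ?x g) ?s)) (chi f g ?s)"
        unfolding e[symmetric] by (simp add: Comp_assoc')
      also have "Comp ?C (o2 \<sigma> (k1 f g) (p0 u v)) (R.ph (L f ?y') (V ?x g) ?s) =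
         Comp ?C (o2 \<sigma> (L f ?y') (p0 u (FObj (P1 G g) v))) (R.fa (L f ?y') (o2 \<sigma> (V ?x g) (p0 u v)))"
        using ZR.o2_Comp1[OF \<sigma>, of "V ?x g" "L f ?y'" "p0 u v"] by simp
      finally show ?case by (simp add: Comp_assoc')
    qed simp_all
  qed simp_all
qed

text \<open>The components of the axioms at \<open>y\<close> and \<open>v\<close> are the axioms of
  \<sigma> along cells that are identities in the \<open>Y\<close> direction.\<close>

lemma J0_pn: "pseudonatural X F TB (J0 \<sigma>)"
  unfolding J0_def
proof (rule ps.pseudonatural_mkpt[OF ps_TB], rule psdataI, unfold TB_simps(1) PS_hom_simps, goal_cases)
  case (5 x u)
  note v = 5(1)
  show ?case by (rule slice_modif_eqI[OF v]) (use 5 sl_md_Idn[OF v] in simp_all)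
next
  case (6 x m n)
  note v = 6(1)
  show ?case by (rule slice_modif_eqI[OF v]) (use 6 sl_md_Comp[OF v] in \<open>simp_all add: o1_p1_Comp\<close>)
next
  case (7 f u x')
  have v: "x' \<in> C0 X" using 7 by auto
  show ?case by (rule slice_iso_I[OF v]) (use 7 v in simp_all)
next
  case (8 f u x')
  then show ?case by simp
next
  case (10 f m)
  have v: "Trg X f \<in> C0 X" "Src X f \<in> C0 X" using 10 by simp_all
  have n: "Comp (P0 R (k0 (Trg X f) y)) (o2 \<sigma> (L f y) (p0 (Cod (P0 F (Src X f)) m) v))
       (R.fa (L f y) (o1 \<sigma> (k0 (Src X f) y) (p1 m (Idn (P0 G y) v)))) =
     Comp (P0 R (k0 (Trg X f) y)) (o1 \<sigma> (k0 (Trg X f) y) (p1 (FArr (P1 F f) m) (Idn (P0 G y) v)))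
       (o2 \<sigma> (L f y) (p0 (Dom (P0 F (Src X f)) m) v))" if "y \<in> C0 Y" "v \<in> Obj (P0 G y)" for y v
    using ZR.o2_natural[OF \<sigma>, of "L f y" "p1 m (Idn (P0 G y) v)"] 10 that by simp
  show ?case by (rule slice_modif_eqI[OF v(1)]) (use 10 v sl_md_Comp[OF v(1)] in \<open>simp_all add: n\<close>)
next
  case (11 \<alpha> u)
  let ?x = "Src X (Dom2 X \<alpha>)" and ?x' = "Trg X (Dom2 X \<alpha>)"
  have v: "?x' \<in> C0 X" "?x \<in> C0 X" using 11 by simp_all
  have n: "Comp (P0 R (k0 ?x' y)) (o2 \<sigma> (L (Cod2 X \<alpha>) y) (p0 u v)) (R.fc (k2 \<alpha> (Id2 Y (Id1 Y y))) (o0 \<sigma> (k0 ?x y) (p0 u v))) =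
     Comp (P0 R (k0 ?x' y)) (o1 \<sigma> (k0 ?x' y) (p1 (NMap (P2 F \<alpha>) u) (Idn (P0 G y) v))) (o2 \<sigma> (L (Dom2 X \<alpha>) y) (p0 u v))"
    if "y \<in> C0 Y" "v \<in> Obj (P0 G y)" for y v
    using ZR.o2_natural2[OF \<sigma>, of "k2 \<alpha> (Id2 Y (Id1 Y y))" "p0 u v"] 11 that by simp
  show ?case by (rule slice_modif_eqI[OF v(1)]) (use 11 v sl_md_Comp[OF v(1)] in \<open>simp_all add: n\<close>)
next
  case (12 f f' u)
  have v: "Trg X f' \<in> C0 X" "Src X f' \<in> C0 X" "Src X f \<in> C0 X" using 12 by simp_all
  have n: "Comp (P0 R (k0 (Trg X f') y)) (o2 \<sigma> (L (Comp1 X f' f) y) (p0 u v)) (R.ph (L f' y) (L f y) (o0 \<sigma> (k0 (Src X f) y) (p0 u v))) =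
     Comp (P0 R (k0 (Trg X f') y)) (o2 \<sigma> (L f' y) (p0 (FObj (P1 F f) u) v)) (R.fa (L f' y) (o2 \<sigma> (L f y) (p0 u v)))"
    if "y \<in> C0 Y" "v \<in> Obj (P0 G y)" for y v
    using ZR.o2_Comp1[OF \<sigma>, of "L f y" "L f' y" "p0 u v"] 12 that by simp
  show ?case by (rule slice_modif_eqI[OF v(1)]) (use 12 v sl_md_Comp[OF v(1)] in \<open>simp_all add: n\<close>)
next
  case (13 x u)
  note v = 13(1)
  have n: "Comp (P0 R (k0 x y)) (o2 \<sigma> (Id1 Z (k0 x y)) (p0 u v)) (R.un (k0 x y) (o0 \<sigma> (k0 x y) (p0 u v))) =
     Idn (P0 R (k0 x y)) (o0 \<sigma> (k0 x y) (p0 u v))"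
    if "y \<in> C0 Y" "v \<in> Obj (P0 G y)" for y v
    using ZR.o2_Id1[OF \<sigma>, of "k0 x y" "p0 u v"] 13 that by simp
  show ?case by (rule slice_modif_eqI[OF v(1)]) (use 13 v sl_md_Comp[OF v] sl_md_Idn[OF v] in \<open>simp_all add: n\<close>)
qed simp_all

end

lemma innerJ_mod [simp]:
  assumes \<Gamma>: "modification Z H R \<Gamma>" and x: "x \<in> C0 X" "u \<in> Obj (P0 F x)"
  shows "modification Y G (slice x) (innerJ \<Gamma> x u)"
proof -
  note [simp] = \<Gamma> x
  show ?thesis
    unfolding innerJ_def
  proof (rule ps.modification_mkmd[OF ps_slice[OF x(1)]], goal_cases)
    case 3 show ?case
    proof (rule mdata.intro, unfold slice_simps, goal_cases)
      case (4 y n)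
      then show ?case using ZR.md_natural[OF \<Gamma>, of "k0 x y" "p1 (Idn (P0 F x) u) n"] by simp
    next
      case (5 g v)
      then show ?case using ZR.md_modif[OF \<Gamma>, of "V x g" "p0 u v"] by simp
    qed simp_all
  qed simp_all
qed

text \<open>The laws of \<Gamma> along \<open>V\<close> were used for \<open>innerJ_mod\<close>;
  those along \<open>L\<close> give the outer modification.\<close>

lemma J1_mod:
  assumes \<Gamma>: "modification Z H R \<Gamma>"
  shows "modification X F TB (J1 \<Gamma>)"
proof -
  note [simp] = \<Gamma>
  show ?thesis
    unfolding J1_def
  proof (rule ps.modification_mkmd[OF ps_TB], goal_cases)
    case 3 show ?case
    proof (rule mdata.intro, unfold TB_simps(1) PS_hom_simps, goal_cases)
      case (4 x m)
      note v = 4(1)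
      have n: "Comp (P0 R (k0 x y)) (md \<Gamma> (k0 x y) (p0 (Cod (P0 F x) m) v)) (o1 (MDom \<Gamma>) (k0 x y) (p1 m (Idn (P0 G y) v))) =
         Comp (P0 R (k0 x y)) (o1 (MCod \<Gamma>) (k0 x y) (p1 m (Idn (P0 G y) v))) (md \<Gamma> (k0 x y) (p0 (Dom (P0 F x) m) v))"
        if "y \<in> C0 Y" "v \<in> Obj (P0 G y)" for y v
        using ZR.md_natural[OF \<Gamma>, of "k0 x y" "p1 m (Idn (P0 G y) v)"] 4 that by simp
      show ?case by (rule slice_modif_eqI[OF v]) (use 4 sl_md_Comp[OF v] in \<open>simp_all add: n\<close>)
    next
      case (5 f u)
      have v: "Trg X f \<in> C0 X" "Src X f \<in> C0 X" using 5 by simp_all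
      have n: "Comp (P0 R (k0 (Trg X f) y)) (o2 (MCod \<Gamma>) (L f y) (p0 u v)) (R.fa (L f y) (md \<Gamma> (k0 (Src X f) y) (p0 u v))) =
         Comp (P0 R (k0 (Trg X f) y)) (md \<Gamma> (k0 (Trg X f) y) (p0 (FObj (P1 F f) u) v)) (o2 (MDom \<Gamma>) (L f y) (p0 u v))"
        if "y \<in> C0 Y" "v \<in> Obj (P0 G y)" for y v
        using ZR.md_modif[OF \<Gamma>, of "L f y" "p0 u v"] 5 that by simp
      show ?case by (rule slice_modif_eqI[OF v(1)]) (use 5 v sl_md_Comp[OF v(1)] in \<open>simp_all add: n\<close>)
    qed simp_all
  qed (simp_all add: J0_pn)
qed

section \<open>The currying functor and its inverse\<close>

definition J where
  "J = \<lparr>FDom = PS_hom Z H R, FCod = PS_hom X F TB, FObj = (\<lambda>\<sigma>\<in>Obj (PS_hom Z H R). J0 \<sigma>),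
     FArr = (\<lambda>\<Gamma>\<in>Arr (PS_hom Z H R). J1 \<Gamma>)\<rparr>"

lemma J_fields [simp]: "FDom J = PS_hom Z H R" "FCod J = PS_hom X F TB"
  "pseudonatural Z H R \<sigma> \<Longrightarrow> FObj J \<sigma> = J0 \<sigma>" "modification Z H R \<Gamma> \<Longrightarrow> FArr J \<Gamma> = J1 \<Gamma>"
  by (simp_all add: J_def)

lemmas TB_modif_eqI = ps.modif_eqI[OF ps_TB]

lemma J_functor: "is_functor J"
proof (rule is_functor.intro, goal_cases)
  case 2 show ?case using ps.category_PS_hom[OF ps_TB] by simp
next
  case (9 \<sigma>)
  then have \<sigma> [simp]: "pseudonatural Z H R \<sigma>" by simp
  have i [simp]: "modification Z H R (Idn (PS_hom Z H R) \<sigma>)" by (rule ZR.modification_Idn) simp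
  have "J1 (Idn (PS_hom Z H R) \<sigma>) = Idn (PS_hom X F TB) (J0 \<sigma>)"
  proof (rule TB_modif_eqI, goal_cases)
    case (5 x u)
    have "innerJ (Idn (PS_hom Z H R) \<sigma>) x u = Idn (PS_hom Y G (slice x)) (inner \<sigma> x u)"
      by (rule slice_modif_eqI[OF 5(1)]) (use 5 sl_md_Idn[OF 5(1)] in simp_all)
    then show ?case using 5 ps.md_Idn[OF ps_TB J0_pn[OF \<sigma>] 5] by simp
  qed (simp_all add: J1_mod J0_pn ps.modification_Idn[OF ps_TB])
  then show ?case by simp
next
  case (10 \<Gamma> \<Delta>)
  then have [simp]: "modification Z H R \<Gamma>" "modification Z H R \<Delta>" "MCod \<Gamma> = MDom \<Delta>" by simp_all
  have i [simp]: "modification Z H R (Comp (PS_hom Z H R) \<Delta> \<Gamma>)" by (rule ZR.modification_Comp) simp_all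
  have "J1 (Comp (PS_hom Z H R) \<Delta> \<Gamma>) = Comp (PS_hom X F TB) (J1 \<Delta>) (J1 \<Gamma>)"
  proof (rule TB_modif_eqI, goal_cases)
    case (5 x u)
    have "innerJ (Comp (PS_hom Z H R) \<Delta> \<Gamma>) x u = Comp (PS_hom Y G (slice x)) (innerJ \<Delta> x u) (innerJ \<Gamma> x u)"
      by (rule slice_modif_eqI[OF 5(1)]) (use 5 sl_md_Comp[OF 5(1)] in simp_all)
    then show ?case using 5 ps.md_Comp[OF ps_TB J1_mod J1_mod _ 5] by simp
  qed (simp_all add: J1_mod J0_pn ps.modification_Comp[OF ps_TB])
  then show ?case by simp
qed (simp_all add: J0_pn J1_mod, simp_all add: J_def)

definition J0' where
  "J0' \<tau> = mkpt Z H R (K0 \<tau>) (K1 \<tau>) (K2 \<tau>)"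

lemma J0'_simps [simp]:
  "\<lbrakk>z \<in> C0 Z; w \<in> Obj (P0 H z)\<rbrakk> \<Longrightarrow> o0 (J0' \<tau>) z w = K0 \<tau> z w"
  "\<lbrakk>z \<in> C0 Z; l \<in> Arr (P0 H z)\<rbrakk> \<Longrightarrow> o1 (J0' \<tau>) z l = K1 \<tau> z l"
  "\<lbrakk>h \<in> C1 Z; w \<in> Obj (P0 H (Src Z h))\<rbrakk> \<Longrightarrow> o2 (J0' \<tau>) h w = K2 \<tau> h w"
  by (simp_all add: J0'_def)

lemma J0'_pn [simp]: "pseudonatural X F TB \<tau> \<Longrightarrow> pseudonatural Z H R (J0' \<tau>)"
  unfolding J0'_def by (rule ZR.pseudonatural_mkpt) (rule K_data)

text \<open>On arrows this is functoriality at \<open>(1, n) o (m, 1)\<close>. On 1-cells both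
  transformations agree after composition with the comparison cell of \<open>V\<close> and
  \<open>L\<close>, one by \<open>K2_fac\<close>, the other by the composition axiom of
  \<sigma>.\<close>

lemma J0'_J0:
  assumes \<sigma> [simp]: "pseudonatural Z H R \<sigma>"
  shows "J0' (J0 \<sigma>) = \<sigma>"
proof (rule ZR.ptrans_eqI, goal_cases)
  case 1 show ?case by (simp add: J0_pn)
next
  case (3 z w)
  show ?case by (rule pz_cases[OF 3]) simp
next
  case (4 z l)
  show ?case by (rule pm_cases[OF 4]) (simp add: o1_p1_Comp)
next
  case (5 h w)
  show ?case
  proof (rule pf_cases[OF 5])
    fix f g u v assume f: "f \<in> C1 X" "g \<in> C1 Y" "u \<in> Obj (P0 F (Src X f))" "v \<in> Obj (P0 G (Src Y g))"
      and [simp]: "h = k1 f g" "w = p0 u v"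
    note [simp] = f
    let ?C = "P0 R (k0 (Trg X f) (Trg Y g))" and ?s = "o0 \<sigma> (k0 (Src X f) (Src Y g)) (p0 u v)"
    let ?h = "R.ph (V (Trg X f) g) (L f (Src Y g)) ?s"
    note K = K2_fac[OF J0_pn[OF \<sigma>] f(1) refl refl f(2) refl refl f(3,4)]
    have "K2 (J0 \<sigma>) (k1 f g) (p0 u v) = o2 \<sigma> (k1 f g) (p0 u v)"
    proof (rule iso_epi[of ?C ?h])
      show "Comp ?C (K2 (J0 \<sigma>) (k1 f g) (p0 u v)) ?h = Comp ?C (o2 \<sigma> (k1 f g) (p0 u v)) ?h"
        using K(4) ZR.o2_Comp1[OF \<sigma>, of "L f (Src Y g)" "V (Trg X f) g" "p0 u v"] by simp
    qed (use K(1,2) in simp_all)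
    then show ?case by simp
  qed
qed simp

lemma inner_J0':
  assumes "pseudonatural X F TB \<tau>" "x \<in> C0 X" "u \<in> Obj (P0 F x)"
  shows "inner (J0' \<tau>) x u = o0 \<tau> x u"
  by (rule ps.ptrans_eqI[OF ps_slice[OF assms(2)]]) (use assms in \<open>simp_all add: K2_V\<close>)

text \<open>The values on the factors survive the passage through \<open>K2\<close>:
  \<open>K2_V\<close> recovers the inner transformations and \<open>K2_L\<close> the outer
  components.\<close>

lemma J0_J0':
  assumes \<tau> [simp]: "pseudonatural X F TB \<tau>"
  shows "J0 (J0' \<tau>) = \<tau>"
proof (rule ps.ptrans_eqI[OF ps_TB], goal_cases)
  case 1 show ?case by (simp add: J0_pn)
next
  case 2 show ?case by simp
next
  case (3 x u)
  then show ?case by (simp add: inner_J0')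
next
  case (4 x m)
  have "innerm (J0' \<tau>) x m = o1 \<tau> x m"
    by (rule slice_modif_eqI[OF 4(1)]) (use 4 in \<open>simp_all add: inner_J0'\<close>)
  then show ?case using 4 by simp
next
  case (5 f u)
  have v: "Src X f \<in> C0 X" "Trg X f \<in> C0 X" using 5 by simp_all
  have "innert (J0' \<tau>) f u = o2 \<tau> f u"
    by (rule slice_modif_eqI[OF v(2)]) (use 5 v in \<open>simp_all add: inner_J0' K2_L\<close>)
  then show ?case using 5 by simp
qed

definition D0 where
  "D0 \<Delta> z w = (case inv (\<lambda>(x, y). k0 x y) z of (x, y) \<Rightarrow> case inv (\<lambda>(u, v). p0 u v) w of (u, v) \<Rightarrow> md (md \<Delta> x u) y v)"

lemma D0_eq [simp]: "D0 \<Delta> (k0 x y) (p0 u v) = md (md \<Delta> x u) y v"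
  by (simp add: D0_def inv_pair[OF k0_inj] inv_pair[OF p0_inj])

definition J1' where
  "J1' \<Delta> = mkmd Z H (J0' (MDom \<Delta>)) (J0' (MCod \<Delta>)) (D0 \<Delta>)"

lemma J1'_simps [simp]:
  "MDom (J1' \<Delta>) = J0' (MDom \<Delta>)" "MCod (J1' \<Delta>) = J0' (MCod \<Delta>)"
  "\<lbrakk>z \<in> C0 Z; w \<in> Obj (P0 H z)\<rbrakk> \<Longrightarrow> md (J1' \<Delta>) z w = D0 \<Delta> z w"
  by (simp_all add: J1'_def)

text \<open>The joint laws are glued from the outer laws of \<Delta>, called \<open>M\<close> and
  \<open>th\<close> below, and the laws of the single modifications
  \<open>md \<Delta> x u\<close>.\<close>

lemma J1'_mod:
  assumes \<Delta>: "modification X F TB \<Delta>"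
  shows "modification Z H R (J1' \<Delta>)"
proof -
  let ?\<sigma> = "MDom \<Delta>" and ?\<tau> = "MCod \<Delta>"
  have pn [simp]: "pseudonatural X F TB ?\<sigma>" "pseudonatural X F TB ?\<tau>"
    using ps.modification_MDom[OF ps_TB \<Delta>] ps.modification_MCod[OF ps_TB \<Delta>] by simp_all
  have D [simp]: "modification Y G (slice x) (md \<Delta> x u)" "MDom (md \<Delta> x u) = o0 ?\<sigma> x u" "MCod (md \<Delta> x u) = o0 ?\<tau> x u"
    if "x \<in> C0 X" "u \<in> Obj (P0 F x)" for x u
    using ps.md_simps[OF ps_TB \<Delta> that] by simp_all
  have c [simp]: "md (md \<Delta> x u) y v \<in> Arr (P0 R (k0 x y))" "Dom (P0 R (k0 x y)) (md (md \<Delta> x u) y v) = o0 (o0 ?\<sigma> x u) y v"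
    "Cod (P0 R (k0 x y)) (md (md \<Delta> x u) y v) = o0 (o0 ?\<tau> x u) y v"
    if "x \<in> C0 X" "u \<in> Obj (P0 F x)" "y \<in> C0 Y" "v \<in> Obj (P0 G y)" for x u y v
    using sl_md[OF that(1) D(1)[OF that(1,2)] that(3,4)] that by simp_all
  have M: "Comp (P0 R (k0 x y)) (md (md \<Delta> x (Cod (P0 F x) m)) y v) (md (o1 ?\<sigma> x m) y v) =
     Comp (P0 R (k0 x y)) (md (o1 ?\<tau> x m) y v) (md (md \<Delta> x (Dom (P0 F x) m)) y v)"
    if "x \<in> C0 X" "m \<in> Arr (P0 F x)" "y \<in> C0 Y" "v \<in> Obj (P0 G y)" for x m y v
    using arg_cong[OF ps.md_natural[OF ps_TB \<Delta> that(1,2)], of "\<lambda>\<Gamma>. md \<Gamma> y v"] that sl_md_Comp[of x] by simp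
  have th: "Comp (P0 R (k0 (Trg X f) y)) (md (o2 ?\<tau> f u) y v) (R.fa (L f y) (md (md \<Delta> (Src X f) u) y v)) =
     Comp (P0 R (k0 (Trg X f) y)) (md (md \<Delta> (Trg X f) (FObj (P1 F f) u)) y v) (md (o2 ?\<sigma> f u) y v)"
    if "f \<in> C1 X" "u \<in> Obj (P0 F (Src X f))" "y \<in> C0 Y" "v \<in> Obj (P0 G y)" for f u y v
    using arg_cong[OF ps.md_modif[OF ps_TB \<Delta> that(1,2)], of "\<lambda>\<Gamma>. md \<Gamma> y v"] that sl_md_Comp[of "Trg X f"] by simp
  show ?thesis
    unfolding J1'_def
  proof (rule ZR.modification_mkmd, goal_cases)
    case 3 show ?case
    proof (rule mdata.intro, goal_cases)
      case (1 z w)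
      show ?case by (rule pz_cases[OF 1]) simp
    next
      case (2 z w)
      show ?case by (rule pz_cases[OF 2]) simp
    next
      case (3 z w)
      show ?case by (rule pz_cases[OF 3]) simp
    next
      case (4 z l)
      show ?case
      proof (rule pm_cases[OF 4])
        fix x y m n assume a: "x \<in> C0 X" "y \<in> C0 Y" "m \<in> Arr (P0 F x)" "n \<in> Arr (P0 G y)" and [simp]: "z = k0 x y" "l = p1 m n"
        note [simp] = a
        let ?C = "P0 R (k0 x y)" and ?u = "Dom (P0 F x) m" and ?u' = "Cod (P0 F x) m" and ?v = "Dom (P0 G y) n" and ?v' = "Cod (P0 G y) n"
        have "Comp ?C (Comp ?C (o1 (o0 ?\<tau> x ?u') y n) (md (o1 ?\<tau> x m) y ?v)) (md (md \<Delta> x ?u) y ?v) =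
           Comp ?C (md (md \<Delta> x ?u') y ?v') (Comp ?C (o1 (o0 ?\<sigma> x ?u') y n) (md (o1 ?\<sigma> x m) y ?v))"
          by (rule paste_squares[where ?f2.0 = "md (md \<Delta> x ?u') y ?v"])
            (use M sl_md_natural[of x "md \<Delta> x ?u'" y n] in simp_all)
        then show ?thesis by simp
      qed
    next
      case (5 h w)
      show ?case
      proof (rule pf_cases[OF 5])
        fix f g u v assume f: "f \<in> C1 X" "g \<in> C1 Y" "u \<in> Obj (P0 F (Src X f))" "v \<in> Obj (P0 G (Src Y g))"
          and [simp]: "h = k1 f g" "w = p0 u v"
        note [simp] = f
        let ?x = "Src X f" and ?x' = "Trg X f" and ?y = "Src Y g" and ?y' = "Trg Y g"
        let ?C = "P0 R (k0 ?x' ?y')" and ?c = "md (md \<Delta> ?x u) ?y v" and ?u = "FObj (P1 F f) u"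
        let ?K = "\<lambda>\<tau>. K2 \<tau> (k1 f g) (p0 u v)" and ?h = "\<lambda>\<tau>. R.ph (V ?x' g) (L f ?y) (o0 (o0 \<tau> ?x u) ?y v)"
        let ?tv = "\<lambda>\<tau>. o2 (o0 \<tau> ?x' ?u) g v" and ?th = "\<lambda>\<tau>. R.fa (V ?x' g) (md (o2 \<tau> f u) ?y v)"
        let ?c' = "md (md \<Delta> ?x' ?u) ?y' (FObj (P1 G g) v)"
        note K = K2_fac[OF pn(1) f(1) refl refl f(2) refl refl f(3,4)]
        note K' = K2_fac[OF pn(2) f(1) refl refl f(2) refl refl f(3,4)]
        note [simp] = K(1-3) K'(1-3)
        \<comment> \<open>After composition with the comparison cell of \<open>V\<close> and
          \<open>L\<close>, \<open>K2_fac\<close> replaces both values of \<open>K2\<close>; the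
          component of \<Delta> then passes the \<open>L\<close> factor by \<open>th\<close> and the
          \<open>V\<close> factor by the inner modification law.\<close>
        have "Comp ?C (?K ?\<tau>) (R.fa (k1 f g) ?c) = Comp ?C ?c' (?K ?\<sigma>)"
        proof (rule iso_epi[of ?C "?h ?\<sigma>"])
          have "Comp ?C (Comp ?C (?K ?\<tau>) (R.fa (k1 f g) ?c)) (?h ?\<sigma>) =
             Comp ?C (?K ?\<tau>) (Comp ?C (?h ?\<tau>) (R.fa (V ?x' g) (R.fa (L f ?y) ?c)))"
            using R.ph_natural[of "L f ?y" "V ?x' g" ?c] by (simp add: Comp_assoc')
          also have "\<dots> = Comp ?C (?tv ?\<tau>) (Comp ?C (?th ?\<tau>) (R.fa (V ?x' g) (R.fa (L f ?y) ?c)))"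
            by (rule rew_left) (use K'(4) in simp_all)
          also have "Comp ?C (?th ?\<tau>) (R.fa (V ?x' g) (R.fa (L f ?y) ?c)) =
             Comp ?C (R.fa (V ?x' g) (md (md \<Delta> ?x' ?u) ?y v)) (?th ?\<sigma>)"
            using arg_cong[OF th[of f u ?y v], of "R.fa (V ?x' g)"] by simp
          also have "Comp ?C (?tv ?\<tau>) (Comp ?C (R.fa (V ?x' g) (md (md \<Delta> ?x' ?u) ?y v)) (?th ?\<sigma>)) =
             Comp ?C ?c' (Comp ?C (?tv ?\<sigma>) (?th ?\<sigma>))"
            by (rule rew_left) (use sl_md_modif[of ?x' "md \<Delta> ?x' ?u" g v] in simp_all)
          also have "Comp ?C (?tv ?\<sigma>) (?th ?\<sigma>) = Comp ?C (?K ?\<sigma>) (?h ?\<sigma>)"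
            using K(4) by simp
          finally show "Comp ?C (Comp ?C (?K ?\<tau>) (R.fa (k1 f g) ?c)) (?h ?\<sigma>) = Comp ?C (Comp ?C ?c' (?K ?\<sigma>)) (?h ?\<sigma>)"
            by (simp add: Comp_assoc')
        qed simp_all
        then show ?thesis by simp
      qed
    qed
  qed simp_all
qed

lemma J1'_J1:
  assumes \<Gamma> [simp]: "modification Z H R \<Gamma>"
  shows "J1' (J1 \<Gamma>) = \<Gamma>"
proof (rule ZR.modif_eqI, goal_cases)
  case (5 z w)
  show ?case by (rule pz_cases[OF 5]) simp
qed (simp_all add: J1'_mod J1_mod J0'_J0)

lemma J1_J1':
  assumes \<Delta>: "modification X F TB \<Delta>"
  shows "J1 (J1' \<Delta>) = \<Delta>"
proof (rule TB_modif_eqI, goal_cases)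
  case (5 x u)
  have pn: "pseudonatural X F TB (MDom \<Delta>)" "pseudonatural X F TB (MCod \<Delta>)"
    using ps.modification_MDom[OF ps_TB \<Delta>] ps.modification_MCod[OF ps_TB \<Delta>] by simp_all
  have "innerJ (J1' \<Delta>) x u = md \<Delta> x u"
    by (rule slice_modif_eqI[OF 5(1)]) (use 5 pn ps.md_simps[OF ps_TB \<Delta> 5] J1'_mod[OF \<Delta>] in \<open>simp_all add: inner_J0'\<close>)
  then show ?case using 5 by simp
qed (use J1'_mod[OF \<Delta>] \<Delta> ps.modification_MDom[OF ps_TB \<Delta>] ps.modification_MCod[OF ps_TB \<Delta>] in \<open>simp_all add: J1_mod J0_J0'\<close>)

theorem curry_isomorphic: "PS_hom Z H R \<cong>\<^sub>C PS_hom X F TB"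
proof (rule isomorphic_catI[OF J_functor])
  show "bij_betw (FObj J) (Obj (PS_hom Z H R)) (Obj (PS_hom X F TB))"
    by (rule bij_betw_byWitness[where f' = J0']) (auto simp: J0'_J0 J0_J0' J0_pn)
  show "bij_betw (FArr J) (Arr (PS_hom Z H R)) (Arr (PS_hom X F TB))"
    by (rule bij_betw_byWitness[where f' = J1']) (auto simp: J1'_J1 J1_J1' J1_mod J1'_mod)
qed simp_all

end

section \<open>The Fubini theorem\<close>

lemma two_category_end: "two_category A \<Longrightarrow> two_category (op2 A \<times>\<^sub>2 A)"
  by simp

text \<open>A hom category of the product 2-category consists of pairs of cells, so
  \<open>p0\<close> and \<open>p1\<close> are plain pairing; the maps \<open>k0\<close>,
  \<open>k1\<close>, \<open>k2\<close> only regroup the variables.\<close>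

lemma curry_iso_AB:
  assumes A: "two_category A" and B: "two_category B"
    and R: "pseudofunctor (op2 (A \<times>\<^sub>2 B) \<times>\<^sub>2 (A \<times>\<^sub>2 B)) CAT R"
  shows "curry_iso (op2 A \<times>\<^sub>2 A) (op2 B \<times>\<^sub>2 B) (op2 (A \<times>\<^sub>2 B) \<times>\<^sub>2 (A \<times>\<^sub>2 B))
    (hom_pfunc A) (hom_pfunc B) (hom_pfunc (A \<times>\<^sub>2 B)) R
    (\<lambda>(a, a') (b, b'). ((a, b), (a', b'))) (\<lambda>(a, a') (b, b'). ((a, b), (a', b')))
    (\<lambda>(a, a') (b, b'). ((a, b), (a', b'))) Pair Pair"
proof -
  interpret A: two_category A by fact
  interpret B: two_category B by fact
  have AB: "two_category (A \<times>\<^sub>2 B)" using A B by simp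
  show ?thesis
    by (intro curry_iso.intro curry.intro curry_axioms.intro curry_iso_axioms.intro cat_pf.intro
        two_category.strict_hom_pfunc A B AB R two_category_end) (auto simp: inj_def)
qed

text \<open>\<open>Z\<close>, \<open>H\<close> and \<open>R\<close> stay as in
  \<open>curry_iso_AB\<close> and only the pairings are flipped, so both orders curry the very same
  joint pseudoend.\<close>

lemma curry_iso_BA:
  assumes A: "two_category A" and B: "two_category B"
    and R: "pseudofunctor (op2 (A \<times>\<^sub>2 B) \<times>\<^sub>2 (A \<times>\<^sub>2 B)) CAT R"
  shows "curry_iso (op2 B \<times>\<^sub>2 B) (op2 A \<times>\<^sub>2 A) (op2 (A \<times>\<^sub>2 B) \<times>\<^sub>2 (A \<times>\<^sub>2 B))
    (hom_pfunc B) (hom_pfunc A) (hom_pfunc (A \<times>\<^sub>2 B)) R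
    (\<lambda>(b, b') (a, a'). ((a, b), (a', b'))) (\<lambda>(b, b') (a, a'). ((a, b), (a', b')))
    (\<lambda>(b, b') (a, a'). ((a, b), (a', b'))) (\<lambda>v u. (u, v)) (\<lambda>n m. (m, n))"
proof -
  interpret A: two_category A by fact
  interpret B: two_category B by fact
  have AB: "two_category (A \<times>\<^sub>2 B)" using A B by simp
  show ?thesis
    by (intro curry_iso.intro curry.intro curry_axioms.intro curry_iso_axioms.intro cat_pf.intro
        two_category.strict_hom_pfunc A B AB R two_category_end) (auto simp: inj_def)
qed

lemma pseudofunctor_regroup:
  assumes A: "two_category A" and B: "two_category B"
    and T: "pseudofunctor (op2 A \<times>\<^sub>2 op2 B \<times>\<^sub>2 A \<times>\<^sub>2 B) CAT T"
  shows "pseudofunctor (op2 (A \<times>\<^sub>2 B) \<times>\<^sub>2 (A \<times>\<^sub>2 B)) CAT (regroup T)"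
  unfolding regroup_def
  by (rule pseudofunctor_reindex[OF _ T]) (use A B in auto)

theorem theorem3p13:
  fixes A :: "('a0, 'a1, 'a2) two_cat" and B :: "('b0, 'b1, 'b2) two_cat"
    and T :: "('a0, 'a1, 'a2, 'b0, 'b1, 'b2, 'o, 'm) integrand"
  assumes "two_category A" and "two_category B"
    and "pseudofunctor (op2 A \<times>\<^sub>2 op2 B \<times>\<^sub>2 A \<times>\<^sub>2 B) CAT T"
  shows "\<exists>(TB :: ('a0 \<times> 'a0, 'a1 \<times> 'a1, 'a2 \<times> 'a2,
              ('b0, 'b1, 'b2, 'o, 'm) end_obj, ('b0, 'b1, 'b2, 'o, 'm) end_arr) cat_pfunc)
          (TA :: ('b0 \<times> 'b0, 'b1 \<times> 'b1, 'b2 \<times> 'b2,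
              ('a0, 'a1, 'a2, 'o, 'm) end_obj, ('a0, 'a1, 'a2, 'o, 'm) end_arr) cat_pfunc).
    pseudofunctor (op2 A \<times>\<^sub>2 A) CAT TB \<and>
    pseudofunctor (op2 B \<times>\<^sub>2 B) CAT TA \<and>
    (\<forall>x\<in>C0 A. \<forall>y\<in>C0 A. P0 TB (x, y) \<cong>\<^sub>C pseudoend B (fix_A A x y T)) \<and>
    (\<forall>w\<in>C0 B. \<forall>z\<in>C0 B. P0 TA (w, z) \<cong>\<^sub>C pseudoend A (fix_B B w z T)) \<and>
    pseudoend (A \<times>\<^sub>2 B) (regroup T) \<simeq>\<^sub>C pseudoend A TB \<and>
    pseudoend A TB \<simeq>\<^sub>C pseudoend B TA"
proof -
  note R = pseudofunctor_regroup[OF assms]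
  interpret AB: curry_iso "op2 A \<times>\<^sub>2 A" "op2 B \<times>\<^sub>2 B" "op2 (A \<times>\<^sub>2 B) \<times>\<^sub>2 (A \<times>\<^sub>2 B)"
    "hom_pfunc A" "hom_pfunc B" "hom_pfunc (A \<times>\<^sub>2 B)" "regroup T"
    "\<lambda>(a, a') (b, b'). ((a, b), (a', b'))" "\<lambda>(a, a') (b, b'). ((a, b), (a', b'))"
    "\<lambda>(a, a') (b, b'). ((a, b), (a', b'))" Pair Pair
    by (rule curry_iso_AB[OF assms(1,2) R])
  interpret BA: curry_iso "op2 B \<times>\<^sub>2 B" "op2 A \<times>\<^sub>2 A" "op2 (A \<times>\<^sub>2 B) \<times>\<^sub>2 (A \<times>\<^sub>2 B)"
    "hom_pfunc B" "hom_pfunc A" "hom_pfunc (A \<times>\<^sub>2 B)" "regroup T"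
    "\<lambda>(b, b') (a, a'). ((a, b), (a', b'))" "\<lambda>(b, b') (a, a'). ((a, b), (a', b'))"
    "\<lambda>(b, b') (a, a'). ((a, b), (a', b'))" "\<lambda>v u. (u, v)" "\<lambda>n m. (m, n)"
    by (rule curry_iso_BA[OF assms(1,2) R])
  \<comment> \<open>The slices agree with the required integrands as records, both inserting
    identity cells into \<open>T\<close>.\<close>
  have sA: "AB.slice (x, y) = fix_A A x y T" for x y
    unfolding AB.slice_def unfolding fix_A_def regroup_def reindex_def by (auto simp: fun_eq_iff)
  have sB: "BA.slice (w, z) = fix_B B w z T" for w z
    unfolding BA.slice_def unfolding fix_B_def regroup_def reindex_def by (auto simp: fun_eq_iff)
  \<comment> \<open>The value of \<open>TB\<close> is the pseudoend itself, so the isomorphism is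
    reflexivity, which only asks that it be a category.\<close>
  have iA: "P0 AB.TB (x, y) \<cong>\<^sub>C pseudoend B (fix_A A x y T)" if "x \<in> C0 A" "y \<in> C0 A" for x y
  proof -
    have "category (P0 AB.TB (x, y))"
      using ps.category_PS_hom[OF AB.ps_slice, of "(x, y)"] that by simp
    then show ?thesis
      using isomorphic_cat_refl by (simp add: sA pseudoend_def)
  qed
  have iB: "P0 BA.TB (w, z) \<cong>\<^sub>C pseudoend A (fix_B B w z T)" if "w \<in> C0 B" "z \<in> C0 B" for w z
  proof -
    have "category (P0 BA.TB (w, z))"
      using ps.category_PS_hom[OF BA.ps_slice, of "(w, z)"] that by simp
    then show ?thesis
      using isomorphic_cat_refl by (simp add: sB pseudoend_def)
  qed
  have 1: "pseudoend (A \<times>\<^sub>2 B) (regroup T) \<cong>\<^sub>C pseudoend A AB.TB"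
    unfolding pseudoend_def by (rule AB.curry_isomorphic)
  have 2: "pseudoend (A \<times>\<^sub>2 B) (regroup T) \<cong>\<^sub>C pseudoend B BA.TB"
    unfolding pseudoend_def by (rule BA.curry_isomorphic)
  \<comment> \<open>The two iterated pseudoends are compared through the joint one.\<close>
  show ?thesis
    by (rule exI[of _ AB.TB], rule exI[of _ BA.TB])
      (intro conjI ballI AB.pseudofunctor_TB BA.pseudofunctor_TB iA iB isomorphic_cat_equivalent[OF 1]
        isomorphic_cat_equivalent[OF isomorphic_cat_trans[OF isomorphic_cat_sym[OF 1] 2]]; assumption)
qed

end
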